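(* Let $S$ be a non-trivial stability theory or monic stability theory. Suppose that each stratum of $Str(S)$ is open in its closure. Then every $D$-stratum $(k,l,m)_S$ is semialgebraically homeomorphic to $$\Omega_s^{(k)}\times\Omega_{ss}^{(l)}\times\Omega_{un}^{(m)}.$$
   Context: A stability theory is $S=(X,\Omega,e)$ with $X=\mathbb{CP}^1$, $e=\infty$; a monic stability theory is $S=(X,\Omega,e)$ with $X=\mathbb C$, $e=0$; in both cases $\Omega\subseteq X$ is semialgebraic ($X$ viewed as a real algebraic variety). The strata $Str(S)$ are $\Omega_s=\Omega$, $\Omega_{ss}=\overline\Omega\setminus\Omega$, $\Omega_{un}=X\setminus\overline\Omega$ (Euclidean closure in $X$). $S$ is non-trivial if $\Omega\ne\varnothing$ and $\Omega\ne X$. For a semialgebraic space $Y$, $Y^{(n)}=Y^n/\Sigma_n$ is the $n$-th symmetric product, again a semialgebraic space, whose points are multisets of cardinality $n$ in $Y$. The $D$-stratum $(k,l,m)_S\subseteq X^{(k+l+m)}$ is the set of multisets with exactly $k,l,m$ points (with multiplicity) in $\Omega_s,\Omega_{ss},\Omega_{un}$. *)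

theory Defs
  imports "HOL-Analysis.Analysis"
begin

section \<open>Semialgebraic subsets of affine space\<close>

inductive polynomial_fun :: "nat \<Rightarrow> ((nat \<Rightarrow> real) \<Rightarrow> real) \<Rightarrow> bool" for n where
  const: "polynomial_fun n (\<lambda>x. c)"
| coord: "i < n \<Longrightarrow> polynomial_fun n (\<lambda>x. x i)"
| add: "polynomial_fun n p \<Longrightarrow> polynomial_fun n q \<Longrightarrow> polynomial_fun n (\<lambda>x. p x + q x)"
| mult: "polynomial_fun n p \<Longrightarrow> polynomial_fun n q \<Longrightarrow> polynomial_fun n (\<lambda>x. p x * q x)"

text \<open>The smallest Boolean algebra of subsets of $R^n$ that contains all sets $p > 0$.\<close>

inductive semialgebraic :: "nat \<Rightarrow> (nat \<Rightarrow> real) set \<Rightarrow> bool" for n where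
  pos: "polynomial_fun n p \<Longrightarrow> semialgebraic n {x \<in> topspace (Euclidean_space n). p x > 0}"
| compl: "semialgebraic n A \<Longrightarrow> semialgebraic n (topspace (Euclidean_space n) - A)"
| union: "semialgebraic n A \<Longrightarrow> semialgebraic n B \<Longrightarrow> semialgebraic n (A \<union> B)"

lemma semialgebraic_space: "semialgebraic n (topspace (Euclidean_space n))"
  using semialgebraic.pos[OF polynomial_fun.const[of n 1]] by simp

lemma semialgebraic_Int:
  assumes "semialgebraic n A" "semialgebraic n B"
  shows "semialgebraic n (A \<inter> B)"
proof -
  have sub: "semialgebraic n C \<Longrightarrow> C \<subseteq> topspace (Euclidean_space n)" for C
    by (induction rule: semialgebraic.induct) auto
  let ?T = "topspace (Euclidean_space n)"
  have "A \<inter> B = ?T - ((?T - A) \<union> (?T - B))" using sub assms by blast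
  then show ?thesis using assms by (metis semialgebraic.compl semialgebraic.union)
qed

lemma semialgebraic_zero_set:
  assumes "polynomial_fun n p"
  shows "semialgebraic n {x \<in> topspace (Euclidean_space n). p x = 0}"
proof -
  let ?T = "topspace (Euclidean_space n)"
  have "semialgebraic n {x \<in> ?T. (-1) * p x > 0}"
    by (intro semialgebraic.pos polynomial_fun.mult polynomial_fun.const assms)
  moreover have "semialgebraic n {x \<in> ?T. p x > 0}"
    by (rule semialgebraic.pos[OF assms])
  ultimately have "semialgebraic n (?T - ({x \<in> ?T. p x > 0} \<union> {x \<in> ?T. (-1) * p x > 0}))"
    by (intro semialgebraic.compl semialgebraic.union)
  also have "?T - ({x \<in> ?T. p x > 0} \<union> {x \<in> ?T. (-1) * p x > 0}) = {x \<in> ?T. p x = 0}"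
    by auto
  finally show ?thesis .
qed

lemma polynomial_fun_diff:
  assumes "polynomial_fun n p" "polynomial_fun n q"
  shows "polynomial_fun n (\<lambda>x. p x - q x)"
proof -
  have "polynomial_fun n (\<lambda>x. p x + (-1) * q x)"
    by (intro polynomial_fun.add polynomial_fun.mult polynomial_fun.const assms)
  then show ?thesis by simp
qed


section \<open>Semialgebraic spaces\<close>

text \<open>
  A semialgebraic space is given by its topology and a parametrisation \<open>sa_par\<close> of its points by
  a subset \<open>sa_dom\<close> of affine space of dimension \<open>sa_dim\<close>. The parametrisation need not be
  injective: it exhibits the space as a quotient (projective line, symmetric products), and a
  subset of the space is semialgebraic if and only if its inverse image is.
\<close>

record 'a sa_space =
  sa_top :: "'a topology"
  sa_dim :: nat
  sa_dom :: "(nat \<Rightarrow> real) set"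
  sa_par :: "(nat \<Rightarrow> real) \<Rightarrow> 'a"

definition sa_subset :: "'a sa_space \<Rightarrow> 'a set \<Rightarrow> bool" where
  "sa_subset M A \<longleftrightarrow>
     A \<subseteq> topspace (sa_top M) \<and> semialgebraic (sa_dim M) {x \<in> sa_dom M. sa_par M x \<in> A}"

text \<open>The coordinates \<open>a, \<dots>, a + d - 1\<close> of a point, as a point of $R^d$.\<close>

definition slice :: "nat \<Rightarrow> nat \<Rightarrow> (nat \<Rightarrow> real) \<Rightarrow> nat \<Rightarrow> real" where
  "slice a d x = (\<lambda>j. if j < d then x (a + j) else 0)"

definition sa_prod :: "'a sa_space \<Rightarrow> 'b sa_space \<Rightarrow> ('a \<times> 'b) sa_space" where
  "sa_prod M N =
     \<lparr>sa_top = prod_topology (sa_top M) (sa_top N),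
      sa_dim = sa_dim M + sa_dim N,
      sa_dom = {x \<in> topspace (Euclidean_space (sa_dim M + sa_dim N)).
                  slice 0 (sa_dim M) x \<in> sa_dom M \<and> slice (sa_dim M) (sa_dim N) x \<in> sa_dom N},
      sa_par = (\<lambda>x. (sa_par M (slice 0 (sa_dim M) x), sa_par N (slice (sa_dim M) (sa_dim N) x)))\<rparr>"

definition sa_sub :: "'a sa_space \<Rightarrow> 'a set \<Rightarrow> 'a sa_space" where
  "sa_sub M A =
     \<lparr>sa_top = subtopology (sa_top M) A,
      sa_dim = sa_dim M,
      sa_dom = {x \<in> sa_dom M. sa_par M x \<in> A},
      sa_par = sa_par M\<rparr>"

definition sa_map :: "'a sa_space \<Rightarrow> 'b sa_space \<Rightarrow> ('a \<Rightarrow> 'b) \<Rightarrow> bool" where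
  "sa_map M N f \<longleftrightarrow>
     continuous_map (sa_top M) (sa_top N) f \<and>
     sa_subset (sa_prod M N) ((\<lambda>p. (p, f p)) ` topspace (sa_top M))"

definition sa_homeomorphic :: "'a sa_space \<Rightarrow> 'b sa_space \<Rightarrow> bool" where
  "sa_homeomorphic M N \<longleftrightarrow>
     (\<exists>f g. homeomorphic_maps (sa_top M) (sa_top N) f g \<and> sa_map M N f \<and> sa_map N M g)"

text \<open>
  Compatibility of the topology and the parametrisation: the latter is an open quotient of a
  semialgebraic set by a semialgebraic equivalence relation.
\<close>

definition wf_sa_space :: "'a sa_space \<Rightarrow> bool" where
  "wf_sa_space M \<longleftrightarrow>
     semialgebraic (sa_dim M) (sa_dom M) \<and>
     sa_par M ` sa_dom M = topspace (sa_top M) \<and>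
     continuous_map (subtopology (Euclidean_space (sa_dim M)) (sa_dom M)) (sa_top M) (sa_par M) \<and>
     open_map (subtopology (Euclidean_space (sa_dim M)) (sa_dom M)) (sa_top M) (sa_par M) \<and>
     semialgebraic (sa_dim M + sa_dim M)
       {x \<in> topspace (Euclidean_space (sa_dim M + sa_dim M)).
          slice 0 (sa_dim M) x \<in> sa_dom M \<and> slice (sa_dim M) (sa_dim M) x \<in> sa_dom M \<and>
          sa_par M (slice 0 (sa_dim M) x) = sa_par M (slice (sa_dim M) (sa_dim M) x)}"


section \<open>Quotient topology and symmetric products\<close>

definition quotient_topology :: "'a topology \<Rightarrow> ('a \<Rightarrow> 'b) \<Rightarrow> 'b topology" where
  "quotient_topology T f =
     topology (\<lambda>U. U \<subseteq> f ` topspace T \<and> openin T {x \<in> topspace T. f x \<in> U})"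

lemma openin_quotient_topology:
  "openin (quotient_topology T f) U \<longleftrightarrow>
     U \<subseteq> f ` topspace T \<and> openin T {x \<in> topspace T. f x \<in> U}"
proof -
  have "istopology (\<lambda>U. U \<subseteq> f ` topspace T \<and> openin T {x \<in> topspace T. f x \<in> U})"
    unfolding istopology_def
  proof (intro conjI allI impI)
    fix S U
    assume S: "S \<subseteq> f ` topspace T \<and> openin T {x \<in> topspace T. f x \<in> S}"
      and U: "U \<subseteq> f ` topspace T \<and> openin T {x \<in> topspace T. f x \<in> U}"
    show "S \<inter> U \<subseteq> f ` topspace T" using S by blast
    have "{x \<in> topspace T. f x \<in> S \<inter> U} =
          {x \<in> topspace T. f x \<in> S} \<inter> {x \<in> topspace T. f x \<in> U}" by blast
    then show "openin T {x \<in> topspace T. f x \<in> S \<inter> U}" using S U by (simp add: openin_Int)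
  next
    fix K
    assume K: "\<forall>U\<in>K. U \<subseteq> f ` topspace T \<and> openin T {x \<in> topspace T. f x \<in> U}"
    show "\<Union>K \<subseteq> f ` topspace T" using K by blast
    have "{x \<in> topspace T. f x \<in> \<Union>K} = (\<Union>U\<in>K. {x \<in> topspace T. f x \<in> U})" by blast
    then show "openin T {x \<in> topspace T. f x \<in> \<Union>K}" using K by auto
  qed
  then show ?thesis
    by (simp add: quotient_topology_def topology_inverse')
qed

lemma topspace_quotient_topology: "topspace (quotient_topology T f) = f ` topspace T"
proof (rule antisym)
  show "topspace (quotient_topology T f) \<subseteq> f ` topspace T"
    using openin_topspace[of "quotient_topology T f"] unfolding openin_quotient_topology by blast
  have "{x \<in> topspace T. f x \<in> f ` topspace T} = topspace T" by blast
  then have "openin (quotient_topology T f) (f ` topspace T)"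
    by (simp add: openin_quotient_topology)
  then show "f ` topspace T \<subseteq> topspace (quotient_topology T f)"
    by (rule openin_subset)
qed

lemma quotient_map_quotient_topology: "quotient_map T (quotient_topology T f) f"
  by (auto simp: quotient_map_def topspace_quotient_topology openin_quotient_topology)

text \<open>The orbit map $Y^n \to Y^n/\Sigma_n$, where orbits are multisets of cardinality $n$.\<close>

definition mset_of_fun :: "nat \<Rightarrow> (nat \<Rightarrow> 'a) \<Rightarrow> 'a multiset" where
  "mset_of_fun n y = image_mset y (mset_set {..<n})"

definition sym_prod :: "nat \<Rightarrow> 'a sa_space \<Rightarrow> 'a multiset sa_space" where
  "sym_prod n Y =
     \<lparr>sa_top = quotient_topology (product_topology (\<lambda>i. sa_top Y) {..<n}) (mset_of_fun n),
      sa_dim = n * sa_dim Y,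
      sa_dom = {x \<in> topspace (Euclidean_space (n * sa_dim Y)).
                  \<forall>i<n. slice (i * sa_dim Y) (sa_dim Y) x \<in> sa_dom Y},
      sa_par = (\<lambda>x. mset_of_fun n (\<lambda>i. sa_par Y (slice (i * sa_dim Y) (sa_dim Y) x)))\<rparr>"


section \<open>The complex line and the complex projective line\<close>

definition complex_line :: "complex sa_space" where
  "complex_line =
     \<lparr>sa_top = euclidean,
      sa_dim = 2,
      sa_dom = topspace (Euclidean_space 2),
      sa_par = (\<lambda>x. Complex (x 0) (x 1))\<rparr>"

definition proportional :: "complex \<times> complex \<Rightarrow> complex \<times> complex \<Rightarrow> bool" where
  "proportional u v \<longleftrightarrow>
     u \<noteq> 0 \<and> v \<noteq> 0 \<and> (\<exists>c. c \<noteq> 0 \<and> v = (c * fst u, c * snd u))"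

lemma part_equivp_proportional: "part_equivp proportional"
proof (rule part_equivpI)
  show "\<exists>u. proportional u u"
    by (rule exI[of _ "(1, 0)"], auto simp: proportional_def zero_prod_def intro!: exI[of _ 1])
  show "symp proportional"
  proof (rule sympI)
    fix u v assume "proportional u v"
    then obtain c where c: "c \<noteq> 0" "v = (c * fst u, c * snd u)" "u \<noteq> 0" "v \<noteq> 0"
      by (auto simp: proportional_def)
    then have "u = (inverse c * fst v, inverse c * snd v)" by (simp add: prod_eq_iff)
    then show "proportional v u" using c unfolding proportional_def
      by (metis nonzero_imp_inverse_nonzero)
  qed
  show "transp proportional"
  proof (rule transpI)
    fix u v w assume "proportional u v" "proportional v w"
    then obtain c d where "c \<noteq> 0" "v = (c * fst u, c * snd u)" "d \<noteq> 0"
      "w = (d * fst v, d * snd v)" "u \<noteq> 0" "w \<noteq> 0"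
      by (auto simp: proportional_def)
    then have "d * c \<noteq> 0 \<and> w = (d * c * fst u, d * c * snd u)" by simp
    then show "proportional u w" using \<open>u \<noteq> 0\<close> \<open>w \<noteq> 0\<close> unfolding proportional_def by blast
  qed
qed

quotient_type cp1 = "complex \<times> complex" / partial: proportional
  by (rule part_equivp_proportional)

definition CP1 :: "cp1 sa_space" where
  "CP1 =
     \<lparr>sa_top = quotient_topology (top_of_set (- {0})) abs_cp1,
      sa_dim = 4,
      sa_dom = {x \<in> topspace (Euclidean_space 4). (Complex (x 0) (x 1), Complex (x 2) (x 3)) \<noteq> 0},
      sa_par = (\<lambda>x. abs_cp1 (Complex (x 0) (x 1), Complex (x 2) (x 3)))\<rparr>"

text \<open>The affine coordinate is $z \mapsto [z:1]$.\<close>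

definition cp1_infinity :: cp1 where
  "cp1_infinity = abs_cp1 (1, 0)"

lemma continuous_on_Euclidean_coordinate: "continuous_on S (\<lambda>x::nat \<Rightarrow> real. x i)"
  by (rule continuous_on_subset[OF continuous_on_product_coordinates]) simp

lemma subtopology_Euclidean_top_of_set:
  assumes "D \<subseteq> topspace (Euclidean_space n)"
  shows "subtopology (Euclidean_space n) D = top_of_set D"
proof -
  have "subtopology (Euclidean_space n) D = subtopology (powertop_real UNIV) ({x. \<forall>i\<ge>n. x i = 0} \<inter> D)"
    by (simp add: Euclidean_space_def subtopology_subtopology)
  also have "{x. \<forall>i\<ge>n. x i = 0} \<inter> D = D"
    using assms by (auto simp: topspace_Euclidean_space)
  finally show ?thesis by (simp add: euclidean_product_topology)
qed

lemma continuous_on_Complex [continuous_intros]: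
  "continuous_on S f \<Longrightarrow> continuous_on S g \<Longrightarrow> continuous_on S (\<lambda>x. Complex (f x) (g x))"
  unfolding Complex_eq by (intro continuous_intros)

lemma wf_complex_line: "wf_sa_space complex_line"
proof -
  let ?E = "topspace (Euclidean_space 2)"
  let ?f = "\<lambda>x::nat \<Rightarrow> real. Complex (x 0) (x 1)"
  let ?g = "\<lambda>z i. if i = 0 then Re z else if i = (1::nat) then Im z else 0"
  have gE: "?g z \<in> ?E" for z by (auto simp: topspace_Euclidean_space)
  have gf: "?g (?f x) = x" if "x \<in> ?E" for x
  proof
    fix i show "?g (?f x) i = x i"
      using that by (cases "i = 0 \<or> i = 1") (auto simp: topspace_Euclidean_space)
  qed
  have fg: "?f (?g z) = z" for z by (simp add: complex_eq_iff)
  have top: "subtopology (Euclidean_space 2) ?E = top_of_set ?E"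
    by (rule subtopology_Euclidean_top_of_set) simp
  have contf: "continuous_map (top_of_set ?E) euclidean ?f"
    by (simp, intro continuous_intros continuous_on_Euclidean_coordinate)
  have contg: "continuous_on UNIV ?g"
  proof (rule continuous_on_coordinatewise_then_product)
    fix i show "continuous_on UNIV (\<lambda>v. ?g v i)"
      by (cases "i = 0"; cases "i = 1"; cases "i = 2"; cases "i = 3")
         (auto intro!: continuous_intros)
  qed
  have hm: "homeomorphic_maps (top_of_set ?E) euclidean ?f ?g"
    unfolding homeomorphic_maps_def using contf contg gE gf fg
    by (auto simp: continuous_map_in_subtopology)
  have hf: "homeomorphic_map (top_of_set ?E) euclidean ?f"
    using homeomorphic_maps_map[THEN iffD1, OF hm] by (rule conjunct1)
  note op = homeomorphic_imp_open_map[OF hf]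
  have surj: "?f ` ?E = UNIV"
    using homeomorphic_imp_surjective_map[OF hf]
    unfolding topspace_euclidean_subtopology topspace_euclidean .
  let ?E4 = "topspace (Euclidean_space 4)"
  have p: "polynomial_fun 4 (\<lambda>x. x 0 - x 2)" "polynomial_fun 4 (\<lambda>x. x 1 - x 3)"
    by (intro polynomial_fun_diff polynomial_fun.coord; simp)+
  have "{x \<in> ?E4. slice 0 2 x \<in> ?E \<and> slice 2 2 x \<in> ?E \<and> ?f (slice 0 2 x) = ?f (slice 2 2 x)} =
        {x \<in> ?E4. x 0 - x 2 = 0} \<inter> {x \<in> ?E4. x 1 - x 3 = 0}"
    by (auto simp: slice_def topspace_Euclidean_space numeral_eq_Suc)
  then have rel: "semialgebraic 4 {x \<in> ?E4. slice 0 2 x \<in> ?E \<and> slice 2 2 x \<in> ?E \<and>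
      ?f (slice 0 2 x) = ?f (slice 2 2 x)}"
    using p by (simp only: semialgebraic_Int semialgebraic_zero_set)
  show ?thesis
    unfolding wf_sa_space_def complex_line_def sa_space.select_convs top topspace_euclidean
    using contf op surj rel by (intro conjI semialgebraic_space) simp_all
qed

lemma proportional_iff_det:
  assumes "u \<noteq> 0" "v \<noteq> 0"
  shows "proportional u v \<longleftrightarrow> fst u * snd v = snd u * fst v"
proof
  assume "proportional u v"
  then show "fst u * snd v = snd u * fst v" by (auto simp: proportional_def)
next
  assume d: "fst u * snd v = snd u * fst v"
  show "proportional u v"
  proof (cases "fst u = 0")
    case True
    then have "snd u \<noteq> 0" using assms by (simp add: prod_eq_iff)
    then have "fst v = 0" "snd v \<noteq> 0" using d True assms by (auto simp: prod_eq_iff)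
    then show ?thesis unfolding proportional_def using assms True \<open>snd u \<noteq> 0\<close>
      by (intro conjI exI[of _ "snd v / snd u"]) (auto simp: prod_eq_iff)
  next
    case False
    then have "fst v \<noteq> 0" using d assms by (auto simp: prod_eq_iff)
    then show ?thesis unfolding proportional_def using assms d False
      by (intro conjI exI[of _ "fst v / fst u"]) (auto simp: prod_eq_iff field_simps)
  qed
qed

lemma abs_cp1_eq_iff:
  assumes "u \<noteq> 0" "v \<noteq> 0"
  shows "abs_cp1 u = abs_cp1 v \<longleftrightarrow> fst u * snd v = snd u * fst v"
proof -
  have "proportional u u" "proportional v v" using assms by (auto simp: proportional_iff_det)
  then have "abs_cp1 u = abs_cp1 v \<longleftrightarrow> proportional u v"
    using Quotient3_rel[OF Quotient3_cp1] by blast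
  then show ?thesis using assms by (simp add: proportional_iff_det)
qed

lemma open_map_abs_cp1:
  "open_map (top_of_set (- {0})) (quotient_topology (top_of_set (- {0})) abs_cp1) abs_cp1"
  unfolding open_map_def
proof (intro allI impI)
  fix U :: "(complex \<times> complex) set"
  assume "openin (top_of_set (- {0})) U"
  then have U: "open U" "U \<subseteq> - {0}" by (simp_all add: openin_open_eq subset_Compl_singleton open_Compl)
  let ?V = "\<lambda>c. (\<lambda>v. (c * fst v, c * snd v)) -` U"
  have "{v \<in> - {0}. abs_cp1 v \<in> abs_cp1 ` U} = (\<Union>c \<in> - {0}. ?V c)"
  proof (intro set_eqI iffI)
    fix v assume "v \<in> {v \<in> - {0}. abs_cp1 v \<in> abs_cp1 ` U}"
    then obtain u where u: "u \<in> U" "abs_cp1 v = abs_cp1 u" "v \<noteq> 0" by auto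
    moreover from this U have "u \<noteq> 0" by auto
    ultimately have "proportional v u" by (auto simp: abs_cp1_eq_iff proportional_iff_det)
    then show "v \<in> (\<Union>c \<in> - {0}. ?V c)" using u by (auto simp: proportional_def)
  next
    fix v assume "v \<in> (\<Union>c \<in> - {0}. ?V c)"
    then obtain c where c: "c \<noteq> 0" "(c * fst v, c * snd v) \<in> U" by auto
    then have n: "(c * fst v, c * snd v) \<noteq> 0" using U by auto
    then have v: "v \<noteq> 0" by (auto simp: zero_prod_def)
    from v n have "abs_cp1 v = abs_cp1 (c * fst v, c * snd v)" by (simp add: abs_cp1_eq_iff)
    then show "v \<in> {v \<in> - {0}. abs_cp1 v \<in> abs_cp1 ` U}" using v c by auto
  qed
  moreover have "open (?V c)" for c
    using U(1) by (intro continuous_open_vimage continuous_intros)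
  ultimately have "open {v \<in> - {0}. abs_cp1 v \<in> abs_cp1 ` U}" by auto
  then have "openin (top_of_set (- {0})) {v \<in> - {0}. abs_cp1 v \<in> abs_cp1 ` U}"
    by (rule open_subset[rotated]) auto
  then show "openin (quotient_topology (top_of_set (- {0})) abs_cp1) (abs_cp1 ` U)"
    using U(2) by (auto simp: openin_quotient_topology)
qed

lemma wf_CP1: "wf_sa_space CP1"
proof -
  let ?E = "topspace (Euclidean_space 4)"
  let ?f = "\<lambda>x::nat \<Rightarrow> real. (Complex (x 0) (x 1), Complex (x 2) (x 3))"
  let ?D = "{x \<in> ?E. ?f x \<noteq> 0}"
  let ?g = "\<lambda>v i. if i = 0 then Re (fst v) else if i = (1::nat) then Im (fst v) else
                   if i = 2 then Re (snd v) else if i = 3 then Im (snd v) else 0"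
  have gE: "?g v \<in> ?E" for v by (auto simp: topspace_Euclidean_space)
  have gf: "?g (?f x) = x" if "x \<in> ?E" for x
  proof
    fix i show "?g (?f x) i = x i"
      using that by (cases "i < 4") (auto simp: topspace_Euclidean_space numeral_eq_Suc less_Suc_eq)
  qed
  have fg: "?f (?g v) = v" for v by (simp add: prod_eq_iff complex_eq_iff)
  have top: "subtopology (Euclidean_space 4) ?D = top_of_set ?D"
    by (rule subtopology_Euclidean_top_of_set) auto
  have contf: "continuous_on ?D ?f"
    by (intro continuous_intros continuous_on_Euclidean_coordinate)
  have contg: "continuous_on (- {0}) ?g"
  proof (rule continuous_on_coordinatewise_then_product)
    fix i show "continuous_on (- {0}) (\<lambda>v. ?g v i)"
      by (cases "i = 0"; cases "i = 1"; cases "i = 2"; cases "i = 3")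
         (auto intro!: continuous_intros)
  qed
  have gD: "?g v \<in> ?D" if "v \<noteq> 0" for v using gE[of v] fg[of v] that by simp
  have hm: "homeomorphic_maps (top_of_set ?D) (top_of_set (- {0})) ?f ?g"
    unfolding homeomorphic_maps_def using contf contg gD gf fg
    by (auto simp: continuous_map_in_subtopology)
  have hf: "homeomorphic_map (top_of_set ?D) (top_of_set (- {0})) ?f"
    using homeomorphic_maps_map[THEN iffD1, OF hm] by (rule conjunct1)
  note op = homeomorphic_imp_open_map[OF hf]
  note cf = homeomorphic_imp_continuous_map[OF hf]
  let ?T = "quotient_topology (top_of_set (- {0})) abs_cp1"
  have op': "open_map (top_of_set ?D) ?T (\<lambda>x. abs_cp1 (?f x))"
    using open_map_compose[OF op open_map_abs_cp1] by (simp add: o_def)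
  have cont': "continuous_map (top_of_set ?D) ?T (\<lambda>x. abs_cp1 (?f x))"
    using continuous_map_compose[OF cf quotient_imp_continuous_map[OF quotient_map_quotient_topology]]
    by (simp add: o_def)
  have surj: "?f ` ?D = - {0}"
    using homeomorphic_imp_surjective_map[OF hf] unfolding topspace_euclidean_subtopology .
  have surj': "(\<lambda>x. abs_cp1 (?f x)) ` ?D = topspace ?T"
    unfolding topspace_quotient_topology topspace_euclidean_subtopology surj[symmetric]
    by (rule image_image[symmetric])
  note pcoord = polynomial_fun.coord polynomial_fun.mult polynomial_fun.add polynomial_fun_diff
  have "semialgebraic 4 (?E - ({x \<in> ?E. x 0 = 0} \<inter> {x \<in> ?E. x 1 = 0} \<inter> {x \<in> ?E. x 2 = 0} \<inter> {x \<in> ?E. x 3 = 0}))"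
    by (intro semialgebraic.compl semialgebraic_Int semialgebraic_zero_set polynomial_fun.coord) simp_all
  also have "?E - ({x \<in> ?E. x 0 = 0} \<inter> {x \<in> ?E. x 1 = 0} \<inter> {x \<in> ?E. x 2 = 0} \<inter> {x \<in> ?E. x 3 = 0}) = ?D"
    by (auto simp: zero_prod_def complex_eq_iff)
  finally have dom: "semialgebraic 4 ?D" .
  let ?E8 = "topspace (Euclidean_space 8)"
  let ?R = "\<lambda>x::nat \<Rightarrow> real. (x 0 * x 6 - x 1 * x 7) - (x 2 * x 4 - x 3 * x 5)"
  let ?I = "\<lambda>x::nat \<Rightarrow> real. (x 0 * x 7 + x 1 * x 6) - (x 2 * x 5 + x 3 * x 4)"
  let ?A = "?E8 - ({x \<in> ?E8. x 0 = 0} \<inter> {x \<in> ?E8. x 1 = 0} \<inter> {x \<in> ?E8. x 2 = 0} \<inter> {x \<in> ?E8. x 3 = 0})"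
  let ?B = "?E8 - ({x \<in> ?E8. x 4 = 0} \<inter> {x \<in> ?E8. x 5 = 0} \<inter> {x \<in> ?E8. x 6 = 0} \<inter> {x \<in> ?E8. x 7 = 0})"
  have sE: "slice a 4 x \<in> ?E" for a x by (simp add: slice_def topspace_Euclidean_space)
  have f0: "?f (slice 0 4 x) = (Complex (x 0) (x 1), Complex (x 2) (x 3))" for x
    by (simp add: slice_def numeral_eq_Suc)
  have f4: "?f (slice 4 4 x) = (Complex (x 4) (x 5), Complex (x 6) (x 7))" for x
    by (simp add: slice_def numeral_eq_Suc)
  have zD: "(Complex a b, Complex c d) = 0 \<longleftrightarrow> a = 0 \<and> b = 0 \<and> c = 0 \<and> d = 0" for a b c d
    by (auto simp: zero_prod_def complex_eq_iff)
  have det: "abs_cp1 (Complex a b, Complex c d) = abs_cp1 (Complex a' b', Complex c' d') \<longleftrightarrow>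
      (a * c' - b * d') - (c * a' - d * b') = 0 \<and> (a * d' + b * c') - (c * b' + d * a') = 0"
    if "(Complex a b, Complex c d) \<noteq> 0" "(Complex a' b', Complex c' d') \<noteq> 0"
    for a b c d a' b' c' d'
    using that by (simp add: abs_cp1_eq_iff complex_eq_iff)
  have eq: "{x \<in> ?E8. slice 0 4 x \<in> ?D \<and> slice 4 4 x \<in> ?D \<and>
          abs_cp1 (?f (slice 0 4 x)) = abs_cp1 (?f (slice 4 4 x))} =
        ?A \<inter> ?B \<inter> {x \<in> ?E8. ?R x = 0} \<inter> {x \<in> ?E8. ?I x = 0}" (is "?L = ?N")
  proof (rule set_eqI)
    fix x
    have "x \<in> ?L \<longleftrightarrow> x \<in> ?E8 \<and> (Complex (x 0) (x 1), Complex (x 2) (x 3)) \<noteq> 0 \<and>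
        (Complex (x 4) (x 5), Complex (x 6) (x 7)) \<noteq> 0 \<and>
        abs_cp1 (Complex (x 0) (x 1), Complex (x 2) (x 3)) =
        abs_cp1 (Complex (x 4) (x 5), Complex (x 6) (x 7))"
      using sE f0 f4 by simp
    also have "\<dots> \<longleftrightarrow> x \<in> ?E8 \<and> (Complex (x 0) (x 1), Complex (x 2) (x 3)) \<noteq> 0 \<and>
        (Complex (x 4) (x 5), Complex (x 6) (x 7)) \<noteq> 0 \<and> ?R x = 0 \<and> ?I x = 0"
      using det by blast
    also have "\<dots> \<longleftrightarrow> x \<in> ?N" unfolding zD by blast
    finally show "x \<in> ?L \<longleftrightarrow> x \<in> ?N" .
  qed
  have rel: "semialgebraic 8 {x \<in> ?E8. slice 0 4 x \<in> ?D \<and> slice 4 4 x \<in> ?D \<and>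
          abs_cp1 (?f (slice 0 4 x)) = abs_cp1 (?f (slice 4 4 x))}"
    unfolding eq
    by (intro semialgebraic_Int semialgebraic.compl semialgebraic_zero_set pcoord) simp_all
  show ?thesis
    unfolding wf_sa_space_def CP1_def sa_space.select_convs top
    using dom surj' cont' op' rel by (intro conjI) simp_all
qed


section \<open>Stability theories\<close>

record 'a stability_data =
  ambient :: "'a sa_space"
  stable :: "'a set"
  basepoint :: 'a

definition stability_theory :: "cp1 stability_data \<Rightarrow> bool" where
  "stability_theory S \<longleftrightarrow>
     ambient S = CP1 \<and> sa_subset CP1 (stable S) \<and> basepoint S = cp1_infinity"

definition monic_stability_theory :: "complex stability_data \<Rightarrow> bool" where
  "monic_stability_theory S \<longleftrightarrow>
     ambient S = complex_line \<and> sa_subset complex_line (stable S) \<and> basepoint S = 0"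

definition nontrivial :: "'a stability_data \<Rightarrow> bool" where
  "nontrivial S \<longleftrightarrow> stable S \<noteq> {} \<and> stable S \<noteq> topspace (sa_top (ambient S))"

definition Omega_s :: "'a stability_data \<Rightarrow> 'a set" where
  "Omega_s S = stable S"

definition Omega_ss :: "'a stability_data \<Rightarrow> 'a set" where
  "Omega_ss S = (sa_top (ambient S) closure_of stable S) - stable S"

definition Omega_un :: "'a stability_data \<Rightarrow> 'a set" where
  "Omega_un S = topspace (sa_top (ambient S)) - (sa_top (ambient S) closure_of stable S)"

definition Str :: "'a stability_data \<Rightarrow> 'a set set" where
  "Str S = {Omega_s S, Omega_ss S, Omega_un S}"

definition open_in_closure :: "'a topology \<Rightarrow> 'a set \<Rightarrow> bool" where
  "open_in_closure T A \<longleftrightarrow> openin (subtopology T (T closure_of A)) A"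

definition D_stratum :: "'a stability_data \<Rightarrow> nat \<Rightarrow> nat \<Rightarrow> nat \<Rightarrow> 'a multiset set" where
  "D_stratum S k l m =
     {M \<in> topspace (sa_top (sym_prod (k + l + m) (ambient S))).
        size (filter_mset (\<lambda>p. p \<in> Omega_s S) M) = k \<and>
        size (filter_mset (\<lambda>p. p \<in> Omega_ss S) M) = l \<and>
        size (filter_mset (\<lambda>p. p \<in> Omega_un S) M) = m}"

end

theory Submission
  imports Defs
begin

text \<open>
  The addition of multisets \<open>(P, Q, R) \<mapsto> P + Q + R\<close> is a continuous bijection from
  \<open>\<Omega>\<^sub>s\<^sup>(\<^sup>k\<^sup>) \<times> \<Omega>\<^sub>s\<^sub>s\<^sup>(\<^sup>l\<^sup>) \<times> \<Omega>\<^sub>u\<^sub>n\<^sup>(\<^sup>m\<^sup>)\<close> onto the stratum; its inverse sorts the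
  points by stratum. Two things have to be seen: that sorting is continuous, and that the graphs
  are semialgebraic.

  Continuity. The unstable set is the complement of a closure, hence open. The stable set is open in its
  closure, hence the strictly semistable set is closed. Let \<open>M'\<close> be a multiset of the stratum near
  \<open>M\<close>. The \<open>m\<close> points of \<open>M'\<close> near unstable points are unstable, so by the count no other
  points are. The \<open>k\<close> points near stable points are not strictly semistable, so they are stable, and
  again by the count the remaining \<open>l\<close> points are strictly semistable. Hence the points of \<open>M'\<close> near
  each part of \<open>M\<close> form the corresponding part of \<open>M'\<close> (\<open>split_in_separating_box\<close>,
  \<open>split_continuous\<close>).

  Graphs. In coordinates, both graphs say that one tuple of points is a permutation of another tuple whose
  entries lie in prescribed strata. This is a finite Boolean combination of conditions on single points and
  pairs of points (\<open>semialgebraic_sum_relation\<close>), provided that the strata are semialgebraic. Two of them are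
  defined by a closure, so it is necessary to know that the closure of a semialgebraic set is
  semialgebraic (\<open>sa_subset_closure\<close>). Closures are described by quantifiers over real numbers, and this is where the
  Tarski-Seidenberg theorem enters (\<open>semialgebraic_projection\<close>).

  The projection theorem is proved in the manner of Cohen and Hoermander. Two parameters \<open>x\<close>, \<open>x'\<close> are called
  equivalent for a finite set of families of univariate polynomials if an increasing bijection of the
  line carries the signs of \<open>P x\<close> to those of \<open>P x'\<close> for every family \<open>P\<close>. It is shown that
  the parameter space is covered by finitely many semialgebraic sets of equivalent parameters
  (\<open>tame_families\<close>). The induction replaces a family of maximal degree by its derivative and its remainders
  modulo the other families and the derivative: at the roots of these, the sign of \<open>P\<close> is the sign of a
  remainder, and between neighbouring roots \<open>P\<close> is monotone, so the bijection can be corrected there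
  (\<open>increasing_bijection_matching_signs\<close>, \<open>sign_equiv_insert\<close>).
\<close>


section \<open>Transporting the signs of one polynomial along the line\<close>

definition increasing_bijection :: "(real \<Rightarrow> real) \<Rightarrow> bool" where
  "increasing_bijection \<theta> \<longleftrightarrow> strict_mono \<theta> \<and> surj \<theta>"

lemma increasing_bijection_less_iff:
  "increasing_bijection \<theta> \<Longrightarrow> \<theta> x < \<theta> y \<longleftrightarrow> x < y"
  by (simp add: increasing_bijection_def strict_mono_less)

lemma increasing_bijection_compose:
  "increasing_bijection \<theta> \<Longrightarrow> increasing_bijection \<tau> \<Longrightarrow> increasing_bijection (\<theta> \<circ> \<tau>)"
  unfolding increasing_bijection_def strict_mono_def by (metis comp_surj comp_apply)

text \<open>
  This is the piecewise linear map through \<open>(a, a)\<close>, \<open>(r, s)\<close>, \<open>(b, b)\<close>, extended by the identity. It corrects a sign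
  matching at one point and leaves everything outside one gap as it was.
\<close>

lemma increasing_bijection_moving_point:
  fixes a b r s :: real
  assumes "a < r" "r < b" "a < s" "s < b"
  obtains \<tau> where "increasing_bijection \<tau>" "\<tau> r = s" "\<And>y. y \<le> a \<or> b \<le> y \<Longrightarrow> \<tau> y = y"
proof
  define c where "c = (s - a) / (r - a)"
  define d where "d = (b - s) / (b - r)"
  define \<tau> where "\<tau> = (\<lambda>y. if y \<le> a \<or> b \<le> y then y
     else if y \<le> r then a + (y - a) * c else b - (b - y) * d)"
  define \<sigma> where "\<sigma> = (\<lambda>y. if y \<le> a \<or> b \<le> y then y
     else if y \<le> s then a + (y - a) / c else b - (b - y) / d)"
  have cd: "c > 0" "d > 0" "(r - a) * c = s - a" "(b - r) * d = b - s"
    using assms by (simp_all add: c_def d_def)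
  have left: "a < a + (y - a) * c \<and> a + (y - a) * c \<le> s" if "a < y" "y \<le> r" for y
  proof -
    have "(y - a) * c \<le> (r - a) * c" using that cd by (intro mult_right_mono) auto
    moreover have "0 < (y - a) * c" using that cd by (intro mult_pos_pos) auto
    ultimately show ?thesis using cd by linarith
  qed
  have right: "s < b - (b - y) * d \<and> b - (b - y) * d < b" if "r < y" "y < b" for y
  proof -
    have "(b - y) * d < (b - r) * d" using that cd by (intro mult_strict_right_mono) auto
    moreover have "0 < (b - y) * d" using that cd by (intro mult_pos_pos) auto
    ultimately show ?thesis using cd by linarith
  qed
  show "\<And>y. y \<le> a \<or> b \<le> y \<Longrightarrow> \<tau> y = y" by (simp add: \<tau>_def)
  show "\<tau> r = s" using assms cd by (simp add: \<tau>_def)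
  have "strict_mono \<tau>"
  proof (rule strict_monoI)
    fix x y :: real assume xy: "x < y"
    have "(x - a) * c < (y - a) * c" "(b - y) * d < (b - x) * d"
      using cd xy by (intro mult_strict_right_mono; simp)+
    then show "\<tau> x < \<tau> y"
      using xy left[of x] left[of y] right[of x] right[of y] assms unfolding \<tau>_def
      by (smt (verit))
  qed
  moreover have "\<tau> (\<sigma> y) = y" for y
  proof (cases "y \<le> a \<or> b \<le> y")
    case True then show ?thesis by (simp add: \<tau>_def \<sigma>_def)
  next
    case False
    show ?thesis
    proof (cases "y \<le> s")
      case True
      have "(y - a) / c \<le> (s - a) / c" using True cd by (intro divide_right_mono) auto
      also have "(s - a) / c = r - a" using cd by (simp add: field_simps)
      finally have "(y - a) / c \<le> r - a" .
      moreover have "(y - a) / c > 0" using False cd by auto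
      ultimately show ?thesis using True False assms cd
        by (simp add: \<tau>_def \<sigma>_def divide_le_0_iff)
    next
      case n: False
      have "(b - y) / d < (b - s) / d" using n cd by (intro divide_strict_right_mono) auto
      also have "(b - s) / d = b - r" using cd by (simp add: field_simps)
      finally have "(b - y) / d < b - r" .
      moreover have "(b - y) / d > 0" using False cd by auto
      ultimately show ?thesis using n False assms cd
        by (simp add: \<tau>_def \<sigma>_def divide_le_0_iff)
    qed
  qed
  ultimately show "increasing_bijection \<tau>"
    unfolding increasing_bijection_def by (metis surjI)
qed

lemma poly_same_sign:
  fixes p :: "real poly"
  assumes "\<And>w. min u v \<le> w \<Longrightarrow> w \<le> max u v \<Longrightarrow> poly p w \<noteq> 0"
  shows "sgn (poly p u) = sgn (poly p v)"
proof -
  have *: "sgn (poly p u) = sgn (poly p v)" 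
    if "u \<le> v" and nz: "\<And>w. u \<le> w \<Longrightarrow> w \<le> v \<Longrightarrow> poly p w \<noteq> 0" for u v
  proof (rule ccontr)
    assume ne: "sgn (poly p u) \<noteq> sgn (poly p v)"
    then have "u < v" using that(1) by (cases "u = v") auto
    moreover have "poly p u \<noteq> 0" "poly p v \<noteq> 0" using nz that(1) by auto
    ultimately obtain w where "u < w" "w < v" "poly p w = 0"
      using ne poly_IVT_pos[of u v p] poly_IVT_neg[of u v p]
      by (auto simp: sgn_if split: if_splits)
    then show False using nz[of w] by auto
  qed
  show ?thesis
  proof (cases "u \<le> v")
    case True
    then show ?thesis by (intro *) (use assms in auto)
  next
    case False
    then have "sgn (poly p v) = sgn (poly p u)" by (intro *) (use assms in auto)
    then show ?thesis by simp
  qed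
qed

text \<open>
  On a gap \<open>(a, b)\<close> between critical points a polynomial is strictly monotone, and the sign of
  the derivative at any point of the gap tells in which direction.
\<close>

lemma sgn_poly_diff:
  fixes p :: "real poly"
  assumes "u < v" "u \<le> y" "y \<le> v" "a \<le> u" "v \<le> b" "a < y" "y < b"
    and nz: "\<And>w. a < w \<Longrightarrow> w < b \<Longrightarrow> poly (pderiv p) w \<noteq> 0"
  shows "sgn (poly p v - poly p u) = sgn (poly (pderiv p) y)"
proof -
  obtain c where c: "u < c" "c < v" "poly p v - poly p u = (v - u) * poly (pderiv p) c"
    using poly_MVT[OF assms(1), of p] by blast
  have "sgn (poly (pderiv p) c) = sgn (poly (pderiv p) y)"
    by (rule poly_same_sign) (use assms c in \<open>auto intro!: nz simp: min_def max_def split: if_splits\<close>)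
  then show ?thesis using c(3) assms(1) by (simp add: sgn_mult)
qed

lemma sgn_poly_right_end:
  fixes p :: "real poly"
  assumes "\<And>w. N \<le> w \<Longrightarrow> poly p w \<noteq> 0"
  shows "sgn (poly p N) = sgn (lead_coeff p)"
proof -
  have *: "sgn (poly p N) = 1" if pos: "lead_coeff p > 0" and nz: "\<And>w. N \<le> w \<Longrightarrow> poly p w \<noteq> 0" for p :: "real poly"
  proof -
    obtain n where n: "\<forall>x\<ge>n. lead_coeff p \<le> poly p x"
      using poly_pinfty_gt_lc[OF pos] by blast
    have "poly p (max n N) > 0" using n pos by (metis less_le_trans max.cobounded1)
    moreover have "sgn (poly p N) = sgn (poly p (max n N))"
      by (rule poly_same_sign) (use nz in auto)
    ultimately show ?thesis by simp
  qed
  have "lead_coeff p \<noteq> 0" using assms[of N] by auto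
  then consider "lead_coeff p > 0" | "lead_coeff (-p) > 0" 
    by (metis lead_coeff_minus neg_0_less_iff_less linorder_neqE)
  then show ?thesis
  proof cases
    case 1 then show ?thesis using *[of p] assms by simp
  next
    case 2 
    then have "sgn (poly (-p) N) = 1" using *[of "-p"] assms by simp
    then show ?thesis using 2 by (simp add: sgn_if lead_coeff_minus split: if_splits)
  qed
qed

text \<open>
  Beyond all roots both signs are those of the leading coefficients, which differ by the positive
  factor \<open>degree p\<close>.
\<close>

lemma sgn_pderiv_right_end:
  fixes p :: "real poly"
  assumes "\<And>w. N \<le> w \<Longrightarrow> poly p w \<noteq> 0" "\<And>w. N \<le> w \<Longrightarrow> poly (pderiv p) w \<noteq> 0"
  shows "sgn (poly p N) = sgn (poly (pderiv p) N)"
proof -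
  have "degree p \<noteq> 0" using assms(2)[OF order_refl] by (metis pderiv_eq_0_iff poly_0)
  then have "lead_coeff (pderiv p) = of_nat (degree p) * lead_coeff p"
    by (simp add: degree_pderiv coeff_pderiv)
  then have "sgn (lead_coeff (pderiv p)) = sgn (lead_coeff p)"
    using \<open>degree p \<noteq> 0\<close> by (simp add: sgn_mult)
  then show ?thesis using sgn_poly_right_end assms by metis
qed

lemma sgn_pderiv_left_end:
  fixes p :: "real poly"
  assumes "\<And>w. w \<le> N \<Longrightarrow> poly p w \<noteq> 0" "\<And>w. w \<le> N \<Longrightarrow> poly (pderiv p) w \<noteq> 0"
  shows "sgn (poly p N) = - sgn (poly (pderiv p) N)"
proof -
  let ?q = "pcompose p [:0, -1:]"
  have "sgn (poly ?q (- N)) = sgn (poly (pderiv ?q) (- N))"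
    by (rule sgn_pderiv_right_end)
       (use assms in \<open>auto simp: poly_pcompose pderiv_pcompose pderiv_pCons\<close>)
  then show ?thesis by (simp add: poly_pcompose pderiv_pcompose pderiv_pCons sgn_minus)
qed

text \<open>
  If \<open>\<theta>\<close> and \<open>\<theta>'\<close> agree on \<open>Z\<close>, then \<open>\<theta> y\<close> and \<open>\<theta>' y\<close> lie in the same gap of \<open>\<theta> ` Z\<close>, and \<open>q\<close>
  has no root in that gap. Hence a matching may be changed freely inside the gaps without
  spoiling the polynomials whose roots are in \<open>Z\<close>.
\<close>

lemma sgn_poly_transport:
  fixes p q :: "real poly"
  assumes \<theta>: "increasing_bijection \<theta>" and \<theta>': "increasing_bijection \<theta>'"
    and eq: "\<And>z. z \<in> Z \<Longrightarrow> \<theta>' z = \<theta> z"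
    and roots: "\<And>w. poly q w = 0 \<Longrightarrow> w \<in> \<theta> ` Z"
    and sgn: "\<And>y. sgn (poly p y) = sgn (poly q (\<theta> y))"
  shows "sgn (poly p y) = sgn (poly q (\<theta>' y))"
proof (cases "y \<in> Z")
  case True
  then show ?thesis using eq sgn by simp
next
  case False
  have "sgn (poly q (\<theta> y)) = sgn (poly q (\<theta>' y))"
  proof (rule poly_same_sign, rule notI)
    fix w assume w: "min (\<theta> y) (\<theta>' y) \<le> w" "w \<le> max (\<theta> y) (\<theta>' y)" "poly q w = 0"
    then obtain z where z: "z \<in> Z" "w = \<theta> z" using roots by auto
    then have "w = \<theta>' z" using eq by simp
    have "\<not> y < z" "\<not> z < y"
      using w(1,2) z(2) \<open>w = \<theta>' z\<close> increasing_bijection_less_iff[OF \<theta>, of y z]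
        increasing_bijection_less_iff[OF \<theta>, of z y]
        increasing_bijection_less_iff[OF \<theta>', of y z] increasing_bijection_less_iff[OF \<theta>', of z y]
      by linarith+
    then have "z = y" by simp
    then show False using False z by simp
  qed
  then show ?thesis using sgn by simp
qed

lemma finite_gap:
  fixes Z :: "real set"
  assumes "finite Z" "y \<notin> Z" "\<exists>z\<in>Z. z < y" "\<exists>z\<in>Z. y < z"
  obtains a b where "a \<in> Z" "b \<in> Z" "a < y" "y < b" "\<And>z. z \<in> Z \<Longrightarrow> z \<le> a \<or> b \<le> z"
proof
  let ?A = "{z\<in>Z. z < y}" and ?B = "{z\<in>Z. y < z}"
  have fin: "finite ?A" "?A \<noteq> {}" "finite ?B" "?B \<noteq> {}" using assms by auto
  show "Max ?A \<in> Z" "Min ?B \<in> Z" "Max ?A < y" "y < Min ?B"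
    using Max_in[OF fin(1,2)] Min_in[OF fin(3,4)] by auto
  fix z assume "z \<in> Z"
  then show "z \<le> Max ?A \<or> Min ?B \<le> z"
    using fin Max_ge[OF fin(1)] Min_le[OF fin(3)] assms(2) by (metis (mono_tags, lifting) linorder_neqE mem_Collect_eq)
qed

text \<open>
  The situation of this part: \<open>\<theta>\<close> matches the signs of the derivatives of \<open>p\<close> and \<open>q\<close> everywhere, but the
  signs of \<open>p\<close> and \<open>q\<close> only on a finite set \<open>Z\<close> that contains the critical points of \<open>p\<close>. It is
  then possible to change \<open>\<theta>\<close> off \<open>Z\<close> so that all signs of \<open>p\<close> and \<open>q\<close> match.
\<close>

context
  fixes p q :: "real poly" and Z :: "real set" and \<theta> :: "real \<Rightarrow> real"
  assumes \<theta>: "increasing_bijection \<theta>" and Z: "finite Z"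
    and nonconst: "pderiv p \<noteq> 0" "pderiv q \<noteq> 0"
    and crit: "\<And>w. poly (pderiv p) w = 0 \<Longrightarrow> w \<in> Z"
    and sgn_crit: "\<And>y. sgn (poly (pderiv p) y) = sgn (poly (pderiv q) (\<theta> y))"
    and sgn_Z: "\<And>z. z \<in> Z \<Longrightarrow> sgn (poly p z) = sgn (poly q (\<theta> z))"
begin

lemma crit_image: "poly (pderiv q) w = 0 \<Longrightarrow> w \<in> \<theta> ` Z"
  using crit sgn_crit \<theta> unfolding increasing_bijection_def by (metis imageI sgn_0_0 surj_def)

text \<open>
  The roots are treated one at a time. A root \<open>r\<close> of \<open>p\<close> in a gap \<open>(a, b)\<close> forces \<open>p a\<close> and \<open>p b\<close> to
  have opposite signs, so \<open>q\<close> has a root in the image gap, and \<open>r\<close> can be moved there. A gap contains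
  at most one root of \<open>p\<close>, so the roots matched before stay matched.
\<close>

lemma match_roots_bounded:
  assumes "finite R" "\<And>r. r \<in> R \<Longrightarrow> poly p r = 0"
    and bd: "\<And>r. r \<in> R \<Longrightarrow> (\<exists>z\<in>Z. z < r) \<and> (\<exists>z\<in>Z. r < z)"
  shows "\<exists>\<theta>'. increasing_bijection \<theta>' \<and> (\<forall>z\<in>Z. \<theta>' z = \<theta> z) \<and> (\<forall>r\<in>R. poly q (\<theta>' r) = 0)"
  using assms
proof (induction R rule: finite_induct)
  case empty
  then show ?case using \<theta> by auto
next
  case (insert r R)
  then obtain \<theta>' where \<theta>': "increasing_bijection \<theta>'" "\<And>z. z \<in> Z \<Longrightarrow> \<theta>' z = \<theta> z"
    "\<And>r. r \<in> R \<Longrightarrow> poly q (\<theta>' r) = 0" by auto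
  show ?case
  proof (cases "r \<in> Z")
    case True
    then have "poly q (\<theta>' r) = 0" using sgn_Z[OF True] insert.prems(1)[of r] \<theta>'(2) by (simp add: sgn_0_0)
    then show ?thesis using \<theta>' by auto
  next
    case False
    then have "\<exists>z\<in>Z. z < r" "\<exists>z\<in>Z. r < z" using insert.prems(2)[of r] by (metis insertI1)+
    then obtain a b where ab: "a \<in> Z" "b \<in> Z" "a < r" "r < b" and gap: "\<And>z. z \<in> Z \<Longrightarrow> z \<le> a \<or> b \<le> z"
      using finite_gap[OF Z False] by metis
    have nz: "poly (pderiv p) w \<noteq> 0" if "a < w" "w < b" for w
      using crit[of w] gap[of w] that by auto
    have pr: "poly p r = 0" using insert.prems(1) by simp
    have "sgn (poly p r - poly p a) = sgn (poly (pderiv p) r)"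
         "sgn (poly p b - poly p r) = sgn (poly (pderiv p) r)"
      by (rule sgn_poly_diff[where a=a and b=b]; use ab nz in simp)+
    then have "sgn (poly p b) = - sgn (poly p a)" "poly p a \<noteq> 0"
      using pr nz[of r] ab by (auto simp: sgn_minus sgn_0_0)
    then have "sgn (poly q (\<theta>' b)) = - sgn (poly q (\<theta>' a))" "poly q (\<theta>' a) \<noteq> 0"
      using sgn_Z ab \<theta>'(2) by (metis sgn_0_0)+
    moreover have "\<theta>' a < \<theta>' b" using ab increasing_bijection_less_iff[OF \<theta>'(1)] by simp
    ultimately obtain w where w: "\<theta>' a < w" "w < \<theta>' b" "poly q w = 0"
      using poly_IVT_pos[of "\<theta>' a" "\<theta>' b" q] poly_IVT_neg[of "\<theta>' a" "\<theta>' b" q]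
      by (auto simp: sgn_if split: if_splits)
    obtain s where s: "w = \<theta>' s" using \<theta>'(1) unfolding increasing_bijection_def surj_def by blast
    have as: "a < s" "s < b" using w s increasing_bijection_less_iff[OF \<theta>'(1)] by auto
    obtain \<tau> where \<tau>: "increasing_bijection \<tau>" "\<tau> r = s" "\<And>y. y \<le> a \<or> b \<le> y \<Longrightarrow> \<tau> y = y"
      using increasing_bijection_moving_point[OF ab(3,4) as] by blast
    have "r' \<le> a \<or> b \<le> r'" if r': "r' \<in> R" for r'
    proof (rule ccontr)
      assume c: "\<not> (r' \<le> a \<or> b \<le> r')"
      have "r' \<noteq> r" "poly p r' = 0" using r' insert by auto
      then have "sgn (poly p (max r r') - poly p (min r r')) = sgn (poly (pderiv p) r)"
        by (intro sgn_poly_diff[where a=a and b=b]) (use c ab nz in auto)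
      then have "poly (pderiv p) r = 0" using pr \<open>poly p r' = 0\<close> 
        by (auto simp: min_def max_def sgn_0_0 split: if_splits)
      then show False using nz ab by simp
    qed
    then have "increasing_bijection (\<theta>' \<circ> \<tau>) \<and> (\<forall>z\<in>Z. (\<theta>' \<circ> \<tau>) z = \<theta> z) \<and>
      (\<forall>r'\<in>insert r R. poly q ((\<theta>' \<circ> \<tau>) r') = 0)"
      using increasing_bijection_compose[OF \<theta>'(1) \<tau>(1)] \<tau> \<theta>' gap w s by auto
    then show ?thesis by blast
  qed
qed

text \<open>
  Once the roots are matched, the signs are. In a gap with a root both polynomials change sign
  there, in the direction given by the derivative; in a gap without a root the sign is that at an
  endpoint where the polynomial does not vanish, and Rolle's theorem excludes that it vanishes
  at both. The outer hypotheses keep the unbounded gaps free of roots.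
\<close>

lemma match_signs_bounded:
  assumes "finite {r. poly p r = 0}"
    and bd: "\<And>r. poly p r = 0 \<Longrightarrow> (\<exists>z\<in>Z. z < r) \<and> (\<exists>z\<in>Z. r < z)"
    and bd': "\<And>r. poly q r = 0 \<Longrightarrow> (\<exists>z\<in>Z. \<theta> z < r) \<and> (\<exists>z\<in>Z. r < \<theta> z)"
    and "Z \<noteq> {}"
  shows "\<exists>\<theta>'. increasing_bijection \<theta>' \<and> (\<forall>z\<in>Z. \<theta>' z = \<theta> z) \<and>
           (\<forall>y. sgn (poly p y) = sgn (poly q (\<theta>' y)))"
proof -
  obtain \<theta>' where \<theta>': "increasing_bijection \<theta>'" "\<And>z. z \<in> Z \<Longrightarrow> \<theta>' z = \<theta> z"
    "\<And>r. poly p r = 0 \<Longrightarrow> poly q (\<theta>' r) = 0"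
    using match_roots_bounded[OF assms(1)] bd by auto
  have mono: "\<theta>' x < \<theta>' y \<longleftrightarrow> x < y" for x y by (rule increasing_bijection_less_iff[OF \<theta>'(1)])
  have mono': "\<theta>' x \<le> \<theta>' y \<longleftrightarrow> x \<le> y" for x y using mono by (metis linorder_not_less)
  have inv: "\<exists>t. w = \<theta>' t" for w
    using \<theta>'(1) unfolding increasing_bijection_def surj_def by blast
  have sgn_crit': "sgn (poly (pderiv p) y) = sgn (poly (pderiv q) (\<theta>' y))" for y
    by (rule sgn_poly_transport[OF \<theta> \<theta>'(1) \<theta>'(2) crit_image sgn_crit])
  have "sgn (poly p y) = sgn (poly q (\<theta>' y))" for y
  proof (cases "y \<in> Z \<or> poly p y = 0")
    case True then show ?thesis using \<theta>' sgn_Z by auto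
  next
    case F: False
    show ?thesis
    proof (cases "(\<exists>z\<in>Z. z < y) \<and> (\<exists>z\<in>Z. y < z)")
      case False
      obtain z where z: "z \<in> Z" "(\<forall>z'\<in>Z. z' \<le> z) \<and> z < y \<or> (\<forall>z'\<in>Z. z \<le> z') \<and> y < z"
      proof (cases "\<exists>z\<in>Z. z < y")
        case True
        then have "\<forall>z\<in>Z. z < y" using False F by (metis linorder_neqE)
        then show ?thesis using that[of "Max Z"] Z \<open>Z \<noteq> {}\<close> by simp
      next
        case f: False
        then have "\<forall>z\<in>Z. y < z" using F by (metis linorder_neqE)
        then show ?thesis using that[of "Min Z"] Z \<open>Z \<noteq> {}\<close> by simp
      qed
      have "sgn (poly p y) = sgn (poly p z)" if "poly p z \<noteq> 0"
      proof (rule poly_same_sign, rule notI)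
        fix w assume w: "min y z \<le> w" "w \<le> max y z" "poly p w = 0"
        then have "w = z" using bd[OF w(3)] z by force
        then show False using w that by simp
      qed
      moreover have "sgn (poly q (\<theta>' y)) = sgn (poly q (\<theta>' z))" if "poly q (\<theta>' z) \<noteq> 0"
      proof (rule poly_same_sign, rule notI)
        fix w assume w: "min (\<theta>' y) (\<theta>' z) \<le> w" "w \<le> max (\<theta>' y) (\<theta>' z)" "poly q w = 0"
        obtain t where t: "w = \<theta>' t" using inv by blast
        have "(\<exists>z\<in>Z. z < t) \<and> (\<exists>z\<in>Z. t < z)" using bd'[OF w(3)] t mono \<theta>'(2) by metis
        moreover have "min y z \<le> t" "t \<le> max y z" using w t mono' by (auto simp: min_def max_def split: if_splits)
        ultimately have "t = z" using z by force
        then show False using w that t by simp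
      qed
      moreover have "poly p z \<noteq> 0"
      proof
        assume "poly p z = 0"
        show False using bd[OF \<open>poly p z = 0\<close>] z by force
      qed
      ultimately show ?thesis using sgn_Z[OF z(1)] \<theta>'(2)[OF z(1)] by (metis sgn_0_0)
    next
      case True
      then obtain a b where ab: "a \<in> Z" "b \<in> Z" "a < y" "y < b" and gap: "\<And>z. z \<in> Z \<Longrightarrow> z \<le> a \<or> b \<le> z"
        using finite_gap[OF Z _ conjunct1[OF True] conjunct2[OF True]] F by blast
      have nz: "poly (pderiv p) w \<noteq> 0" if "a < w" "w < b" for w
        using crit[of w] gap[of w] that by auto
      have nz': "poly (pderiv q) w \<noteq> 0" if "\<theta>' a < w" "w < \<theta>' b" for w
        using nz inv[of w] that sgn_crit' mono by (metis sgn_0_0)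
      have 1: "sgn (poly p y) = sgn (y - r) * sgn (poly (pderiv p) y)"
        if "poly p r = 0" "a < r" "r < b" for r
        using sgn_poly_diff[of r y y a b p] sgn_poly_diff[of y r y a b p] nz that ab
        by (cases y r rule: linorder_cases) (auto simp: sgn_minus)
      have 2: "sgn (poly q (\<theta>' y)) = sgn (y - r) * sgn (poly (pderiv q) (\<theta>' y))"
        if "poly q (\<theta>' r) = 0" "a < r" "r < b" for r
        using sgn_poly_diff[of "\<theta>' r" "\<theta>' y" "\<theta>' y" "\<theta>' a" "\<theta>' b" q] mono mono'
          sgn_poly_diff[of "\<theta>' y" "\<theta>' r" "\<theta>' y" "\<theta>' a" "\<theta>' b" q] nz' that ab
        by (cases y r rule: linorder_cases) (auto simp: sgn_minus)
      show ?thesis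
      proof (cases "\<exists>r. poly p r = 0 \<and> a < r \<and> r < b")
        case True
        then show ?thesis using 1 2 \<theta>'(3) sgn_crit' by metis
      next
        case no: False
        have no': "poly q w \<noteq> 0" if w: "\<theta>' a < w" "w < \<theta>' b" for w
        proof
          assume q0: "poly q w = 0"
          have "sgn (poly q w - poly q (\<theta>' a)) = sgn (poly (pderiv q) w)"
               "sgn (poly q (\<theta>' b) - poly q w) = sgn (poly (pderiv q) w)"
            by (rule sgn_poly_diff[where a="\<theta>' a" and b="\<theta>' b"]; use w nz' in simp)+
          then have "sgn (poly q (\<theta>' b)) = - sgn (poly q (\<theta>' a))" "poly q (\<theta>' a) \<noteq> 0"
            using q0 nz'[of w] w by (auto simp: sgn_minus sgn_0_0)
          then have "sgn (poly p b) = - sgn (poly p a)" "poly p a \<noteq> 0"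
            using sgn_Z ab \<theta>'(2) by (metis sgn_0_0)+
          then obtain r where "a < r" "r < b" "poly p r = 0"
            using poly_IVT_pos[of a b p] poly_IVT_neg[of a b p] ab
            by (auto simp: sgn_if split: if_splits)
          then show False using no by blast
        qed
        have "sgn (poly p b - poly p a) \<noteq> 0"
          using sgn_poly_diff[of a b y a b p] nz ab by (auto simp: sgn_0_0)
        then obtain c where c: "c = a \<or> c = b" "poly p c \<noteq> 0" by (metis diff_self sgn_0)
        then have "poly q (\<theta>' c) \<noteq> 0" "sgn (poly p c) = sgn (poly q (\<theta>' c))" 
          using sgn_Z ab \<theta>'(2) by (metis sgn_0_0)+
        moreover have "sgn (poly p y) = sgn (poly p c)"
        proof (rule poly_same_sign)
          fix w assume "min y c \<le> w" "w \<le> max y c"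
          then have "a < w \<and> w < b \<or> w = c"
            using c(1) ab by (auto simp: min_def max_def split: if_splits)
          then show "poly p w \<noteq> 0" using no c(2) by blast
        qed
        moreover have "sgn (poly q (\<theta>' y)) = sgn (poly q (\<theta>' c))"
        proof (rule poly_same_sign)
          fix w assume "min (\<theta>' y) (\<theta>' c) \<le> w" "w \<le> max (\<theta>' y) (\<theta>' c)"
          moreover have "\<theta>' a < \<theta>' y" "\<theta>' y < \<theta>' b" using ab mono by auto
          ultimately have "\<theta>' a < w \<and> w < \<theta>' b \<or> w = \<theta>' c" using c(1) by (auto simp: min_def max_def split: if_splits)
          then show "poly q w \<noteq> 0" using no' \<open>poly q (\<theta>' c) \<noteq> 0\<close> by blast
        qed
        ultimately show ?thesis by simp
      qed
    qed
  qed
  then show ?thesis using \<theta>' by blast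
qed

end

text \<open>
  The unbounded gaps are reduced to bounded ones by adding to \<open>Z\<close> two points \<open>-N\<close> and \<open>N\<close> beyond all
  roots on both sides; there the sign of a polynomial is determined by that of its derivative.
\<close>

lemma increasing_bijection_matching_signs:
  fixes p q :: "real poly"
  assumes \<theta>: "increasing_bijection \<theta>" and Z: "finite Z"
    and nonconst: "pderiv p \<noteq> 0" "pderiv q \<noteq> 0"
    and crit: "\<And>w. poly (pderiv p) w = 0 \<Longrightarrow> w \<in> Z"
    and sgn_crit: "\<And>y. sgn (poly (pderiv p) y) = sgn (poly (pderiv q) (\<theta> y))"
    and sgn_Z: "\<And>z. z \<in> Z \<Longrightarrow> sgn (poly p z) = sgn (poly q (\<theta> z))"
  obtains \<theta>' where "increasing_bijection \<theta>'" "\<And>z. z \<in> Z \<Longrightarrow> \<theta>' z = \<theta> z"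
    "\<And>y. sgn (poly p y) = sgn (poly q (\<theta>' y))"
proof -
  have mono: "\<theta> x < \<theta> y \<longleftrightarrow> x < y" for x y by (rule increasing_bijection_less_iff[OF \<theta>])
  have mono': "\<theta> x \<le> \<theta> y \<longleftrightarrow> x \<le> y" for x y using mono by (metis linorder_not_less)
  have inv: "\<exists>t. w = \<theta> t" for w using \<theta> unfolding increasing_bijection_def surj_def by blast
  have nz: "p \<noteq> 0" "q \<noteq> 0" using nonconst by auto
  have inj: "inj \<theta>" using \<theta> strict_mono_imp_inj_on unfolding increasing_bijection_def by blast
  \<comment> \<open>The preimages under \<open>\<theta>\<close> make \<open>\<theta> N\<close> and \<open>\<theta> (- N)\<close> lie beyond the roots of \<open>q\<close> as well.\<close>
  define S where "S = Z \<union> {r. poly p r = 0} \<union> \<theta> -` {r. poly q r = 0}"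
  have "finite S"
    unfolding S_def using Z poly_roots_finite nz finite_vimageI[OF _ inj] by blast
  then have "bounded S" by (rule finite_imp_bounded)
  then obtain N where N: "\<And>s. s \<in> S \<Longrightarrow> \<bar>s\<bar> < N"
    unfolding bounded_pos_less by (metis real_norm_def)
  have Np: "\<bar>r\<bar> < N" if "poly p r = 0" for r using N that by (simp add: S_def)
  have Nq: "\<bar>r\<bar> < N" if "poly q (\<theta> r) = 0" for r using N that by (simp add: S_def)
  have Np': "\<bar>r\<bar> < N" if "poly (pderiv p) r = 0" for r using N crit[OF that] by (simp add: S_def)
  have Nq': "\<bar>r\<bar> < N" if "poly (pderiv q) (\<theta> r) = 0" for r
    using Np' sgn_crit[of r] that by (simp add: sgn_0_0)
  have right: "sgn (poly p N) = sgn (poly q (\<theta> N))"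
  proof -
    have "sgn (poly p N) = sgn (poly (pderiv p) N)"
      by (rule sgn_pderiv_right_end) (use Np Np' in force)+
    moreover have "sgn (poly q (\<theta> N)) = sgn (poly (pderiv q) (\<theta> N))"
    proof (rule sgn_pderiv_right_end)
      fix w assume "\<theta> N \<le> w"
      then obtain t where "w = \<theta> t" "N \<le> t" using inv mono' by metis
      then show "poly q w \<noteq> 0" "poly (pderiv q) w \<noteq> 0" using Nq[of t] Nq'[of t] by auto
    qed
    ultimately show ?thesis using sgn_crit by simp
  qed
  have left: "sgn (poly p (- N)) = sgn (poly q (\<theta> (- N)))"
  proof -
    have "sgn (poly p (- N)) = - sgn (poly (pderiv p) (- N))"
      by (rule sgn_pderiv_left_end) (use Np Np' in force)+
    moreover have "sgn (poly q (\<theta> (- N))) = - sgn (poly (pderiv q) (\<theta> (- N)))"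
    proof (rule sgn_pderiv_left_end)
      fix w assume "w \<le> \<theta> (- N)"
      then obtain t where "w = \<theta> t" "t \<le> - N" using inv mono' by metis
      then show "poly q w \<noteq> 0" "poly (pderiv q) w \<noteq> 0" using Nq[of t] Nq'[of t] by auto
    qed
    ultimately show ?thesis using sgn_crit by simp
  qed
  have "\<exists>\<theta>'. increasing_bijection \<theta>' \<and> (\<forall>z\<in>insert N (insert (- N) Z). \<theta>' z = \<theta> z) \<and>
      (\<forall>y. sgn (poly p y) = sgn (poly q (\<theta>' y)))"
  proof (rule match_signs_bounded[OF \<theta>])
    show "(\<exists>z\<in>insert N (insert (- N) Z). z < r) \<and> (\<exists>z\<in>insert N (insert (- N) Z). r < z)"
      if "poly p r = 0" for r using Np[OF that] by auto
    show "(\<exists>z\<in>insert N (insert (- N) Z). \<theta> z < r) \<and> (\<exists>z\<in>insert N (insert (- N) Z). r < \<theta> z)"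
      if "poly q r = 0" for r
    proof -
      obtain t where t: "r = \<theta> t" using inv by blast
      then have "\<bar>t\<bar> < N" using Nq that by simp
      then show ?thesis using t mono by auto
    qed
  qed (use Z nonconst crit sgn_crit sgn_Z left right poly_roots_finite nz in auto)
  then show ?thesis using that by blast
qed

section \<open>Families of polynomials with the same sign pattern\<close>

text \<open>
  This encodes, without any list of roots, that the families \<open>P x\<close> and \<open>P x'\<close> for \<open>P \<in> F\<close> have the same
  sign diagram on the line. In particular whether some \<open>y\<close> satisfies given sign conditions depends only
  on the class of \<open>x\<close>, and passing to a subfamily is trivial.
\<close>

definition sign_equiv :: "('a \<Rightarrow> real poly) set \<Rightarrow> 'a \<Rightarrow> 'a \<Rightarrow> bool" where
  "sign_equiv F x x' \<longleftrightarrow>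
     (\<exists>\<theta>. increasing_bijection \<theta> \<and> (\<forall>P\<in>F. \<forall>y. sgn (poly (P x) y) = sgn (poly (P x') (\<theta> y))))"

lemma sign_equiv_mono: "sign_equiv G x x' \<Longrightarrow> F \<subseteq> G \<Longrightarrow> sign_equiv F x x'"
  unfolding sign_equiv_def by blast

text \<open>
  The step of the Cohen-Hoermander elimination. Let \<open>Z\<close> be the set of roots of the nonzero members of \<open>F\<close> and of
  the derivative of \<open>P\<close>. At a root of \<open>Q\<close> the value of \<open>P\<close> is that of its remainder \<open>R\<close> modulo \<open>Q\<close>, whose
  sign is matched already. So the signs of \<open>P\<close> match on \<open>Z\<close>, and the matching can be improved inside
  the gaps, where the members of \<open>F\<close> have constant signs.
\<close>

lemma sign_equiv_insert:
  fixes P :: "'a \<Rightarrow> real poly"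
  assumes fin: "finite F"
    and eq: "sign_equiv (insert (\<lambda>x. pderiv (P x)) F \<union> G) x x'"
    and nonconst: "pderiv (P x) \<noteq> 0" "pderiv (P x') \<noteq> 0"
    and rem: "\<And>Q. Q \<in> insert (\<lambda>x. pderiv (P x)) F \<Longrightarrow> Q x = 0 \<and> Q x' = 0 \<or>
       Q x \<noteq> 0 \<and> Q x' \<noteq> 0 \<and>
       (\<exists>R\<in>G. (\<forall>z. poly (Q x) z = 0 \<longrightarrow> poly (P x) z = poly (R x) z) \<and>
               (\<forall>z. poly (Q x') z = 0 \<longrightarrow> poly (P x') z = poly (R x') z))"
  shows "sign_equiv (insert P F) x x'"
proof -
  let ?P' = "\<lambda>x. pderiv (P x)"
  obtain \<theta> where \<theta>: "increasing_bijection \<theta>"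
    and sgn': "\<forall>Q\<in>insert ?P' F \<union> G. \<forall>y. sgn (poly (Q x) y) = sgn (poly (Q x') (\<theta> y))"
    using eq unfolding sign_equiv_def by (elim exE conjE) blast
  have sgn: "sgn (poly (Q x) y) = sgn (poly (Q x') (\<theta> y))" if "Q \<in> insert ?P' F \<union> G" for Q y
    using bspec[OF sgn' that] by blast
  define Z where "Z = (\<Union>Q\<in>{Q \<in> insert ?P' F. Q x \<noteq> 0}. {z. poly (Q x) z = 0})"
  have "finite Z" unfolding Z_def using fin by (auto simp: poly_roots_finite)
  moreover have "w \<in> Z" if "poly (pderiv (P x)) w = 0" for w
    unfolding Z_def using nonconst that by blast
  moreover have "sgn (poly (P x) z) = sgn (poly (P x') (\<theta> z))" if zZ: "z \<in> Z" for z
  proof -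
    obtain Q where Q: "Q \<in> insert ?P' F" "Q x \<noteq> 0" "poly (Q x) z = 0"
      using zZ unfolding Z_def by (elim UN_E CollectE conjE)
    then obtain R where "R \<in> G" "poly (P x) z = poly (R x) z"
      and R: "\<And>z. poly (Q x') z = 0 \<Longrightarrow> poly (P x') z = poly (R x') z" using rem[OF Q(1)] by blast
    moreover have "poly (Q x') (\<theta> z) = 0"
    proof -
      have "sgn (poly (Q x) z) = sgn (poly (Q x') (\<theta> z))" by (rule sgn) (use Q(1) in blast)
      then show ?thesis using Q(3) by (simp add: sgn_0_0)
    qed
    ultimately show ?thesis using sgn[of R z] by simp
  qed
  moreover have "sgn (poly (pderiv (P x)) y) = sgn (poly (pderiv (P x')) (\<theta> y))" for y
    using sgn[of ?P' y] by simp
  ultimately obtain \<theta>' where \<theta>': "increasing_bijection \<theta>'" "\<And>z. z \<in> Z \<Longrightarrow> \<theta>' z = \<theta> z"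
    "\<And>y. sgn (poly (P x) y) = sgn (poly (P x') (\<theta>' y))"
    using increasing_bijection_matching_signs[OF \<theta> _ nonconst] by metis
  have "sgn (poly (Q x) y) = sgn (poly (Q x') (\<theta>' y))" if Q: "Q \<in> F" for Q y
  proof (cases "Q x = 0")
    case True
    then show ?thesis using rem[of Q] Q by auto
  next
    case False
    have "w \<in> \<theta> ` Z" if "poly (Q x') w = 0" for w
    proof -
      obtain z where "w = \<theta> z" using \<theta> unfolding increasing_bijection_def surj_def by blast
      moreover have "poly (Q x) z = 0" using sgn[of Q z] that Q calculation by (simp add: sgn_0_0)
      ultimately show ?thesis using False Q by (auto simp: Z_def)
    qed
    then show ?thesis
      using sgn_poly_transport[OF \<theta> \<theta>'(1,2), of Z "Q x'" "Q x" y] sgn[of Q] Q by blast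
  qed
  then show ?thesis unfolding sign_equiv_def using \<theta>' by blast
qed

section \<open>Sign patterns of polynomial families are semialgebraic in the parameter\<close>

text \<open>
  Division with remainder needs quotients of the coefficients, so the coefficients of families
  are rational functions of the parameter without poles on the set under consideration.
\<close>

definition rational_on :: "nat \<Rightarrow> (nat \<Rightarrow> real) set \<Rightarrow> ((nat \<Rightarrow> real) \<Rightarrow> real) \<Rightarrow> bool" where
  "rational_on n B f \<longleftrightarrow>
     (\<exists>p q. polynomial_fun n p \<and> polynomial_fun n q \<and> (\<forall>x\<in>B. q x \<noteq> 0 \<and> f x = p x / q x))"

lemma rational_on_polynomial: "polynomial_fun n p \<Longrightarrow> rational_on n B p"
  unfolding rational_on_def using polynomial_fun.const[of n 1] by force

lemma rational_on_const: "rational_on n B (\<lambda>x. c)"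
  by (rule rational_on_polynomial) (rule polynomial_fun.const)

lemma rational_on_subset: "rational_on n B f \<Longrightarrow> C \<subseteq> B \<Longrightarrow> rational_on n C f"
  unfolding rational_on_def by blast

lemma rational_on_add:
  assumes "rational_on n B f" "rational_on n B g"
  shows "rational_on n B (\<lambda>x. f x + g x)"
proof -
  from assms obtain p q p' q' where "polynomial_fun n p" "polynomial_fun n q"
    "polynomial_fun n p'" "polynomial_fun n q'" "\<forall>x\<in>B. q x \<noteq> 0 \<and> f x = p x / q x"
    "\<forall>x\<in>B. q' x \<noteq> 0 \<and> g x = p' x / q' x" unfolding rational_on_def by blast
  then show ?thesis unfolding rational_on_def
    by (intro exI[of _ "\<lambda>x. p x * q' x + p' x * q x"] exI[of _ "\<lambda>x. q x * q' x"])
       (auto intro!: polynomial_fun.intros simp: add_frac_eq)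
qed

lemma rational_on_mult:
  assumes "rational_on n B f" "rational_on n B g"
  shows "rational_on n B (\<lambda>x. f x * g x)"
proof -
  from assms obtain p q p' q' where "polynomial_fun n p" "polynomial_fun n q"
    "polynomial_fun n p'" "polynomial_fun n q'" "\<forall>x\<in>B. q x \<noteq> 0 \<and> f x = p x / q x"
    "\<forall>x\<in>B. q' x \<noteq> 0 \<and> g x = p' x / q' x" unfolding rational_on_def by blast
  then show ?thesis unfolding rational_on_def
    by (intro exI[of _ "\<lambda>x. p x * p' x"] exI[of _ "\<lambda>x. q x * q' x"])
       (auto intro!: polynomial_fun.intros)
qed

lemma rational_on_divide:
  assumes "rational_on n B f" "rational_on n B g" "\<forall>x\<in>B. g x \<noteq> 0"
  shows "rational_on n B (\<lambda>x. f x / g x)"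
proof -
  from assms obtain p q p' q' where "polynomial_fun n p" "polynomial_fun n q"
    "polynomial_fun n p'" "polynomial_fun n q'" "\<forall>x\<in>B. q x \<noteq> 0 \<and> f x = p x / q x"
    "\<forall>x\<in>B. q' x \<noteq> 0 \<and> g x = p' x / q' x" unfolding rational_on_def by blast
  then show ?thesis unfolding rational_on_def using assms(3)
    by (intro exI[of _ "\<lambda>x. p x * q' x"] exI[of _ "\<lambda>x. q x * p' x"])
       (auto intro!: polynomial_fun.intros)
qed

lemma semialgebraic_subset: "semialgebraic n A \<Longrightarrow> A \<subseteq> topspace (Euclidean_space n)"
  by (induction rule: semialgebraic.induct) auto

lemma semialgebraic_Diff:
  assumes "semialgebraic n A" "semialgebraic n B"
  shows "semialgebraic n (A - B)"
proof -
  have "A - B = A \<inter> (topspace (Euclidean_space n) - B)" using semialgebraic_subset[OF assms(1)] by blast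
  then show ?thesis using assms by (simp only: semialgebraic_Int semialgebraic.compl)
qed

lemma semialgebraic_empty: "semialgebraic n {}"
  using semialgebraic.compl[OF semialgebraic_space] by simp

lemma semialgebraic_Collect_conj:
  assumes "semialgebraic n B" "semialgebraic n {x \<in> topspace (Euclidean_space n). P x}"
  shows "semialgebraic n {x \<in> B. P x}"
proof -
  have "{x \<in> B. P x} = B \<inter> {x \<in> topspace (Euclidean_space n). P x}"
    using semialgebraic_subset[OF assms(1)] by blast
  then show ?thesis using semialgebraic_Int assms by simp
qed

lemma semialgebraic_rational_pos:
  assumes "rational_on n B f" "semialgebraic n B"
  shows "semialgebraic n {x \<in> B. f x > 0}"
proof -
  from assms(1) obtain p q where pq: "polynomial_fun n p" "polynomial_fun n q"
    "\<forall>x\<in>B. q x \<noteq> 0 \<and> f x = p x / q x" unfolding rational_on_def by blast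
  then have "{x \<in> B. f x > 0} = {x \<in> B. p x * q x > 0}"
    by (auto simp: zero_less_divide_iff zero_less_mult_iff)
  then show ?thesis
    using semialgebraic_Collect_conj[OF assms(2) semialgebraic.pos[OF polynomial_fun.mult[OF pq(1,2)]]]
    by simp
qed

lemma semialgebraic_rational_neg:
  assumes "rational_on n B f" "semialgebraic n B"
  shows "semialgebraic n {x \<in> B. f x < 0}"
  using semialgebraic_rational_pos[OF rational_on_mult[OF rational_on_const[of _ _ "-1"] assms(1)] assms(2)]
  by simp

lemma semialgebraic_rational_zero:
  assumes "rational_on n B f" "semialgebraic n B"
  shows "semialgebraic n {x \<in> B. f x = 0}" "semialgebraic n {x \<in> B. f x \<noteq> 0}"
proof -
  have "{x \<in> B. f x \<noteq> 0} = {x \<in> B. f x > 0} \<union> {x \<in> B. f x < 0}" by auto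
  then show 1: "semialgebraic n {x \<in> B. f x \<noteq> 0}"
    using semialgebraic_rational_pos semialgebraic_rational_neg assms semialgebraic.union by simp
  have "{x \<in> B. f x = 0} = B - {x \<in> B. f x \<noteq> 0}" by auto
  then show "semialgebraic n {x \<in> B. f x = 0}" using semialgebraic_Diff[OF assms(2) 1] by simp
qed

text \<open>
  The bound \<open>d\<close> on the degree is strict, so that an induction on \<open>d\<close> starts with zero families.
\<close>

definition poly_family :: "nat \<Rightarrow> (nat \<Rightarrow> real) set \<Rightarrow> nat \<Rightarrow> ((nat \<Rightarrow> real) \<Rightarrow> real poly) \<Rightarrow> bool" where
  "poly_family n B d P \<longleftrightarrow>
     (\<forall>i. rational_on n B (\<lambda>x. coeff (P x) i)) \<and> (\<forall>x\<in>B. \<forall>i\<ge>d. coeff (P x) i = 0)"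

lemma poly_family_subset: "poly_family n B d P \<Longrightarrow> C \<subseteq> B \<Longrightarrow> poly_family n C d P"
  unfolding poly_family_def using rational_on_subset by blast

lemma poly_family_weaken: "poly_family n B d P \<Longrightarrow> d \<le> e \<Longrightarrow> poly_family n B e P"
  unfolding poly_family_def by auto

lemma poly_family_lower:
  assumes "poly_family n B (Suc d) P"
  shows "poly_family n {x \<in> B. coeff (P x) d = 0} d P"
  unfolding poly_family_def
proof (intro conjI allI ballI impI)
  fix i show "rational_on n {x \<in> B. coeff (P x) d = 0} (\<lambda>x. coeff (P x) i)"
    by (rule rational_on_subset[of n B]) (use assms in \<open>auto simp: poly_family_def\<close>)
next
  fix x i assume "x \<in> {x \<in> B. coeff (P x) d = 0}" "d \<le> i"
  then show "coeff (P x) i = 0" using assms unfolding poly_family_def by (cases "i = d") auto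
qed

lemma poly_family_pderiv: "poly_family n B (Suc d) P \<Longrightarrow> poly_family n B d (\<lambda>x. pderiv (P x))"
  unfolding poly_family_def coeff_pderiv
  by (auto intro!: rational_on_mult rational_on_const)

text \<open>
  Division with remainder, carried out for all parameters at once; this is possible where the
  leading coefficient of the divisor has no zero.
\<close>

lemma poly_family_remainder:
  assumes "poly_family n B m P" "poly_family n B (Suc e) Q" "\<forall>x\<in>B. coeff (Q x) e \<noteq> 0"
  shows "\<exists>R. poly_family n B e R \<and> (\<forall>x\<in>B. \<forall>z. poly (Q x) z = 0 \<longrightarrow> poly (P x) z = poly (R x) z)"
  using assms(1)
proof (induction m arbitrary: P)
  case 0
  then have "poly_family n B e P" by (rule poly_family_weaken) simp
  then show ?case by blast
next
  case (Suc m)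
  show ?case
  proof (cases "Suc m \<le> e")
    case True
    then have "poly_family n B e P" using poly_family_weaken Suc.prems by blast
    then show ?thesis by blast
  next
    case False
    define c where "c = (\<lambda>x. - (coeff (P x) m / coeff (Q x) e))"
    define P1 where "P1 = (\<lambda>x. P x + monom (c x) (m - e) * Q x)"
    have c: "rational_on n B c"
      unfolding c_def using rational_on_mult[OF rational_on_const[of _ _ "-1"] rational_on_divide[OF _ _ assms(3)]]
        Suc.prems assms(2) unfolding poly_family_def by simp
    have "poly_family n B m P1"
      unfolding poly_family_def
    proof (intro conjI allI ballI impI)
      fix i
      have "rational_on n B (\<lambda>x. coeff (P x) i + (if i < m - e then 0 else c x * coeff (Q x) (i - (m - e))))"
        using Suc.prems assms(2) c unfolding poly_family_def
        by (cases "i < m - e") (auto intro!: rational_on_add rational_on_mult rational_on_const)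
      then show "rational_on n B (\<lambda>x. coeff (P1 x) i)"
        by (simp add: P1_def coeff_monom_mult if_distrib cong: if_cong)
    next
      fix x i assume x: "x \<in> B" "m \<le> i"
      show "coeff (P1 x) i = 0"
      proof (cases "i = m")
        case True
        then show ?thesis using False x assms(3) by (simp add: P1_def coeff_monom_mult c_def)
      next
        case n: False
        then have "coeff (P x) i = 0" "coeff (Q x) (i - (m - e)) = 0"
          using Suc.prems assms(2) x False unfolding poly_family_def by auto
        then show ?thesis by (simp add: P1_def coeff_monom_mult)
      qed
    qed
    then obtain R where R: "poly_family n B e R" "\<forall>x\<in>B. \<forall>z. poly (Q x) z = 0 \<longrightarrow> poly (P1 x) z = poly (R x) z"
      using Suc.IH by blast
    then show ?thesis unfolding P1_def by (intro exI[of _ R]) simp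
  qed
qed

text \<open>
  A family is good as a divisor if its leading coefficient stays in one place and does not vanish,
  or if it is identically zero, in which case its sign needs no matching.
\<close>

definition degree_constant :: "nat \<Rightarrow> (nat \<Rightarrow> real) set \<Rightarrow> ((nat \<Rightarrow> real) \<Rightarrow> real poly) \<Rightarrow> bool" where
  "degree_constant n B P \<longleftrightarrow> (\<forall>x\<in>B. P x = 0) \<or>
     (\<exists>e. poly_family n B (Suc e) P \<and> (\<forall>x\<in>B. coeff (P x) e \<noteq> 0))"

lemma degree_constant_subset: "degree_constant n B P \<Longrightarrow> C \<subseteq> B \<Longrightarrow> degree_constant n C P"
  unfolding degree_constant_def using poly_family_subset by blast

definition finite_semialgebraic_cover :: "nat \<Rightarrow> (nat \<Rightarrow> real) set \<Rightarrow> (nat \<Rightarrow> real) set set \<Rightarrow> bool" where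
  "finite_semialgebraic_cover n B \<C> \<longleftrightarrow> finite \<C> \<and> \<Union>\<C> = B \<and> (\<forall>C\<in>\<C>. semialgebraic n C)"

lemma finite_semialgebraic_coverD:
  assumes "finite_semialgebraic_cover n B \<C>" "C \<in> \<C>"
  shows "C \<subseteq> B" "semialgebraic n C"
  using assms unfolding finite_semialgebraic_cover_def by auto

lemma finite_semialgebraic_cover_trans:
  assumes "finite_semialgebraic_cover n B \<C>"
    and "\<forall>C\<in>\<C>. \<exists>\<D>. finite_semialgebraic_cover n C \<D> \<and> (\<forall>D\<in>\<D>. Q D)"
  shows "\<exists>\<D>. finite_semialgebraic_cover n B \<D> \<and> (\<forall>D\<in>\<D>. Q D)"
proof -
  obtain f where f: "\<forall>C\<in>\<C>. finite_semialgebraic_cover n C (f C) \<and> (\<forall>D\<in>f C. Q D)"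
    using bchoice[OF assms(2)] by blast
  then have "\<forall>C\<in>\<C>. \<Union>(f C) = C" by (simp add: finite_semialgebraic_cover_def)
  then have "(\<Union>C\<in>\<C>. \<Union>(f C)) = \<Union>\<C>" by simp
  moreover have "\<Union>(\<Union>(f ` \<C>)) = (\<Union>C\<in>\<C>. \<Union>(f C))" by blast
  ultimately have "\<Union>(\<Union>(f ` \<C>)) = B"
    using assms(1) unfolding finite_semialgebraic_cover_def by simp
  then have "finite_semialgebraic_cover n B (\<Union>(f ` \<C>)) \<and> (\<forall>D\<in>\<Union>(f ` \<C>). Q D)"
    using assms(1) f unfolding finite_semialgebraic_cover_def by auto
  then show ?thesis by blast
qed

lemma finite_semialgebraic_cover_singleton: 
  "semialgebraic n B \<Longrightarrow> finite_semialgebraic_cover n B {B}"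
  by (simp add: finite_semialgebraic_cover_def)

lemma finite_semialgebraic_cover_zero:
  assumes "rational_on n B f" "semialgebraic n B"
  shows "finite_semialgebraic_cover n B {{x \<in> B. f x = 0}, {x \<in> B. f x \<noteq> 0}}"
  using semialgebraic_rational_zero[OF assms] unfolding finite_semialgebraic_cover_def by auto

lemma degree_constant_cover_single:
  assumes "poly_family n B d P" "semialgebraic n B"
  shows "\<exists>\<D>. finite_semialgebraic_cover n B \<D> \<and> (\<forall>D\<in>\<D>. degree_constant n D P)"
  using assms
proof (induction d arbitrary: B)
  case 0
  then have "degree_constant n B P" 
    unfolding degree_constant_def poly_family_def by (auto intro: poly_eqI)
  then show ?case using finite_semialgebraic_cover_singleton[OF 0(2)] by blast
next
  case (Suc d)
  let ?Z = "{x \<in> B. coeff (P x) d = 0}" and ?N = "{x \<in> B. coeff (P x) d \<noteq> 0}"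
  have r: "rational_on n B (\<lambda>x. coeff (P x) d)" using Suc.prems by (simp add: poly_family_def)
  note sa = semialgebraic_rational_zero[OF r Suc.prems(2)]
  have "poly_family n ?Z d P" by (rule poly_family_lower[OF Suc.prems(1)])
  from Suc.IH[OF this sa(1)]
  have Z: "\<exists>\<D>. finite_semialgebraic_cover n ?Z \<D> \<and> (\<forall>D\<in>\<D>. degree_constant n D P)" .
  have "degree_constant n ?N P"
    unfolding degree_constant_def using poly_family_subset[OF Suc.prems(1), of ?N] by blast
  then have N: "\<exists>\<D>. finite_semialgebraic_cover n ?N \<D> \<and> (\<forall>D\<in>\<D>. degree_constant n D P)"
    using finite_semialgebraic_cover_singleton[OF sa(2)] by blast
  show ?case
    by (rule finite_semialgebraic_cover_trans[OF finite_semialgebraic_cover_zero[OF r Suc.prems(2)]])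
       (use Z N in blast)
qed

lemma degree_constant_cover:
  assumes "finite F" "\<forall>P\<in>F. \<exists>d. poly_family n B d P" "semialgebraic n B"
  shows "\<exists>\<D>. finite_semialgebraic_cover n B \<D> \<and> (\<forall>D\<in>\<D>. \<forall>P\<in>F. degree_constant n D P)"
  using assms
proof (induction F rule: finite_induct)
  case empty
  then show ?case using finite_semialgebraic_cover_singleton by blast
next
  case (insert P F)
  then obtain \<C> where C: "finite_semialgebraic_cover n B \<C>" "\<forall>D\<in>\<C>. \<forall>P\<in>F. degree_constant n D P" by auto
  obtain d where d: "poly_family n B d P" using insert by blast
  show ?case
  proof (rule finite_semialgebraic_cover_trans[OF C(1)], rule ballI)
    fix D assume D: "D \<in> \<C>"
    note sub = finite_semialgebraic_coverD[OF C(1) D]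
    obtain \<D> where \<D>: "finite_semialgebraic_cover n D \<D>" "\<forall>D\<in>\<D>. degree_constant n D P"
      using degree_constant_cover_single[OF poly_family_subset[OF d sub(1)] sub(2)] by blast
    have "degree_constant n D' Q" if "D' \<in> \<D>" "Q \<in> F" for D' Q
      using degree_constant_subset[of n D Q D'] C(2) D finite_semialgebraic_coverD[OF \<D>(1) that(1)] that
      by simp
    then show "\<exists>\<D>. finite_semialgebraic_cover n D \<D> \<and> (\<forall>D\<in>\<D>. \<forall>P\<in>insert P F. degree_constant n D P)"
      using \<D> by (intro exI[of _ \<D>]) simp
  qed
qed

text \<open>
  Only finitely many sign patterns occur, and each one on a semialgebraic set of parameters; the
  pieces of the cover may be smaller than the classes, which avoids computing the patterns.
\<close>

definition tame :: "nat \<Rightarrow> (nat \<Rightarrow> real) set \<Rightarrow> ((nat \<Rightarrow> real) \<Rightarrow> real poly) set \<Rightarrow> bool" where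
  "tame n B F \<longleftrightarrow>
     (\<exists>\<C>. finite_semialgebraic_cover n B \<C> \<and> (\<forall>C\<in>\<C>. \<forall>x\<in>C. \<forall>x'\<in>C. sign_equiv F x x'))"

lemma tame_cover:
  assumes "finite_semialgebraic_cover n B \<C>" "\<And>C. C \<in> \<C> \<Longrightarrow> semialgebraic n C \<Longrightarrow> C \<subseteq> B \<Longrightarrow> tame n C F"
  shows "tame n B F"
  unfolding tame_def
proof (rule finite_semialgebraic_cover_trans[OF assms(1)], rule ballI)
  fix C assume "C \<in> \<C>"
  then have "tame n C F" using assms(2) finite_semialgebraic_coverD[OF assms(1)] by simp
  then show "\<exists>\<D>. finite_semialgebraic_cover n C \<D> \<and> (\<forall>D\<in>\<D>. \<forall>x\<in>D. \<forall>x'\<in>D. sign_equiv F x x')"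
    by (simp only: tame_def)
qed

lemma tame_refine:
  assumes "tame n B G" "\<And>x x'. x \<in> B \<Longrightarrow> x' \<in> B \<Longrightarrow> sign_equiv G x x' \<Longrightarrow> sign_equiv F x x'"
  shows "tame n B F"
proof -
  obtain \<C> where C: "finite_semialgebraic_cover n B \<C>" "\<forall>C\<in>\<C>. \<forall>x\<in>C. \<forall>x'\<in>C. sign_equiv G x x'"
    using assms(1) unfolding tame_def by blast
  have "sign_equiv F x x'" if "D \<in> \<C>" "x \<in> D" "x' \<in> D" for D x x'
    using assms(2)[of x x'] that C(2) finite_semialgebraic_coverD(1)[OF C(1) that(1)] by blast
  then show ?thesis unfolding tame_def using C(1) by (intro exI[of _ \<C>]) simp
qed

lemma tame_insert_const:
  assumes "tame n B F" "\<forall>x\<in>B. \<forall>x'\<in>B. \<forall>y y'. sgn (poly (P x) y) = sgn (poly (P x') y')"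
  shows "tame n B (insert P F)"
  by (rule tame_refine[OF assms(1)]) (use assms(2) in \<open>auto simp: sign_equiv_def\<close>)

text \<open>
  A family \<open>P\<close> of exact degree \<open>d\<close> is traded for its derivative and its remainders modulo the other
  families and the derivative, all of which have smaller degree. If \<open>d = 0\<close>, then \<open>P\<close> is a nonvanishing
  constant for each parameter and only its sign matters.
\<close>

lemma tame_insert_poly:
  assumes IH: "\<And>B H. semialgebraic n B \<Longrightarrow> finite H \<Longrightarrow> \<forall>Q\<in>H. poly_family n B d Q \<Longrightarrow>
       \<forall>Q\<in>K. poly_family n B (Suc d) Q \<Longrightarrow> tame n B (H \<union> K)"
    and B: "semialgebraic n B"
    and H: "finite H" "\<forall>Q\<in>H. poly_family n B d Q"
    and K: "finite K" "\<forall>Q\<in>K. poly_family n B (Suc d) Q"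
    and P: "poly_family n B (Suc d) P" "\<forall>x\<in>B. coeff (P x) d \<noteq> 0"
  shows "tame n B (insert P (H \<union> K))"
proof (cases d)
  case 0
  let ?c = "\<lambda>x. coeff (P x) 0"
  have r: "rational_on n B ?c" using P by (simp add: poly_family_def)
  have eval: "poly (P x) y = ?c x" if "x \<in> B" for x y
  proof -
    have "degree (P x) = 0" using P(1) that 0 unfolding poly_family_def
      by (metis One_nat_def degree_0 leading_coeff_0_iff less_one linorder_not_less)
    then obtain a where "P x = [:a:]" by (rule degree_eq_zeroE)
    then show ?thesis by simp
  qed
  have base: "tame n C (insert P (H \<union> K))"
    if C: "C \<subseteq> B" "semialgebraic n C" "\<forall>x\<in>C. \<forall>x'\<in>C. sgn (?c x) = sgn (?c x')" for C
  proof (rule tame_insert_const, rule IH)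
    show "\<forall>Q\<in>H. poly_family n C d Q" "\<forall>Q\<in>K. poly_family n C (Suc d) Q"
      using H(2) K(2) poly_family_subset[OF _ C(1)] by blast+
    show "\<forall>x\<in>C. \<forall>x'\<in>C. \<forall>y y'. sgn (poly (P x) y) = sgn (poly (P x') y')"
    proof (intro ballI allI)
      fix x x' y y' assume x: "x \<in> C" "x' \<in> C"
      then have "x \<in> B" "x' \<in> B" using C(1) by auto
      then show "sgn (poly (P x) y) = sgn (poly (P x') y')"
        unfolding eval[OF \<open>x \<in> B\<close>] eval[OF \<open>x' \<in> B\<close>] using C(3) x by blast
    qed
  qed (use H C in auto)
  have "finite_semialgebraic_cover n B {{x \<in> B. ?c x > 0}, {x \<in> B. ?c x < 0}}"
    using semialgebraic_rational_pos[OF r B] semialgebraic_rational_neg[OF r B] P(2) 0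
    unfolding finite_semialgebraic_cover_def by (auto simp: neq_iff)
  then show ?thesis by (rule tame_cover) (rule base; auto)
next
  case (Suc d')
  let ?P' = "\<lambda>x. pderiv (P x)"
  have P': "poly_family n B d ?P'" by (rule poly_family_pderiv[OF P(1)])
  have lead: "coeff (?P' x) d' \<noteq> 0" if "x \<in> B" for x using P(2) that Suc by (simp add: coeff_pderiv)
  have dP': "degree_constant n B ?P'"
    unfolding degree_constant_def using P' lead Suc by blast
  have ex: "\<forall>Q\<in>H \<union> K. \<exists>d. poly_family n B d Q" using H K by blast
  obtain \<D> where D: "finite_semialgebraic_cover n B \<D>" "\<forall>D\<in>\<D>. \<forall>Q\<in>H \<union> K. degree_constant n D Q"
    using degree_constant_cover[OF _ ex B] H K by blast
  show ?thesis
  proof (rule tame_cover[OF D(1)])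
    fix C assume C: "C \<in> \<D>" "semialgebraic n C" "C \<subseteq> B"
    let ?F = "insert ?P' (H \<union> K)"
    have dc: "degree_constant n C Q" if "Q \<in> ?F" for Q
      using that D(2) C degree_constant_subset[OF dP' C(3)] by blast
    have "poly_family n B (Suc d) Q" if "Q \<in> ?F" for Q
      using that
    proof (elim insertE UnE)
      show ?thesis if "Q \<in> H" using poly_family_weaken[of n B d Q "Suc d"] H(2) that by simp
      show ?thesis if "Q = ?P'" using poly_family_weaken[OF P'] that by simp
    qed (use K(2) in blast)
    then have bound: "poly_family n C (Suc d) Q" if "Q \<in> ?F" for Q
      using poly_family_subset[OF _ C(3)] that by blast
    have "\<exists>R. poly_family n C d R \<and> ((\<forall>x\<in>C. Q x = 0) \<or> (\<forall>x\<in>C. Q x \<noteq> 0 \<and>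
        (\<forall>z. poly (Q x) z = 0 \<longrightarrow> poly (P x) z = poly (R x) z)))" if Q: "Q \<in> ?F" for Q
    proof (cases "\<forall>x\<in>C. Q x = 0")
      case True
      then show ?thesis using poly_family_subset[OF P' C(3)] by blast
    next
      case False
      then obtain e where e: "poly_family n C (Suc e) Q" "\<forall>x\<in>C. coeff (Q x) e \<noteq> 0"
        using dc[OF Q] unfolding degree_constant_def by blast
      obtain x where "x \<in> C" using False by blast
      then have "e \<le> d" using bound[OF Q] e(2) unfolding poly_family_def by (meson not_less_eq_eq)
      obtain R where "poly_family n C e R" "\<forall>x\<in>C. \<forall>z. poly (Q x) z = 0 \<longrightarrow> poly (P x) z = poly (R x) z"
        using poly_family_remainder[OF poly_family_subset[OF P(1) C(3)] e] by blast
      moreover have "\<forall>x\<in>C. Q x \<noteq> 0" using e(2) by auto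
      ultimately show ?thesis using poly_family_weaken[OF _ \<open>e \<le> d\<close>] by blast
    qed
    then have "\<forall>Q\<in>?F. \<exists>R. poly_family n C d R \<and> ((\<forall>x\<in>C. Q x = 0) \<or> (\<forall>x\<in>C. Q x \<noteq> 0 \<and>
        (\<forall>z. poly (Q x) z = 0 \<longrightarrow> poly (P x) z = poly (R x) z)))" by (rule ballI)
    from bchoice[OF this] obtain R where "\<forall>Q\<in>?F. poly_family n C d (R Q) \<and> ((\<forall>x\<in>C. Q x = 0) \<or>
        (\<forall>x\<in>C. Q x \<noteq> 0 \<and> (\<forall>z. poly (Q x) z = 0 \<longrightarrow> poly (P x) z = poly (R Q x) z)))" ..
    then have R: "poly_family n C d (R Q)"
      "(\<forall>x\<in>C. Q x = 0) \<or> (\<forall>x\<in>C. Q x \<noteq> 0 \<and>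
        (\<forall>z. poly (Q x) z = 0 \<longrightarrow> poly (P x) z = poly (R Q x) z))" if "Q \<in> ?F" for Q
      using that by (elim ballE[where x=Q]; simp only: not_True_eq_False simp_thms; blast)+
    have "tame n C ((insert ?P' H \<union> R ` ?F) \<union> K)"
    proof (rule IH)
      show "\<forall>Q\<in>insert ?P' H \<union> R ` ?F. poly_family n C d Q"
        using H(2) poly_family_subset[OF _ C(3)] P' R(1) by blast
      show "\<forall>Q\<in>K. poly_family n C (Suc d) Q" using K(2) poly_family_subset[OF _ C(3)] by blast
      show "finite (insert ?P' H \<union> R ` ?F)" using H(1) K(1) by blast
    qed (rule C(2))
    then show "tame n C (insert P (H \<union> K))"
    proof (rule tame_refine)
      fix x x' assume x: "x \<in> C" "x' \<in> C"
        and se: "sign_equiv ((insert ?P' H \<union> R ` ?F) \<union> K) x x'"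
      show "sign_equiv (insert P (H \<union> K)) x x'"
      proof (rule sign_equiv_insert[where G = "R ` ?F"])
        show "sign_equiv (insert ?P' (H \<union> K) \<union> R ` ?F) x x'"
          by (rule sign_equiv_mono[OF se]) blast
        show "pderiv (P x) \<noteq> 0" "pderiv (P x') \<noteq> 0" using lead x C by force+
        fix Q assume "Q \<in> ?F"
        then show "Q x = 0 \<and> Q x' = 0 \<or> Q x \<noteq> 0 \<and> Q x' \<noteq> 0 \<and>
          (\<exists>R\<in>R ` ?F. (\<forall>z. poly (Q x) z = 0 \<longrightarrow> poly (P x) z = poly (R x) z) \<and>
                        (\<forall>z. poly (Q x') z = 0 \<longrightarrow> poly (P x') z = poly (R x') z))"
          using R(2)[of Q] x by blast
      qed (use H K in simp)
    qed
  qed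
qed

text \<open>
  Induction on the number of families of degree at most \<open>d\<close>, the lower families being arbitrary. Where
  the coefficient of degree \<open>d\<close> of \<open>P\<close> vanishes, \<open>P\<close> joins the lower families.
\<close>

lemma tame_degree_step:
  assumes IH: "\<And>B H. semialgebraic n B \<Longrightarrow> finite H \<Longrightarrow> \<forall>Q\<in>H. poly_family n B d Q \<Longrightarrow> tame n B H"
    and "finite K"
  shows "semialgebraic n B \<Longrightarrow> finite H \<Longrightarrow> \<forall>Q\<in>H. poly_family n B d Q \<Longrightarrow>
       \<forall>Q\<in>K. poly_family n B (Suc d) Q \<Longrightarrow> tame n B (H \<union> K)"
  using \<open>finite K\<close>
proof (induction K arbitrary: B H rule: finite_induct)
  case empty
  then show ?case using IH by simp
next
  case (insert P K)
  let ?Z = "{x \<in> B. coeff (P x) d = 0}" and ?N = "{x \<in> B. coeff (P x) d \<noteq> 0}"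
  have fam: "poly_family n B (Suc d) P" using insert.prems by simp
  then have r: "rational_on n B (\<lambda>x. coeff (P x) d)" by (simp add: poly_family_def)
  have zero: "tame n ?Z (H \<union> insert P K)"
  proof -
    have "poly_family n ?Z d P"
      by (rule poly_family_lower[OF fam])
    moreover have "poly_family n ?Z e Q" if "poly_family n B e Q" for e Q
      by (rule poly_family_subset[OF that]) auto
    ultimately have "tame n ?Z (insert P H \<union> K)"
      by (intro insert.IH) (use insert.prems semialgebraic_rational_zero[OF r] in auto)
    then show ?thesis by simp
  qed
  have nonzero: "tame n ?N (insert P (H \<union> K))"
  proof (rule tame_insert_poly)
    have sub: "poly_family n ?N e Q" if "poly_family n B e Q" for e Q
      by (rule poly_family_subset[OF that]) auto
    show "\<forall>Q\<in>H. poly_family n ?N d Q" "\<forall>Q\<in>K. poly_family n ?N (Suc d) Q" "poly_family n ?N (Suc d) P"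
      using insert.prems sub by auto
    show "semialgebraic n ?N" using semialgebraic_rational_zero[OF r] insert.prems by auto
  qed (use insert in auto)
  show ?case
    by (rule tame_cover[OF finite_semialgebraic_cover_zero[OF r insert.prems(1)]])
       (use zero nonzero in auto)
qed

theorem tame_families:
  assumes "semialgebraic n B" "finite H" "\<forall>Q\<in>H. poly_family n B d Q"
  shows "tame n B H"
  using assms
proof (induction d arbitrary: B H)
  case 0
  then have "Q x = 0" if "x \<in> B" "Q \<in> H" for x and Q :: "(nat \<Rightarrow> real) \<Rightarrow> real poly"
    using that unfolding poly_family_def by (auto intro: poly_eqI)
  note zero = this
  have "sign_equiv H x x'" if x: "x \<in> B" "x' \<in> B" for x x'
    unfolding sign_equiv_def
  proof (intro exI[of _ id] conjI ballI allI)
    fix P y assume "P \<in> H"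
    then show "sgn (poly (P x) y) = sgn (poly (P x') (id y))"
      using zero[OF x(1), of P] zero[OF x(2), of P] by simp
  qed (simp add: increasing_bijection_def strict_mono_def)
  then show ?case unfolding tame_def
    using finite_semialgebraic_cover_singleton[OF 0(1)] by (intro exI[of _ "{B}"]) simp
next
  case (Suc d)
  show ?case
    using tame_degree_step[where H="{}", OF Suc.IH Suc.prems(2) Suc.prems(1)] Suc.prems by simp
qed

section \<open>The Tarski-Seidenberg theorem and closures\<close>

lemma rational_on_sum: "(\<And>i. i \<in> I \<Longrightarrow> rational_on n B (f i)) \<Longrightarrow> rational_on n B (\<lambda>x. \<Sum>i\<in>I. f i x)"
  by (induction I rule: infinite_finite_induct) (auto intro: rational_on_const rational_on_add)

lemma poly_family_add:
  assumes "poly_family n B d P" "poly_family n B e Q"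
  shows "poly_family n B (max d e) (\<lambda>x. P x + Q x)"
  using assms unfolding poly_family_def by (auto intro: rational_on_add)

lemma poly_family_mult:
  assumes "poly_family n B d P" "poly_family n B e Q"
  shows "poly_family n B (d + e) (\<lambda>x. P x * Q x)"
  unfolding poly_family_def
proof (intro conjI allI ballI impI)
  show "rational_on n B (\<lambda>x. coeff (P x * Q x) i)" for i
    unfolding coeff_mult using assms
    by (intro rational_on_sum rational_on_mult) (auto simp: poly_family_def)
next
  fix x i assume x: "x \<in> B" "d + e \<le> i"
  have *: "coeff (P x) j * coeff (Q x) (i - j) = 0" for j
    using assms x unfolding poly_family_def by (cases "j < d") auto
  then show "coeff (P x * Q x) i = 0" unfolding coeff_mult * by simp
qed

lemma polynomial_fun_as_poly_family:
  assumes "polynomial_fun (Suc n) p"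
  shows "\<exists>P d. poly_family n B d P \<and> (\<forall>x y. poly (P x) y = p (x(n := y)))"
  using assms
proof (induction rule: polynomial_fun.induct)
  case (const c)
  have "poly_family n B 1 (\<lambda>x. [:c:])"
    unfolding poly_family_def by (auto simp: coeff_pCons split: nat.split intro: rational_on_const)
  then show ?case by force
next
  case (coord i)
  show ?case
  proof (cases "i = n")
    case True
    have "poly_family n B 2 (\<lambda>x. [:0, 1:])"
      unfolding poly_family_def by (auto simp: coeff_pCons split: nat.split intro: rational_on_const)
    then show ?thesis using True by force
  next
    case False
    then have "rational_on n B (\<lambda>x. x i)"
      using coord by (intro rational_on_polynomial polynomial_fun.coord) simp
    then have "rational_on n B (\<lambda>x. coeff [:x i:] j)" for j
      by (cases j) (simp_all add: rational_on_const)
    then have "poly_family n B 1 (\<lambda>x. [:x i:])"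
      unfolding poly_family_def by (simp add: coeff_pCons split: nat.split)
    then show ?thesis using False by force
  qed
next
  case (add p q)
  then obtain P d Q e where PQ: "poly_family n B d P" "\<forall>x y. poly (P x) y = p (x(n := y))"
    "poly_family n B e Q" "\<forall>x y. poly (Q x) y = q (x(n := y))" by blast
  show ?case
    by (intro exI[of _ "\<lambda>x. P x + Q x"] exI[of _ "max d e"] conjI poly_family_add PQ)
       (simp add: PQ del: fun_upd_apply)
next
  case (mult p q)
  then obtain P d Q e where PQ: "poly_family n B d P" "\<forall>x y. poly (P x) y = p (x(n := y))"
    "poly_family n B e Q" "\<forall>x y. poly (Q x) y = q (x(n := y))" by blast
  show ?case
    by (intro exI[of _ "\<lambda>x. P x * Q x"] exI[of _ "d + e"] conjI poly_family_mult PQ)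
       (simp add: PQ del: fun_upd_apply)
qed

lemma Euclidean_space_fun_upd:
  "x \<in> topspace (Euclidean_space n) \<Longrightarrow> x(n := y) \<in> topspace (Euclidean_space (Suc n))"
  by (auto simp: topspace_Euclidean_space)

lemma semialgebraic_sign_determined:
  assumes "semialgebraic (Suc n) A"
  shows "\<exists>F d. finite F \<and> (\<forall>P\<in>F. poly_family n B d P) \<and>
    (\<forall>x\<in>topspace (Euclidean_space n). \<forall>x'\<in>topspace (Euclidean_space n). \<forall>y y'.
       (\<forall>P\<in>F. sgn (poly (P x) y) = sgn (poly (P x') y')) \<longrightarrow>
       (x(n := y) \<in> A \<longleftrightarrow> x'(n := y') \<in> A))"
  using assms
proof (induction rule: semialgebraic.induct)
  case (pos p)
  obtain P d where P: "poly_family n B d P" "\<forall>x y. poly (P x) y = p (x(n := y))"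
    using polynomial_fun_as_poly_family[OF pos] by blast
  have "0 < p (x(n := y)) \<longleftrightarrow> sgn (poly (P x) y) = 1" for x y using P(2) by (simp add: sgn_1_pos)
  then show ?case
    by (intro exI[of _ "{P}"] exI[of _ d])
       (simp add: Euclidean_space_fun_upd P(1) del: fun_upd_apply)
next
  case (compl A)
  then obtain F d where F: "finite F" "\<forall>P\<in>F. poly_family n B d P"
    "\<forall>x\<in>topspace (Euclidean_space n). \<forall>x'\<in>topspace (Euclidean_space n). \<forall>y y'.
       (\<forall>P\<in>F. sgn (poly (P x) y) = sgn (poly (P x') y')) \<longrightarrow>
       (x(n := y) \<in> A \<longleftrightarrow> x'(n := y') \<in> A)" by blast
  show ?case
    by (rule exI[of _ F], rule exI[of _ d]) (use F in \<open>simp add: Euclidean_space_fun_upd del: fun_upd_apply\<close>)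
next
  case (union A A')
  then obtain F d where F: "finite F" "\<forall>P\<in>F. poly_family n B d P"
    "\<forall>x\<in>topspace (Euclidean_space n). \<forall>x'\<in>topspace (Euclidean_space n). \<forall>y y'.
       (\<forall>P\<in>F. sgn (poly (P x) y) = sgn (poly (P x') y')) \<longrightarrow>
       (x(n := y) \<in> A \<longleftrightarrow> x'(n := y') \<in> A)" by blast
  obtain G e where G: "finite G" "\<forall>P\<in>G. poly_family n B e P"
    "\<forall>x\<in>topspace (Euclidean_space n). \<forall>x'\<in>topspace (Euclidean_space n). \<forall>y y'.
       (\<forall>P\<in>G. sgn (poly (P x) y) = sgn (poly (P x') y')) \<longrightarrow>
       (x(n := y) \<in> A' \<longleftrightarrow> x'(n := y') \<in> A')" using union.IH by blast
  have "\<forall>P\<in>F \<union> G. poly_family n B (max d e) P"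
    using F(2) G(2) poly_family_weaken[of n B _ _ "max d e"] by (metis UnE max.cobounded1 max.cobounded2)
  moreover have "x(n := y) \<in> A \<union> A' \<longleftrightarrow> x'(n := y') \<in> A \<union> A'"
    if x: "x \<in> topspace (Euclidean_space n)" "x' \<in> topspace (Euclidean_space n)"
      and eq: "\<forall>P\<in>F \<union> G. sgn (poly (P x) y) = sgn (poly (P x') y')" for x x' y y'
  proof -
    have "x(n := y) \<in> A \<longleftrightarrow> x'(n := y') \<in> A" "x(n := y) \<in> A' \<longleftrightarrow> x'(n := y') \<in> A'"
      by (rule F(3)[rule_format, OF x] G(3)[rule_format, OF x]; use eq in simp)+
    then show ?thesis by blast
  qed
  ultimately show ?case
    using F(1) G(1) by (intro exI[of _ "F \<union> G"] exI[of _ "max d e"]) blast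
qed

text \<open>
  On a piece of the cover on which all parameters are sign equivalent, the fibre over one parameter meets
  \<open>A\<close> if and only if the fibre over any other does. The projection is therefore a union of pieces.
\<close>

theorem semialgebraic_projection_last:
  assumes "semialgebraic (Suc n) A"
  shows "semialgebraic n {x \<in> topspace (Euclidean_space n). \<exists>y. x(n := y) \<in> A}"
proof -
  let ?E = "topspace (Euclidean_space n)" and ?S = "{x \<in> topspace (Euclidean_space n). \<exists>y. x(n := y) \<in> A}"
  obtain F d where F: "finite F" "\<forall>P\<in>F. poly_family n ?E d P"
    and det0: "\<forall>x\<in>?E. \<forall>x'\<in>?E. \<forall>y y'. (\<forall>P\<in>F. sgn (poly (P x) y) = sgn (poly (P x') y')) \<longrightarrow>
       (x(n := y) \<in> A \<longleftrightarrow> x'(n := y') \<in> A)"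
    using semialgebraic_sign_determined[OF assms, of ?E] by (elim exE conjE)
  have det: "x'(n := y') \<in> A" if "x \<in> ?E" "x' \<in> ?E"
    "\<forall>P\<in>F. sgn (poly (P x) y) = sgn (poly (P x') y')" "x(n := y) \<in> A" for x x' y y'
    using det0[rule_format, OF that(1,2)] that(3,4) by blast
  obtain \<C> where C: "finite_semialgebraic_cover n ?E \<C>" "\<forall>C\<in>\<C>. \<forall>x\<in>C. \<forall>x'\<in>C. sign_equiv F x x'"
    using tame_families[OF semialgebraic_space F] unfolding tame_def by blast
  have "x' \<in> ?S" if x: "C \<in> \<C>" "x \<in> C" "x' \<in> C" "x \<in> ?S" for C x x'
  proof -
    have x': "x' \<in> ?E" using finite_semialgebraic_coverD[OF C(1) x(1)] x(3) by blast
    obtain y where y: "x(n := y) \<in> A" using x(4) by blast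
    obtain \<theta> where "\<forall>P\<in>F. \<forall>y. sgn (poly (P x) y) = sgn (poly (P x') (\<theta> y))"
      using C(2) x unfolding sign_equiv_def by blast
    then have "\<forall>P\<in>F. sgn (poly (P x) y) = sgn (poly (P x') (\<theta> y))" by simp
    then have "x'(n := \<theta> y) \<in> A" using det[OF _ x' _ y] x(4) by simp
    then show ?thesis using x' by blast
  qed
  then have "?S = \<Union>{C \<in> \<C>. C \<subseteq> ?S}"
    using C(1) unfolding finite_semialgebraic_cover_def by blast
  moreover have "semialgebraic n (\<Union>\<D>)" if "finite \<D>" "\<forall>C\<in>\<D>. semialgebraic n C" for \<D>
    using that by (induction \<D> rule: finite_induct) (auto intro: semialgebraic_empty semialgebraic.union)
  ultimately show ?thesis
    using C(1) unfolding finite_semialgebraic_cover_def by (metis (no_types, lifting) finite_subset mem_Collect_eq subsetI)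
qed

text \<open>
  Points of Euclidean space vanish beyond its dimension, so the projection of \<open>w\<close> is the point that
  agrees with \<open>w\<close> in the first \<open>n\<close> coordinates.
\<close>

theorem semialgebraic_projection:
  assumes "semialgebraic (n + k) A"
  shows "semialgebraic n {x \<in> topspace (Euclidean_space n). \<exists>w\<in>A. \<forall>i<n. w i = x i}"
  using assms
proof (induction k arbitrary: A)
  case 0
  have "{x \<in> topspace (Euclidean_space n). \<exists>w\<in>A. \<forall>i<n. w i = x i} = A"
  proof (intro equalityI subsetI)
    fix x assume "x \<in> {x \<in> topspace (Euclidean_space n). \<exists>w\<in>A. \<forall>i<n. w i = x i}"
    then obtain w where w: "x \<in> topspace (Euclidean_space n)" "w \<in> A" "\<forall>i<n. w i = x i" by blast
    moreover have "w \<in> topspace (Euclidean_space n)" using semialgebraic_subset[OF 0] w by auto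
    ultimately have "w i = x i" for i
      unfolding topspace_Euclidean_space by (cases "i < n") simp_all
    then have "w = x" ..
    then show "x \<in> A" using w by simp
  next
    fix x assume "x \<in> A"
    then show "x \<in> {x \<in> topspace (Euclidean_space n). \<exists>w\<in>A. \<forall>i<n. w i = x i}"
      using semialgebraic_subset[OF 0] by auto
  qed
  then show ?case using 0 by simp
next
  case (Suc k)
  let ?B = "{x \<in> topspace (Euclidean_space (n + k)). \<exists>y. x(n + k := y) \<in> A}"
  have "semialgebraic (n + k) ?B" using semialgebraic_projection_last[of "n + k" A] Suc.prems by simp
  from Suc.IH[OF this]
  have "semialgebraic n {x \<in> topspace (Euclidean_space n). \<exists>w\<in>?B. \<forall>i<n. w i = x i}" .
  moreover have "(\<exists>w\<in>?B. \<forall>i<n. w i = x i) \<longleftrightarrow> (\<exists>w\<in>A. \<forall>i<n. w i = x i)" for x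
  proof
    assume "\<exists>w\<in>?B. \<forall>i<n. w i = x i"
    then obtain w y where "w(n + k := y) \<in> A" "\<forall>i<n. w i = x i" by blast
    then show "\<exists>w\<in>A. \<forall>i<n. w i = x i" by (intro bexI[of _ "w(n + k := y)"]) auto
  next
    assume "\<exists>w\<in>A. \<forall>i<n. w i = x i"
    then obtain w where w: "w \<in> A" "\<forall>i<n. w i = x i" by blast
    then have "w \<in> topspace (Euclidean_space (Suc (n + k)))"
      using subsetD[OF semialgebraic_subset[OF Suc.prems]] by simp
    then have "w(n + k := 0) \<in> topspace (Euclidean_space (n + k))"
      by (auto simp: topspace_Euclidean_space)
    moreover have "(w(n + k := 0))(n + k := w (n + k)) = w" by simp
    ultimately have "w(n + k := 0) \<in> ?B" using w(1) by (metis (mono_tags, lifting) mem_Collect_eq)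
    then show "\<exists>w\<in>?B. \<forall>i<n. w i = x i" using w(2) by (intro bexI[of _ "w(n + k := 0)"]) auto
  qed
  ultimately show ?case by simp
qed

definition select :: "(nat \<Rightarrow> nat) \<Rightarrow> nat \<Rightarrow> (nat \<Rightarrow> real) \<Rightarrow> nat \<Rightarrow> real" where
  "select c n x = (\<lambda>j. if j < n then x (c j) else 0)"

lemma semialgebraic_select:
  assumes "semialgebraic n A" "\<And>j. j < n \<Longrightarrow> c j < N"
  shows "semialgebraic N {x \<in> topspace (Euclidean_space N). select c n x \<in> A}"
proof -
  have sel: "select c n x \<in> topspace (Euclidean_space n)" for x
    by (simp add: select_def topspace_Euclidean_space)
  have poly: "polynomial_fun N (\<lambda>x. p (select c n x))" if "polynomial_fun n p" for p
    using that
    by (induction rule: polynomial_fun.induct)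
       (auto simp: select_def assms(2) intro: polynomial_fun.intros)
  show ?thesis
    using assms(1)
  proof (induction rule: semialgebraic.induct)
    case (pos p)
    then show ?case using semialgebraic.pos[OF poly[OF pos]] sel by simp
  next
    case (compl A)
    have "{x \<in> topspace (Euclidean_space N). select c n x \<in> topspace (Euclidean_space n) - A} =
      topspace (Euclidean_space N) - {x \<in> topspace (Euclidean_space N). select c n x \<in> A}"
      using sel by blast
    then show ?case using semialgebraic.compl[OF compl.IH] by simp
  next
    case (union A B)
    have "{x \<in> topspace (Euclidean_space N). select c n x \<in> A \<union> B} =
      {x \<in> topspace (Euclidean_space N). select c n x \<in> A} \<union> {x \<in> topspace (Euclidean_space N). select c n x \<in> B}"
      by blast
    then show ?case using semialgebraic.union[OF union.IH] by simp
  qed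
qed

lemma semialgebraic_Ball:
  assumes "finite I" "\<And>i. i \<in> I \<Longrightarrow> semialgebraic n {x \<in> topspace (Euclidean_space n). P i x}"
  shows "semialgebraic n {x \<in> topspace (Euclidean_space n). \<forall>i\<in>I. P i x}"
  using assms
proof (induction I rule: finite_induct)
  case empty
  then show ?case using semialgebraic_space by simp
next
  case (insert i I)
  have "{x \<in> topspace (Euclidean_space n). \<forall>i\<in>insert i I. P i x} =
    {x \<in> topspace (Euclidean_space n). P i x} \<inter> {x \<in> topspace (Euclidean_space n). \<forall>i\<in>I. P i x}"
    by blast
  then show ?case using insert semialgebraic_Int by simp
qed

lemma semialgebraic_Bex:
  assumes "finite I" "\<And>i. i \<in> I \<Longrightarrow> semialgebraic n {x \<in> topspace (Euclidean_space n). P i x}"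
  shows "semialgebraic n {x \<in> topspace (Euclidean_space n). \<exists>i\<in>I. P i x}"
  using assms
proof (induction I rule: finite_induct)
  case empty
  then show ?case using semialgebraic_empty by simp
next
  case (insert i I)
  have "{x \<in> topspace (Euclidean_space n). \<exists>i\<in>insert i I. P i x} =
    {x \<in> topspace (Euclidean_space n). P i x} \<union> {x \<in> topspace (Euclidean_space n). \<exists>i\<in>I. P i x}"
    by blast
  then show ?case using insert semialgebraic.union by simp
qed

lemma semialgebraic_polynomial_less:
  assumes "polynomial_fun n p" "polynomial_fun n q"
  shows "semialgebraic n {x \<in> topspace (Euclidean_space n). p x < q x}"
  using semialgebraic.pos[OF polynomial_fun_diff[OF assms(2,1)]] by simp

text \<open>
  The quantifiers over \<open>\<epsilon>\<close> and \<open>y\<close> are projections. The points \<open>x\<close>, \<open>\<epsilon>\<close>, \<open>y\<close> are laid out as one vector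
  of dimension \<open>n + 1 + n\<close>; first \<open>y\<close> is projected away, and then \<open>\<epsilon>\<close> from the complement.
\<close>

lemma semialgebraic_box_closure:
  assumes A: "semialgebraic n A"
  shows "semialgebraic n {x \<in> topspace (Euclidean_space n). \<forall>\<epsilon>>0. \<exists>y\<in>A. \<forall>i<n. \<bar>x i - y i\<bar> < \<epsilon>}"
proof -
  let ?E = "\<lambda>n. topspace (Euclidean_space n)"
  let ?N = "Suc n + n" and ?y = "select (\<lambda>i. Suc n + i) n"
  note pf = polynomial_fun_diff polynomial_fun.coord
  define T where "T = {v \<in> {v \<in> ?E ?N. ?y v \<in> A}. \<forall>i\<in>{..<n}. v i - v (Suc n + i) < v n \<and> v (Suc n + i) - v i < v n}"
  have "semialgebraic ?N {v \<in> ?E ?N. v i - v (Suc n + i) < v n \<and> v (Suc n + i) - v i < v n}" if "i < n" for i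
  proof -
    have "semialgebraic ?N {v \<in> {v \<in> ?E ?N. v i - v (Suc n + i) < v n}. v (Suc n + i) - v i < v n}"
      by (rule semialgebraic_Collect_conj; rule semialgebraic_polynomial_less; intro pf)
         (use that in auto)
    then show ?thesis by simp
  qed
  note strip = this
  have "semialgebraic ?N T"
    unfolding T_def
    by (rule semialgebraic_Collect_conj[OF semialgebraic_select[OF A] semialgebraic_Ball])
       (use strip in simp_all)
  then have P: "semialgebraic (Suc n) {u \<in> ?E (Suc n). \<exists>v\<in>T. \<forall>i<Suc n. v i = u i}"
    by (rule semialgebraic_projection)
  define U where "U = {u \<in> ?E (Suc n). 0 < u n} - {u \<in> ?E (Suc n). \<exists>v\<in>T. \<forall>i<Suc n. v i = u i}"
  have "semialgebraic (Suc n) U"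
    unfolding U_def
    by (intro semialgebraic_Diff P semialgebraic_polynomial_less polynomial_fun.const polynomial_fun.coord) simp
  then have Q: "semialgebraic n {x \<in> ?E n. \<exists>y. x(n := y) \<in> U}" by (rule semialgebraic_projection_last)
  have T_iff: "(\<exists>v\<in>T. \<forall>i<Suc n. v i = (x(n := \<epsilon>)) i) \<longleftrightarrow> (\<exists>y\<in>A. \<forall>i<n. \<bar>x i - y i\<bar> < \<epsilon>)" for x \<epsilon>
  proof
    assume "\<exists>v\<in>T. \<forall>i<Suc n. v i = (x(n := \<epsilon>)) i"
    then obtain v where v: "v \<in> T" "\<And>i. i < Suc n \<Longrightarrow> v i = (x(n := \<epsilon>)) i" by blast
    have "\<bar>x i - ?y v i\<bar> < \<epsilon>" if "i < n" for i
    proof -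
      have "v i - v (Suc n + i) < v n \<and> v (Suc n + i) - v i < v n" using v(1) that by (simp add: T_def)
      then show ?thesis using v(2)[of i] v(2)[of n] that by (simp add: select_def abs_less_iff)
    qed
    moreover have "?y v \<in> A" using v(1) by (simp add: T_def)
    ultimately show "\<exists>y\<in>A. \<forall>i<n. \<bar>x i - y i\<bar> < \<epsilon>" by blast
  next
    assume "\<exists>y\<in>A. \<forall>i<n. \<bar>x i - y i\<bar> < \<epsilon>"
    then obtain y where y: "y \<in> A" "\<And>i. i < n \<Longrightarrow> \<bar>x i - y i\<bar> < \<epsilon>" by blast
    define v where "v = (\<lambda>i. if i < n then x i else if i = n then \<epsilon> else y (i - Suc n))"
    have y0: "y i = 0" if "n \<le> i" for i
      using semialgebraic_subset[OF A] y(1) that by (auto simp: topspace_Euclidean_space)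
    have "?y v = y" by (rule ext) (simp add: select_def v_def y0)
    moreover have "v \<in> ?E ?N" using y0 by (auto simp: topspace_Euclidean_space v_def)
    moreover have "v i - v (Suc n + i) < v n \<and> v (Suc n + i) - v i < v n" if "i < n" for i
      using y(2)[OF that] that by (simp add: v_def abs_less_iff)
    ultimately have "v \<in> T" using y(1) unfolding T_def by blast
    moreover have "\<forall>i<Suc n. v i = (x(n := \<epsilon>)) i" by (simp add: v_def)
    ultimately show "\<exists>v\<in>T. \<forall>i<Suc n. v i = (x(n := \<epsilon>)) i" by blast
  qed
  have "x(n := \<epsilon>) \<in> U \<longleftrightarrow> 0 < \<epsilon> \<and> \<not> (\<exists>y\<in>A. \<forall>i<n. \<bar>x i - y i\<bar> < \<epsilon>)" if "x \<in> ?E n" for x \<epsilon>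
    unfolding U_def using Euclidean_space_fun_upd[OF that, of \<epsilon>] T_iff[of x \<epsilon>]
    by (simp add: fun_upd_same del: fun_upd_apply)
  then have "{x \<in> ?E n. \<forall>\<epsilon>>0. \<exists>y\<in>A. \<forall>i<n. \<bar>x i - y i\<bar> < \<epsilon>} = ?E n - {x \<in> ?E n. \<exists>y. x(n := y) \<in> U}"
    by blast
  then show ?thesis using semialgebraic.compl[OF Q] by simp
qed

lemma openin_box:
  "openin (Euclidean_space n) {y \<in> topspace (Euclidean_space n). \<forall>i<n. \<bar>x i - y i\<bar> < \<epsilon>}"
proof -
  have "open (\<Inter>i\<in>{..<n}. {y::nat \<Rightarrow> real. \<bar>x i - y i\<bar> < \<epsilon>})"
    by (intro open_INT ballI open_Collect_less continuous_intros) auto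
  then have "openin (top_of_set (topspace (Euclidean_space n))) (topspace (Euclidean_space n) \<inter> (\<Inter>i\<in>{..<n}. {y. \<bar>x i - y i\<bar> < \<epsilon>}))"
    by (rule openin_open_Int)
  moreover have "topspace (Euclidean_space n) \<inter> (\<Inter>i\<in>{..<n}. {y. \<bar>x i - y i\<bar> < \<epsilon>}) =
    {y \<in> topspace (Euclidean_space n). \<forall>i<n. \<bar>x i - y i\<bar> < \<epsilon>}" by auto
  ultimately show ?thesis
    using subtopology_Euclidean_top_of_set[of "topspace (Euclidean_space n)" n] by simp
qed

lemma open_contains_box:
  assumes "openin (Euclidean_space n) U" "x \<in> U"
  shows "\<exists>\<epsilon>>0. \<forall>y\<in>topspace (Euclidean_space n). (\<forall>i<n. \<bar>x i - y i\<bar> < \<epsilon>) \<longrightarrow> y \<in> U"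
proof -
  obtain V where V: "openin (powertop_real UNIV) V" "U = V \<inter> {x. \<forall>i\<ge>n. x i = 0}"
    using assms(1) unfolding Euclidean_space_def openin_subtopology by blast
  obtain W where W: "x \<in> (\<Pi>\<^sub>E i\<in>UNIV. W i)" "\<And>i. open (W i)" "(\<Pi>\<^sub>E i\<in>UNIV. W i) \<subseteq> V"
    using product_topology_open_contains_basis[OF V(1), of x] assms(2) V(2) by auto
  have "\<exists>e>0. \<forall>t. \<bar>x i - t\<bar> < e \<longrightarrow> t \<in> W i" for i
    using W(2)[of i] W(1) unfolding open_dist dist_real_def by (metis PiE_E UNIV_I abs_minus_commute)
  then obtain e where e: "\<And>i. e i > 0" "\<And>i t. \<bar>x i - t\<bar> < e i \<Longrightarrow> t \<in> W i" by metis
  have x: "x i = 0" if "n \<le> i" for i using assms(2) V(2) that by auto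
  show ?thesis
  proof (intro exI[of _ "Min (insert 1 (e ` {..<n}))"] conjI ballI impI)
    show "Min (insert 1 (e ` {..<n})) > 0" using e(1) by (subst Min_gr_iff) auto
    fix y assume y: "y \<in> topspace (Euclidean_space n)" "\<forall>i<n. \<bar>x i - y i\<bar> < Min (insert 1 (e ` {..<n}))"
    have "y i \<in> W i" for i
    proof (cases "i < n")
      case True
      then show ?thesis using y(2) e(2)[of i "y i"] by (auto simp: Min_gr_iff)
    next
      case False
      then have "y i = x i" using y(1) x[of i] by (simp add: topspace_Euclidean_space)
      then show ?thesis using PiE_mem[OF W(1), of i] by simp
    qed
    then have "y \<in> V" using W(3) by auto
    then show "y \<in> U" using y(1) V(2) by (auto simp: topspace_Euclidean_space)
  qed
qed

theorem semialgebraic_closure: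
  assumes "semialgebraic n A"
  shows "semialgebraic n (Euclidean_space n closure_of A)"
proof -
  have "Euclidean_space n closure_of A = {x \<in> topspace (Euclidean_space n). \<forall>\<epsilon>>0. \<exists>y\<in>A. \<forall>i<n. \<bar>x i - y i\<bar> < \<epsilon>}"
  proof (intro equalityI subsetI CollectI conjI allI impI)
    fix x assume x: "x \<in> Euclidean_space n closure_of A"
    then show xE: "x \<in> topspace (Euclidean_space n)" by (simp add: in_closure_of)
    fix \<epsilon> :: real assume "\<epsilon> > 0"
    define U where "U = {y \<in> topspace (Euclidean_space n). \<forall>i<n. \<bar>x i - y i\<bar> < \<epsilon>}"
    have "x \<in> U" "openin (Euclidean_space n) U"
      unfolding U_def using xE \<open>\<epsilon> > 0\<close> openin_box by simp_all
    then obtain y where "y \<in> A" "y \<in> U" using x in_closure_of by metis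
    then show "\<exists>y\<in>A. \<forall>i<n. \<bar>x i - y i\<bar> < \<epsilon>" unfolding U_def by blast
  next
    fix x assume "x \<in> {x \<in> topspace (Euclidean_space n). \<forall>\<epsilon>>0. \<exists>y\<in>A. \<forall>i<n. \<bar>x i - y i\<bar> < \<epsilon>}"
    then have x: "x \<in> topspace (Euclidean_space n)"
      "\<And>\<epsilon>. \<epsilon> > 0 \<Longrightarrow> \<exists>y\<in>A. \<forall>i<n. \<bar>x i - y i\<bar> < \<epsilon>" by auto
    show "x \<in> Euclidean_space n closure_of A"
      unfolding in_closure_of
    proof (intro conjI allI impI x(1))
      fix U assume "x \<in> U \<and> openin (Euclidean_space n) U"
      then obtain e where "e > 0" "\<forall>y\<in>topspace (Euclidean_space n). (\<forall>i<n. \<bar>x i - y i\<bar> < e) \<longrightarrow> y \<in> U"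
        using open_contains_box by blast
      then show "\<exists>y. y \<in> A \<and> y \<in> U" using x(2)[of e] semialgebraic_subset[OF assms] by blast
    qed
  qed
  then show ?thesis using semialgebraic_box_closure[OF assms] by simp
qed

text \<open>
  An open continuous parametrisation turns closures into closures relative to its domain, which
  reduces the claim to Euclidean space.
\<close>

lemma sa_subset_closure:
  assumes wf: "wf_sa_space M" and A: "sa_subset M A"
  shows "sa_subset M (sa_top M closure_of A)"
proof -
  let ?E = "Euclidean_space (sa_dim M)"
  let ?S = "subtopology ?E (sa_dom M)"
  let ?pre = "\<lambda>A. {x \<in> sa_dom M. sa_par M x \<in> A}"
  have dom: "semialgebraic (sa_dim M) (sa_dom M)"
    and cont: "continuous_map ?S (sa_top M) (sa_par M)" and op: "open_map ?S (sa_top M) (sa_par M)"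
    using wf unfolding wf_sa_space_def by auto
  have sub: "sa_dom M \<subseteq> topspace ?E" by (rule semialgebraic_subset[OF dom])
  have ts: "topspace ?S = sa_dom M" using sub by auto
  have clS: "?S closure_of ?pre A = sa_dom M \<inter> (?E closure_of ?pre A)"
    by (subst closure_of_subtopology) (auto intro: arg_cong2[where f="(closure_of)"] simp: Int_def)
  have "?pre (sa_top M closure_of A) = ?S closure_of ?pre A"
  proof (intro equalityI subsetI)
    fix x assume x: "x \<in> ?pre (sa_top M closure_of A)"
    show "x \<in> ?S closure_of ?pre A"
      unfolding in_closure_of
    proof (intro conjI allI impI)
      show "x \<in> topspace ?S" using x ts by simp
      fix U assume U: "x \<in> U \<and> openin ?S U"
      then have "openin (sa_top M) (sa_par M ` U)" using op by (simp add: open_map_def)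
      moreover have "sa_par M x \<in> sa_par M ` U" using U by blast
      moreover have "sa_par M x \<in> sa_top M closure_of A" using x by simp
      ultimately obtain a where "a \<in> A" "a \<in> sa_par M ` U"
        unfolding in_closure_of by (metis (no_types, lifting))
      moreover have "U \<subseteq> sa_dom M" using U openin_subset ts by metis
      ultimately show "\<exists>y. y \<in> ?pre A \<and> y \<in> U" by blast
    qed
  next
    fix x assume x: "x \<in> ?S closure_of ?pre A"
    then have "sa_par M x \<in> sa_par M ` (?S closure_of ?pre A)" by blast
    also have "\<dots> \<subseteq> sa_top M closure_of (sa_par M ` ?pre A)"
      using cont by (rule continuous_map_image_closure_subset)
    also have "\<dots> \<subseteq> sa_top M closure_of A" by (rule closure_of_mono) auto
    finally show "x \<in> ?pre (sa_top M closure_of A)"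
      using x ts closure_of_subset_topspace[of ?S] by auto
  qed
  then have eq: "?pre (sa_top M closure_of A) = sa_dom M \<inter> (?E closure_of ?pre A)" unfolding clS .
  have "semialgebraic (sa_dim M) (?pre A)" using A by (simp add: sa_subset_def)
  then have "semialgebraic (sa_dim M) (?pre (sa_top M closure_of A))"
    unfolding eq by (intro semialgebraic_Int dom semialgebraic_closure)
  then show ?thesis
    unfolding sa_subset_def using closure_of_subset_topspace by (intro conjI)
qed

lemma sa_subset_Diff:
  assumes "sa_subset M A" "sa_subset M B"
  shows "sa_subset M (A - B)"
proof -
  have "{x \<in> sa_dom M. sa_par M x \<in> A - B} = {x \<in> sa_dom M. sa_par M x \<in> A} - {x \<in> sa_dom M. sa_par M x \<in> B}"
    by blast
  then show ?thesis using assms semialgebraic_Diff unfolding sa_subset_def by auto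
qed

lemma sa_subset_topspace:
  assumes "wf_sa_space M"
  shows "sa_subset M (topspace (sa_top M))"
proof -
  have "{x \<in> sa_dom M. sa_par M x \<in> topspace (sa_top M)} = sa_dom M"
    using assms unfolding wf_sa_space_def by blast
  then show ?thesis using assms unfolding wf_sa_space_def sa_subset_def by simp
qed

section \<open>The topology of symmetric products\<close>

lemma mset_of_fun_cong: "(\<And>i. i < n \<Longrightarrow> y i = y' i) \<Longrightarrow> mset_of_fun n y = mset_of_fun n y'"
  unfolding mset_of_fun_def by (auto intro: image_mset_cong)

lemma mset_of_fun_Suc: "mset_of_fun (Suc n) y = add_mset (y n) (mset_of_fun n y)"
  by (simp add: mset_of_fun_def lessThan_Suc)

lemma mset_of_fun_add: "mset_of_fun (k + l) y = mset_of_fun k y + mset_of_fun l (\<lambda>i. y (k + i))"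
  by (induction l) (simp_all add: mset_of_fun_Suc, simp add: mset_of_fun_def)

lemma size_mset_of_fun [simp]: "size (mset_of_fun n y) = n"
  by (simp add: mset_of_fun_def)

lemma set_mset_of_fun [simp]: "set_mset (mset_of_fun n y) = y ` {..<n}"
  by (simp add: mset_of_fun_def)

lemma mset_of_fun_eq_iff:
  "mset_of_fun n y = mset_of_fun n y' \<longleftrightarrow> (\<exists>\<pi>\<in>{\<pi>. \<pi> permutes {..<n}}. \<forall>i\<in>{..<n}. y i = y' (\<pi> i))"
proof
  assume "mset_of_fun n y = mset_of_fun n y'"
  then show "\<exists>\<pi>\<in>{\<pi>. \<pi> permutes {..<n}}. \<forall>i\<in>{..<n}. y i = y' (\<pi> i)"
    unfolding mset_of_fun_def
    using image_mset_eq_implies_permutes[OF finite_lessThan, of y n y'] by (metis mem_Collect_eq)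
next
  assume "\<exists>\<pi>\<in>{\<pi>. \<pi> permutes {..<n}}. \<forall>i\<in>{..<n}. y i = y' (\<pi> i)"
  then obtain \<pi> where \<pi>: "\<pi> permutes {..<n}" "\<forall>i\<in>{..<n}. y i = y' (\<pi> i)" by blast
  have "mset_of_fun n y = image_mset (\<lambda>i. y' (\<pi> i)) (mset_set {..<n})"
    unfolding mset_of_fun_def by (rule image_mset_cong) (use \<pi>(2) in auto)
  also have "\<dots> = image_mset y' (image_mset \<pi> (mset_set {..<n}))" by (simp add: image_mset.compositionality o_def)
  also have "image_mset \<pi> (mset_set {..<n}) = mset_set {..<n}" by (rule permutes_image_mset[OF \<pi>(1)])
  finally show "mset_of_fun n y = mset_of_fun n y'" by (simp add: mset_of_fun_def)
qed

lemma mset_of_fun_surj: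
  assumes "size M = n"
  obtains y where "M = mset_of_fun n y"
proof -
  obtain xs where "mset xs = M" using ex_mset by blast
  moreover have "mset_of_fun (length xs) ((!) xs) = mset xs"
    unfolding mset_of_fun_def by (metis atLeast_upt map_nth mset_map mset_upt lessThan_atLeast0)
  ultimately show ?thesis using assms that by (metis size_mset)
qed

lemma topspace_sym_prod:
  "topspace (sa_top (sym_prod n Y)) = {M. size M = n \<and> set_mset M \<subseteq> topspace (sa_top Y)}"
proof (intro equalityI subsetI)
  fix M assume "M \<in> topspace (sa_top (sym_prod n Y))"
  then obtain y where y: "M = mset_of_fun n y" "y \<in> PiE {..<n} (\<lambda>_. topspace (sa_top Y))"
    unfolding sym_prod_def sa_space.select_convs topspace_quotient_topology topspace_product_topology
    by (elim imageE)
  have "y i \<in> topspace (sa_top Y)" if "i < n" for i using PiE_mem[OF y(2), of i] that by simp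
  then show "M \<in> {M. size M = n \<and> set_mset M \<subseteq> topspace (sa_top Y)}"
    unfolding y(1) by auto
next
  fix M assume M: "M \<in> {M. size M = n \<and> set_mset M \<subseteq> topspace (sa_top Y)}"
  then obtain y where y: "M = mset_of_fun n y" using mset_of_fun_surj by blast
  then have "restrict y {..<n} \<in> topspace (product_topology (\<lambda>i. sa_top Y) {..<n})"
    using M by auto
  moreover have "M = mset_of_fun n (restrict y {..<n})" unfolding y by (rule mset_of_fun_cong) simp
  ultimately show "M \<in> topspace (sa_top (sym_prod n Y))"
    by (simp add: sym_prod_def topspace_quotient_topology)
qed

text \<open>
  The orbit map is open: the saturation of a box is the finite union of the boxes obtained by
  permuting its factors.
\<close>

lemma openin_sym_prod_box:
  assumes "\<And>i. i < n \<Longrightarrow> openin (sa_top Y) (W i)"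
  shows "openin (sa_top (sym_prod n Y)) {mset_of_fun n y |y. \<forall>i<n. y i \<in> W i}"
proof -
  let ?T = "product_topology (\<lambda>i. sa_top Y) {..<n}"
  let ?B = "{mset_of_fun n y |y. \<forall>i<n. y i \<in> W i}"
  let ?Pi = "{\<pi>. \<pi> permutes {..<n}}"
  have WY: "W i \<subseteq> topspace (sa_top Y)" if "i < n" for i using openin_subset[OF assms[OF that]] .
  have "?B \<subseteq> topspace (sa_top (sym_prod n Y))"
    unfolding topspace_sym_prod using WY by fastforce
  then have sub: "?B \<subseteq> mset_of_fun n ` topspace ?T"
    by (simp add: sym_prod_def topspace_quotient_topology)
  have "{y \<in> topspace ?T. mset_of_fun n y \<in> ?B} = (\<Union>\<pi>\<in>?Pi. PiE {..<n} (\<lambda>j. W (\<pi> j)))"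
  proof (intro equalityI subsetI)
    fix y assume "y \<in> {y \<in> topspace ?T. mset_of_fun n y \<in> ?B}"
    then obtain y' where y: "y \<in> extensional {..<n}" "\<forall>i<n. y' i \<in> W i" "mset_of_fun n y = mset_of_fun n y'"
      by (auto simp: PiE_def)
    then obtain \<pi> where \<pi>: "\<pi> permutes {..<n}" "\<forall>i\<in>{..<n}. y i = y' (\<pi> i)"
      unfolding mset_of_fun_eq_iff by blast
    then have "y \<in> PiE {..<n} (\<lambda>j. W (\<pi> j))"
      using y(1,2) permutes_in_image[OF \<pi>(1)] by (auto simp: PiE_iff)
    then show "y \<in> (\<Union>\<pi>\<in>?Pi. PiE {..<n} (\<lambda>j. W (\<pi> j)))" using \<pi>(1) by blast
  next
    fix y assume "y \<in> (\<Union>\<pi>\<in>?Pi. PiE {..<n} (\<lambda>j. W (\<pi> j)))"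
    then obtain \<pi> where \<pi>: "\<pi> permutes {..<n}" "y \<in> PiE {..<n} (\<lambda>j. W (\<pi> j))" by blast
    have "y i \<in> topspace (sa_top Y)" if "i < n" for i
      using PiE_mem[OF \<pi>(2), of i] WY[of "\<pi> i"] permutes_in_image[OF \<pi>(1), of i] that by auto
    then have "y \<in> topspace ?T" using \<pi>(2) by (simp add: PiE_iff)
    moreover have "mset_of_fun n y = mset_of_fun n (y \<circ> inv \<pi>)"
      unfolding mset_of_fun_eq_iff
      by (rule bexI[of _ \<pi>]) (use \<pi>(1) in \<open>auto simp: permutes_inverses\<close>)
    moreover have "\<forall>i<n. (y \<circ> inv \<pi>) i \<in> W i"
    proof (intro allI impI)
      fix i assume "i < n"
      then have "inv \<pi> i \<in> {..<n}" using permutes_in_image[OF permutes_inv[OF \<pi>(1)]] by blast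
      then have "y (inv \<pi> i) \<in> W (\<pi> (inv \<pi> i))" using \<pi>(2) by (rule PiE_mem[rotated])
      then show "(y \<circ> inv \<pi>) i \<in> W i" using permutes_inverses(1)[OF \<pi>(1)] by simp
    qed
    ultimately show "y \<in> {y \<in> topspace ?T. mset_of_fun n y \<in> ?B}" by blast
  qed
  moreover have "openin ?T (\<Union>\<pi>\<in>?Pi. PiE {..<n} (\<lambda>j. W (\<pi> j)))"
  proof (rule openin_Union, safe)
    fix \<pi> assume \<pi>: "\<pi> permutes {..<n}"
    show "openin ?T (PiE {..<n} (\<lambda>j. W (\<pi> j)))"
      unfolding openin_PiE_gen using assms permutes_in_image[OF \<pi>] by auto
  qed
  ultimately have "openin ?T {y \<in> topspace ?T. mset_of_fun n y \<in> ?B}" by simp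
  then show ?thesis using sub by (simp only: sym_prod_def sa_space.select_convs openin_quotient_topology simp_thms)
qed

lemma openin_sym_prod_contains_box:
  assumes U: "openin (sa_top (sym_prod n Y)) U" "mset_of_fun n y \<in> U"
  obtains W where "\<And>i. i < n \<Longrightarrow> openin (sa_top Y) (W i)" "\<And>i. i < n \<Longrightarrow> y i \<in> W i"
    "\<And>y'. (\<And>i. i < n \<Longrightarrow> y' i \<in> W i) \<Longrightarrow> mset_of_fun n y' \<in> U"
proof -
  let ?T = "product_topology (\<lambda>i. sa_top Y) {..<n}"
  have op: "openin ?T {y \<in> topspace ?T. mset_of_fun n y \<in> U}"
    using U(1) by (simp add: sym_prod_def openin_quotient_topology)
  have "mset_of_fun n y \<in> topspace (sa_top (sym_prod n Y))" using U openin_subset by blast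
  then have "restrict y {..<n} \<in> topspace ?T"
    unfolding topspace_sym_prod by auto
  moreover have restr: "mset_of_fun n (restrict y {..<n}) = mset_of_fun n y" for y :: "nat \<Rightarrow> 'a"
    by (rule mset_of_fun_cong) simp
  ultimately have "restrict y {..<n} \<in> {y \<in> topspace ?T. mset_of_fun n y \<in> U}" using U(2) by simp
  from product_topology_open_contains_basis[OF op this]
  obtain W where W: "restrict y {..<n} \<in> PiE {..<n} W" "\<forall>i. openin (sa_top Y) (W i)"
    "PiE {..<n} W \<subseteq> {y \<in> topspace ?T. mset_of_fun n y \<in> U}"
    by (elim exE conjE)
  show ?thesis
  proof (rule that)
    show "openin (sa_top Y) (W i)" for i using W(2) by simp
    show "y i \<in> W i" if "i < n" for i using PiE_mem[OF W(1), of i] that by simp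
    fix y' assume "\<And>i. i < n \<Longrightarrow> y' i \<in> W i"
    then have "restrict y' {..<n} \<in> PiE {..<n} W" by auto
    then have "mset_of_fun n (restrict y' {..<n}) \<in> U" using W(3) by blast
    then show "mset_of_fun n y' \<in> U" unfolding restr .
  qed
qed

section \<open>Splitting a multiset along three strata\<close>

lemma all_of_size_filter_mset:
  assumes "size (filter_mset P M) = size M"
  shows "filter_mset P M = M"
  using assms by (metis add_cancel_left_right multiset_partition size_union size_eq_0_iff_empty add.right_neutral)

lemma filter_mset_trivial:
  "(\<And>x. x \<in># M \<Longrightarrow> P x) \<Longrightarrow> filter_mset P M = M"
  "(\<And>x. x \<in># M \<Longrightarrow> \<not> P x) \<Longrightarrow> filter_mset P M = {#}"
  by (simp_all add: filter_mset_eq_conv)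

definition count_stratum :: "'a sa_space \<Rightarrow> 'a set \<Rightarrow> 'a set \<Rightarrow> 'a set \<Rightarrow> nat \<Rightarrow> nat \<Rightarrow> nat \<Rightarrow> 'a multiset set" where
  "count_stratum X A B C k l m =
     {M \<in> topspace (sa_top (sym_prod (k + l + m) X)).
        size (filter_mset (\<lambda>p. p \<in> A) M) = k \<and> size (filter_mset (\<lambda>p. p \<in> B) M) = l \<and>
        size (filter_mset (\<lambda>p. p \<in> C) M) = m}"

definition mset_split :: "'a set \<Rightarrow> 'a set \<Rightarrow> 'a set \<Rightarrow> 'a multiset \<Rightarrow> 'a multiset \<times> 'a multiset \<times> 'a multiset" where
  "mset_split A B C M = (filter_mset (\<lambda>p. p \<in> A) M, filter_mset (\<lambda>p. p \<in> B) M, filter_mset (\<lambda>p. p \<in> C) M)"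

definition mset_join :: "'a multiset \<times> 'a multiset \<times> 'a multiset \<Rightarrow> 'a multiset" where
  "mset_join = (\<lambda>(P, Q, R). P + Q + R)"

text \<open>
  The argument concerns any three disjoint semialgebraic sets of which the second is closed and the
  third is open. Since the counts \<open>k\<close>, \<open>l\<close>, \<open>m\<close> add up to the
  cardinality, the multisets of the stratum lie in the union of these sets.
\<close>

locale three_strata =
  fixes X :: "'a sa_space" and A B C :: "'a set" and k l m :: nat
  assumes wf: "wf_sa_space X"
    and disj: "A \<inter> B = {}" "A \<inter> C = {}" "B \<inter> C = {}"
    and sa: "sa_subset X A" "sa_subset X B" "sa_subset X C"
    and closed: "closedin (sa_top X) B"
    and op: "openin (sa_top X) C"
begin

abbreviation "n \<equiv> k + l + m"
abbreviation "D \<equiv> count_stratum X A B C k l m"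
abbreviation "Mspace \<equiv> sa_sub (sym_prod n X) D"
abbreviation "Nspace \<equiv> sa_prod (sym_prod k (sa_sub X A))
  (sa_prod (sym_prod l (sa_sub X B)) (sym_prod m (sa_sub X C)))"

definition part :: "nat \<Rightarrow> 'a set" where
  "part i = (if i < k then A else if i < k + l then B else C)"

lemma parts: "i < k \<Longrightarrow> part i = A" "i < l \<Longrightarrow> part (k + i) = B" "part (k + l + i) = C"
  by (simp_all add: part_def)

lemma topspace_sub: "S \<subseteq> topspace (sa_top X) \<Longrightarrow> topspace (sa_top (sa_sub X S)) = S"
  by (auto simp: sa_sub_def)

lemma subsets: "A \<subseteq> topspace (sa_top X)" "B \<subseteq> topspace (sa_top X)" "C \<subseteq> topspace (sa_top X)"
  using sa by (simp_all add: sa_subset_def)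

lemma topspace_N: "topspace (sa_top Nspace) =
   {P. size P = k \<and> set_mset P \<subseteq> A} \<times> {Q. size Q = l \<and> set_mset Q \<subseteq> B} \<times> {R. size R = m \<and> set_mset R \<subseteq> C}"
  by (simp add: sa_prod_def topspace_sym_prod topspace_sub subsets)

lemma D_subset: "D \<subseteq> topspace (sa_top (sym_prod n X))"
  by (auto simp: count_stratum_def)

lemma topspace_M: "topspace (sa_top Mspace) = D"
  using D_subset by (auto simp: sa_sub_def)

lemma join_split: 
  assumes "set_mset P \<subseteq> A" "set_mset Q \<subseteq> B" "set_mset R \<subseteq> C"
  shows "mset_split A B C (mset_join (P, Q, R)) = (P, Q, R)"
proof -
  have "filter_mset (\<lambda>p. p \<in> A) P = P" "filter_mset (\<lambda>p. p \<in> A) Q = {#}" "filter_mset (\<lambda>p. p \<in> A) R = {#}"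
    "filter_mset (\<lambda>p. p \<in> B) P = {#}" "filter_mset (\<lambda>p. p \<in> B) Q = Q" "filter_mset (\<lambda>p. p \<in> B) R = {#}"
    "filter_mset (\<lambda>p. p \<in> C) P = {#}" "filter_mset (\<lambda>p. p \<in> C) Q = {#}" "filter_mset (\<lambda>p. p \<in> C) R = R"
    by (rule filter_mset_trivial; use assms disj in blast)+
  then show ?thesis by (simp add: mset_split_def mset_join_def)
qed

lemma join_in_D:
  assumes "p \<in> topspace (sa_top Nspace)"
  shows "mset_join p \<in> D"
proof -
  obtain P Q R where p: "p = (P, Q, R)" by (cases p)
  then have PQR: "size P = k" "set_mset P \<subseteq> A" "size Q = l" "set_mset Q \<subseteq> B" "size R = m" "set_mset R \<subseteq> C"
    using assms unfolding topspace_N by auto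
  have "mset_split A B C (mset_join p) = (P, Q, R)" using join_split PQR p by simp
  moreover have "mset_join p \<in> topspace (sa_top (sym_prod n X))"
    using PQR p subsets by (auto simp: topspace_sym_prod mset_join_def)
  ultimately show ?thesis using PQR by (simp add: count_stratum_def mset_split_def)
qed

lemma split_in_N:
  assumes "M \<in> D"
  shows "mset_split A B C M \<in> topspace (sa_top Nspace)" "mset_join (mset_split A B C M) = M"
proof -
  show "mset_split A B C M \<in> topspace (sa_top Nspace)"
    using assms unfolding topspace_N by (auto simp: count_stratum_def mset_split_def)
  have "filter_mset (\<lambda>p. p \<in> A) M + filter_mset (\<lambda>p. p \<in> B) M = filter_mset (\<lambda>p. p \<in> A \<union> B) M"
    "filter_mset (\<lambda>p. p \<in> A \<union> B) M + filter_mset (\<lambda>p. p \<in> C) M = filter_mset (\<lambda>p. p \<in> A \<union> B \<union> C) M"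
    using disj by (auto intro!: multiset_eqI)
  then have sum: "mset_join (mset_split A B C M) = filter_mset (\<lambda>p. p \<in> A \<union> B \<union> C) M"
    by (simp add: mset_join_def mset_split_def)
  have "size (mset_join (mset_split A B C M)) = size M"
    using assms by (simp add: mset_join_def mset_split_def count_stratum_def topspace_sym_prod)
  then show "mset_join (mset_split A B C M) = M"
    unfolding sum by (rule all_of_size_filter_mset)
qed

text \<open>
  A triple of multisets is represented by a single tuple: first the \<open>k\<close> points in \<open>A\<close>, then the \<open>l\<close> points
  in \<open>B\<close>, then the \<open>m\<close> points in \<open>C\<close>.
\<close>

lemma obtain_representative:
  assumes "(P, Q, R) \<in> topspace (sa_top Nspace)"
  obtains y where "P = mset_of_fun k y" "Q = mset_of_fun l (\<lambda>i. y (k + i))" "R = mset_of_fun m (\<lambda>i. y (k + l + i))"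
    "mset_of_fun n y = mset_join (P, Q, R)" "\<And>i. i < n \<Longrightarrow> y i \<in> part i"
proof -
  have PQR: "size P = k" "set_mset P \<subseteq> A" "size Q = l" "set_mset Q \<subseteq> B" "size R = m" "set_mset R \<subseteq> C"
    using assms unfolding topspace_N by auto
  obtain a where a: "P = mset_of_fun k a" using mset_of_fun_surj[OF PQR(1)] .
  obtain b where b: "Q = mset_of_fun l b" using mset_of_fun_surj[OF PQR(3)] .
  obtain c where c: "R = mset_of_fun m c" using mset_of_fun_surj[OF PQR(5)] .
  define y where "y = (\<lambda>i. if i < k then a i else if i < k + l then b (i - k) else c (i - (k + l)))"
  have 1: "P = mset_of_fun k y" unfolding a by (rule mset_of_fun_cong) (simp add: y_def)
  have 2: "Q = mset_of_fun l (\<lambda>i. y (k + i))" unfolding b by (rule mset_of_fun_cong) (simp add: y_def)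
  have 3: "R = mset_of_fun m (\<lambda>i. y (k + l + i))" unfolding c by (rule mset_of_fun_cong) (simp add: y_def)
  show ?thesis
  proof (rule that[OF 1 2 3])
    show "mset_of_fun n y = mset_join (P, Q, R)" by (simp add: mset_of_fun_add mset_join_def flip: 1 2 3)
    fix i assume i: "i < n"
    have "a i \<in> A" if "i < k" for i using that PQR(2) a by auto
    moreover have "b i \<in> B" if "i < l" for i using that PQR(4) b by auto
    moreover have "c i \<in> C" if "i < m" for i using that PQR(6) c by auto
    ultimately show "y i \<in> part i" using i by (auto simp: y_def part_def)
  qed
qed

lemma join_continuous: "continuous_map (sa_top Nspace) (sa_top Mspace) mset_join"
proof -
  have "continuous_map (sa_top Nspace) (sa_top (sym_prod n X)) mset_join"
    unfolding continuous_map_eq_topcontinuous_at topcontinuous_at_def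
  proof (intro ballI conjI allI impI)
    fix p assume p: "p \<in> topspace (sa_top Nspace)"
    then show "p \<in> topspace (sa_top Nspace)" .
    show "mset_join \<in> topspace (sa_top Nspace) \<rightarrow> topspace (sa_top (sym_prod n X))"
      using join_in_D D_subset by blast
    fix V assume V: "openin (sa_top (sym_prod n X)) V \<and> mset_join p \<in> V"
    obtain P Q R where pe: "p = (P, Q, R)" by (cases p)
    obtain y where y: "P = mset_of_fun k y" "Q = mset_of_fun l (\<lambda>i. y (k + i))"
      "R = mset_of_fun m (\<lambda>i. y (k + l + i))" "mset_of_fun n y = mset_join p" "\<And>i. i < n \<Longrightarrow> y i \<in> part i"
      using obtain_representative[of P Q R] p pe by blast
    then have "mset_of_fun n y \<in> V" using V by simp
    then obtain W where W: "\<And>i. i < n \<Longrightarrow> openin (sa_top X) (W i)" "\<And>i. i < n \<Longrightarrow> y i \<in> W i"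
      "\<And>y'. (\<And>i. i < n \<Longrightarrow> y' i \<in> W i) \<Longrightarrow> mset_of_fun n y' \<in> V"
      using openin_sym_prod_contains_box V by blast
    let ?U1 = "{mset_of_fun k y |y. \<forall>i<k. y i \<in> A \<inter> W i}"
    let ?U2 = "{mset_of_fun l y |y. \<forall>i<l. y i \<in> B \<inter> W (k + i)}"
    let ?U3 = "{mset_of_fun m y |y. \<forall>i<m. y i \<in> C \<inter> W (k + l + i)}"
    have "openin (sa_top (sa_sub X S)) (S \<inter> W i)" if "i < n" for S i
      using W(1)[OF that] by (simp add: sa_sub_def openin_subtopology_Int2)
    then have "openin (sa_top (sym_prod k (sa_sub X A))) ?U1"
      "openin (sa_top (sym_prod l (sa_sub X B))) ?U2" "openin (sa_top (sym_prod m (sa_sub X C))) ?U3"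
      by (intro openin_sym_prod_box; simp)+
    then have "openin (sa_top Nspace) (?U1 \<times> ?U2 \<times> ?U3)"
      by (simp add: sa_prod_def openin_prod_Times_iff)
    moreover have "P \<in> ?U1" unfolding y(1) using y(5) W(2) parts(1)
      by (intro CollectI exI[of _ y] conjI refl allI impI IntI) (metis trans_less_add1)+
    moreover have "Q \<in> ?U2" unfolding y(2) using y(5)[of "k + _"] W(2) parts(2)
      by (intro CollectI exI[of _ "\<lambda>i. y (k + i)"] conjI refl allI impI IntI) (metis nat_add_left_cancel_less trans_less_add1)+
    moreover have "R \<in> ?U3" unfolding y(3) using y(5) W(2) parts(3)
      by (intro CollectI exI[of _ "\<lambda>i. y (k + l + i)"] conjI refl allI impI IntI) (metis nat_add_left_cancel_less)+
    moreover have "\<forall>q\<in>?U1 \<times> ?U2 \<times> ?U3. mset_join q \<in> V"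
    proof
      fix q assume "q \<in> ?U1 \<times> ?U2 \<times> ?U3"
      then obtain a b c where q: "q = (mset_of_fun k a, mset_of_fun l b, mset_of_fun m c)"
        and abc: "\<forall>i<k. a i \<in> W i" "\<forall>i<l. b i \<in> W (k + i)" "\<forall>i<m. c i \<in> W (k + l + i)" by blast
      define z where "z = (\<lambda>i. if i < k then a i else if i < k + l then b (i - k) else c (i - (k + l)))"
      have 1: "mset_of_fun k a = mset_of_fun k z" by (rule mset_of_fun_cong) (simp add: z_def)
      have 2: "mset_of_fun l b = mset_of_fun l (\<lambda>i. z (k + i))" by (rule mset_of_fun_cong) (simp add: z_def)
      have 3: "mset_of_fun m c = mset_of_fun m (\<lambda>i. z (k + l + i))" by (rule mset_of_fun_cong) (simp add: z_def)
      have "mset_join q = mset_of_fun n z" unfolding q 1 2 3 by (simp add: mset_of_fun_add mset_join_def)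
      moreover have "z i \<in> W i" if "i < n" for i
      proof -
        consider "i < k" | "k \<le> i" "i < k + l" | "k + l \<le> i" by linarith
        then show ?thesis
        proof cases
          case 2
          then show ?thesis using abc(2)[rule_format, of "i - k"] by (simp add: z_def)
        next
          case 3
          then show ?thesis using abc(3)[rule_format, of "i - (k + l)"] that by (simp add: z_def)
        qed (use abc in \<open>simp add: z_def\<close>)
      qed
      ultimately show "mset_join q \<in> V" using W(3)[of z] by simp
    qed
    ultimately show "\<exists>U. openin (sa_top Nspace) U \<and> p \<in> U \<and> (\<forall>q\<in>U. mset_join q \<in> V)"
      unfolding pe by (intro exI[of _ "?U1 \<times> ?U2 \<times> ?U3"] conjI SigmaI)
  qed
  then show ?thesis
    using join_in_D by (auto simp: sa_sub_def continuous_map_in_subtopology)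
qed

text \<open>
  The heart of the matter: in the stratum, the counts decide to which set each point belongs. The last \<open>m\<close>
  points are in \<open>C\<close>, so no other point is. The first \<open>k\<close> points avoid \<open>B\<close>, so all \<open>l\<close> points in \<open>B\<close> are found in
  the middle and fill it. What remains for the \<open>k\<close> points in \<open>A\<close> are the first \<open>k\<close> places.
\<close>

lemma split_in_separating_box:
  assumes y: "\<And>i. i < k \<Longrightarrow> y i \<notin> B" "\<And>i. i < m \<Longrightarrow> y (k + l + i) \<in> C"
    and D: "mset_of_fun n y \<in> D"
  shows "mset_split A B C (mset_of_fun n y) =
      (mset_of_fun k y, mset_of_fun l (\<lambda>i. y (k + i)), mset_of_fun m (\<lambda>i. y (k + l + i)))"
    and "\<And>i. i < k \<Longrightarrow> y i \<in> A" "\<And>i. i < l \<Longrightarrow> y (k + i) \<in> B"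
proof -
  let ?P = "mset_of_fun k y" and ?Q = "mset_of_fun l (\<lambda>i. y (k + i))" and ?R = "mset_of_fun m (\<lambda>i. y (k + l + i))"
  have M: "mset_of_fun n y = ?P + ?Q + ?R" by (simp add: mset_of_fun_add)
  have sizes: "size (filter_mset (\<lambda>p. p \<in> A) (?P + ?Q + ?R)) = k" "size (filter_mset (\<lambda>p. p \<in> B) (?P + ?Q + ?R)) = l"
    "size (filter_mset (\<lambda>p. p \<in> C) (?P + ?Q + ?R)) = m"
    using D unfolding M count_stratum_def by auto
  have R: "filter_mset (\<lambda>p. p \<in> C) ?R = ?R" "filter_mset (\<lambda>p. p \<in> A) ?R = {#}" "filter_mset (\<lambda>p. p \<in> B) ?R = {#}"
    by (rule filter_mset_trivial; use y(2) disj in auto)+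
  have P: "filter_mset (\<lambda>p. p \<in> B) ?P = {#}" by (rule filter_mset_trivial) (use y(1) in auto)
  have "size (filter_mset (\<lambda>p. p \<in> B) ?Q) = size ?Q"
    using sizes(2) by (simp only: filter_union_mset P R(3) size_empty add_0_right add_0_left size_mset_of_fun)
  then have Q: "filter_mset (\<lambda>p. p \<in> B) ?Q = ?Q" by (rule all_of_size_filter_mset)
  then have QB: "set_mset ?Q \<subseteq> B" by (metis filter_mset_eq_conv subsetI)
  then have QA: "filter_mset (\<lambda>p. p \<in> A) ?Q = {#}" by (intro filter_mset_trivial) (use disj in auto)
  have "size (filter_mset (\<lambda>p. p \<in> A) ?P) = size ?P"
    using sizes(1) by (simp only: filter_union_mset QA R(2) size_empty add_0_right size_mset_of_fun)
  then have PA: "filter_mset (\<lambda>p. p \<in> A) ?P = ?P" by (rule all_of_size_filter_mset)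
  then have PA': "set_mset ?P \<subseteq> A" by (metis filter_mset_eq_conv subsetI)
  show "mset_split A B C (mset_of_fun n y) = (?P, ?Q, ?R)"
    using join_split[OF PA' QB, of ?R] y(2) unfolding M mset_join_def by auto
  show "\<And>i. i < k \<Longrightarrow> y i \<in> A" "\<And>i. i < l \<Longrightarrow> y (k + i) \<in> B" using PA' QB by auto
qed

text \<open>
  Near a given multiset of the stratum, the neighbourhoods of the points in \<open>A\<close> can be chosen disjoint from
  the closed set \<open>B\<close>, and those of the points in \<open>C\<close> inside the open set \<open>C\<close>.
\<close>

lemma split_continuous: "continuous_map (sa_top Mspace) (sa_top Nspace) (mset_split A B C)"
  unfolding continuous_map_eq_topcontinuous_at topcontinuous_at_def
proof (intro ballI conjI allI impI)
  fix M assume M: "M \<in> topspace (sa_top Mspace)"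
  then show "M \<in> topspace (sa_top Mspace)" .
  have MD: "M \<in> D" using M topspace_M by simp
  show "mset_split A B C \<in> topspace (sa_top Mspace) \<rightarrow> topspace (sa_top Nspace)"
    using split_in_N topspace_M by blast
  have N: "mset_split A B C M \<in> topspace (sa_top Nspace)" by (rule split_in_N[OF MD])
  fix V assume V: "openin (sa_top Nspace) V \<and> mset_split A B C M \<in> V"
  obtain P Q R where PQR: "mset_split A B C M = (P, Q, R)" by (rule prod_cases3)
  obtain y where y: "P = mset_of_fun k y" "Q = mset_of_fun l (\<lambda>i. y (k + i))"
    "R = mset_of_fun m (\<lambda>i. y (k + l + i))" "mset_of_fun n y = mset_join (P, Q, R)" "\<And>i. i < n \<Longrightarrow> y i \<in> part i"
    using obtain_representative[of P Q R] N PQR by metis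
  have My: "M = mset_of_fun n y" using split_in_N(2)[OF MD] PQR y(4) by simp
  have V': "openin (prod_topology (sa_top (sym_prod k (sa_sub X A)))
      (prod_topology (sa_top (sym_prod l (sa_sub X B))) (sa_top (sym_prod m (sa_sub X C))))) V"
    "(P, Q, R) \<in> V" using V PQR by (simp_all add: sa_prod_def)
  obtain V1 V23 where V1: "openin (sa_top (sym_prod k (sa_sub X A))) V1" "P \<in> V1"
    and V23: "openin (prod_topology (sa_top (sym_prod l (sa_sub X B))) (sa_top (sym_prod m (sa_sub X C)))) V23"
      "(Q, R) \<in> V23" "V1 \<times> V23 \<subseteq> V"
    using V' unfolding openin_prod_topology_alt by meson
  obtain V2 V3 where V2: "openin (sa_top (sym_prod l (sa_sub X B))) V2" "Q \<in> V2"
    and V3: "openin (sa_top (sym_prod m (sa_sub X C))) V3" "R \<in> V3" "V2 \<times> V3 \<subseteq> V23"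
    using V23 unfolding openin_prod_topology_alt by meson
  have lift: "\<exists>W. (\<forall>i<j. openin (sa_top X) (W i) \<and> z i \<in> W i) \<and>
      (\<forall>z'. (\<forall>i<j. z' i \<in> W i \<inter> S) \<longrightarrow> mset_of_fun j z' \<in> U)"
    if U: "openin (sa_top (sym_prod j (sa_sub X S))) U" "mset_of_fun j z \<in> U" for j S U and z :: "nat \<Rightarrow> 'a"
  proof -
    obtain W where W: "\<And>i. i < j \<Longrightarrow> openin (sa_top (sa_sub X S)) (W i)" "\<And>i. i < j \<Longrightarrow> z i \<in> W i"
      "\<And>z'. (\<And>i. i < j \<Longrightarrow> z' i \<in> W i) \<Longrightarrow> mset_of_fun j z' \<in> U"
      using openin_sym_prod_contains_box[OF U] by blast
    have "\<forall>i. \<exists>W'. i < j \<longrightarrow> openin (sa_top X) W' \<and> W i = W' \<inter> S"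
      using W(1) by (auto simp: sa_sub_def openin_subtopology)
    then obtain W' where "\<And>i. i < j \<Longrightarrow> openin (sa_top X) (W' i) \<and> W i = W' i \<inter> S" by metis
    then show ?thesis using W by (intro exI[of _ W']) auto
  qed
  obtain W1 where W1: "\<forall>i<k. openin (sa_top X) (W1 i) \<and> y i \<in> W1 i"
    "\<forall>z'. (\<forall>i<k. z' i \<in> W1 i \<inter> A) \<longrightarrow> mset_of_fun k z' \<in> V1"
    using lift[OF V1(1), of y] V1(2) y(1) by blast
  obtain W2 where W2: "\<forall>i<l. openin (sa_top X) (W2 i) \<and> y (k + i) \<in> W2 i"
    "\<forall>z'. (\<forall>i<l. z' i \<in> W2 i \<inter> B) \<longrightarrow> mset_of_fun l z' \<in> V2"
    using lift[OF V2(1), of "\<lambda>i. y (k + i)"] V2(2) y(2) by blast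
  obtain W3 where W3: "\<forall>i<m. openin (sa_top X) (W3 i) \<and> y (k + l + i) \<in> W3 i"
    "\<forall>z'. (\<forall>i<m. z' i \<in> W3 i \<inter> C) \<longrightarrow> mset_of_fun m z' \<in> V3"
    using lift[OF V3(1), of "\<lambda>i. y (k + l + i)"] V3(2) y(3) by blast
  \<comment> \<open>Neighbourhoods of points in \<open>B\<close> may meet \<open>A\<close> and \<open>C\<close>; there the counts keep intruders out.\<close>
  define W where "W = (\<lambda>i. if i < k then W1 i - B else if i < k + l then W2 (i - k) else W3 (i - (k + l)) \<inter> C)"
  have part_i: "i < k \<or> (\<exists>j<l. i = k + j) \<or> (\<exists>j<m. i = k + l + j)" if "i < n" for i
    using that by presburger
  have W: "openin (sa_top X) (W i) \<and> y i \<in> W i" if "i < n" for i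
    using part_i[OF that]
  proof (elim disjE exE conjE)
    assume i: "i < k"
    then have "y i \<in> A" using y(5)[OF that] parts(1) by simp
    then show ?thesis using i W1(1) closed disj by (auto simp: W_def intro!: openin_diff)
  next
    fix j assume "j < l" "i = k + j"
    then show ?thesis using W2(1) by (simp add: W_def)
  next
    fix j assume "j < m" "i = k + l + j"
    then show ?thesis using W3(1) y(5)[OF that] parts(3)[of j] op by (auto simp: W_def)
  qed
  let ?box = "{mset_of_fun n y |y. \<forall>i<n. y i \<in> W i}"
  have "openin (sa_top (sym_prod n X)) ?box" by (rule openin_sym_prod_box) (use W in blast)
  then have "openin (sa_top Mspace) (D \<inter> ?box)" by (simp add: sa_sub_def openin_subtopology_Int2)
  moreover have "M \<in> D \<inter> ?box" using MD My W by blast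
  moreover have "\<forall>M'\<in>D \<inter> ?box. mset_split A B C M' \<in> V"
  proof
    fix M' assume M': "M' \<in> D \<inter> ?box"
    then obtain z where z: "M' = mset_of_fun n z" "\<And>i. i < n \<Longrightarrow> z i \<in> W i" by blast
    have z1: "z i \<in> W1 i - B" if "i < k" for i using z(2)[of i] that by (simp add: W_def)
    have z2: "z (k + i) \<in> W2 i" if "i < l" for i using z(2)[of "k + i"] that by (simp add: W_def)
    have z3: "z (k + l + i) \<in> W3 i \<inter> C" if "i < m" for i using z(2)[of "k + l + i"] that by (simp add: W_def)
    have "mset_of_fun n z \<in> D" using M' z by simp
    note sp = split_in_separating_box[OF _ _ this]
    have zA: "z i \<in> A" if "i < k" for i by (rule sp(2)) (use z1 z3 that in auto)
    have zB: "z (k + i) \<in> B" if "i < l" for i by (rule sp(3)) (use z1 z3 that in auto)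
    have "mset_split A B C M' = (mset_of_fun k z, mset_of_fun l (\<lambda>i. z (k + i)), mset_of_fun m (\<lambda>i. z (k + l + i)))"
      unfolding z(1) by (rule sp(1)) (use z1 z3 in auto)
    moreover have "mset_of_fun k z \<in> V1" using W1(2)[rule_format, of z] z1 zA by auto
    moreover have "mset_of_fun l (\<lambda>i. z (k + i)) \<in> V2" using W2(2)[rule_format, of "\<lambda>i. z (k + i)"] z2 zB by auto
    moreover have "mset_of_fun m (\<lambda>i. z (k + l + i)) \<in> V3" using W3(2)[rule_format, of "\<lambda>i. z (k + l + i)"] z3 by auto
    ultimately show "mset_split A B C M' \<in> V" using V23(3) V3(3) by auto
  qed
  ultimately show "\<exists>U. openin (sa_top Mspace) U \<and> M \<in> U \<and> (\<forall>M'\<in>U. mset_split A B C M' \<in> V)" by blast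
qed

lemma homeomorphic_maps_split_join:
  "homeomorphic_maps (sa_top Mspace) (sa_top Nspace) (mset_split A B C) mset_join"
  unfolding homeomorphic_maps_def
  using split_continuous join_continuous split_in_N(2) join_split
  by (auto simp: topspace_M topspace_N)

section \<open>The graphs of the splitting and of the sum\<close>

text \<open>
  The parametrisations of both spaces consist of \<open>n\<close> blocks of coordinates, one for each point; \<open>block j x\<close>
  is the \<open>j\<close>-th of them.
\<close>

definition block :: "nat \<Rightarrow> (nat \<Rightarrow> real) \<Rightarrow> nat \<Rightarrow> real" where
  "block j x = slice (j * sa_dim X) (sa_dim X) x"

abbreviation "d \<equiv> sa_dim X"
abbreviation "E N \<equiv> topspace (Euclidean_space N)"
abbreviation "point x j \<equiv> sa_par X (block j x)"

lemma slice_eq_select: "slice a e x = select (\<lambda>j. a + j) e x"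
  by (simp add: slice_def select_def)

lemma slice_in_E [simp]: "slice a e x \<in> E e"
  by (simp add: slice_def topspace_Euclidean_space)

lemma block_bound: "j < N \<Longrightarrow> i < d \<Longrightarrow> j * d + i < N * d"
proof -
  assume "j < N" "i < d"
  then have "j * d + i < Suc j * d" by simp
  also have "\<dots> \<le> N * d" using \<open>j < N\<close> by (intro mult_le_mono1) simp
  finally show ?thesis .
qed

lemma slice_slice: "i + e \<le> e' \<Longrightarrow> slice i e (slice a e' x) = slice (a + i) e x"
  by (auto simp: slice_def fun_eq_iff add.assoc)

lemma block_slice: 
  assumes "j < N" "N * d \<le> e"
  shows "block j (slice (a * d) e x) = block (a + j) x"
proof -
  have "Suc j * d \<le> N * d" using assms(1) by (intro mult_le_mono1) simp
  then have "j * d + d \<le> e" using assms(2) by simp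
  then show ?thesis unfolding block_def by (simp add: slice_slice distrib_right)
qed

lemma semialgebraic_point_in:
  assumes "sa_subset X S" "j < N"
  shows "semialgebraic (N * d) {x \<in> E (N * d). block j x \<in> sa_dom X \<and> point x j \<in> S}"
proof -
  have "semialgebraic (N * d) {x \<in> E (N * d). block j x \<in> {x \<in> sa_dom X. sa_par X x \<in> S}}"
    unfolding block_def slice_eq_select
    by (rule semialgebraic_select) (use assms block_bound in \<open>auto simp: sa_subset_def\<close>)
  then show ?thesis by simp
qed

lemma semialgebraic_points_equal:
  assumes "i < N" "j < N"
  shows "semialgebraic (N * d) {x \<in> E (N * d). block i x \<in> sa_dom X \<and> block j x \<in> sa_dom X \<and> point x i = point x j}"
proof -
  let ?c = "\<lambda>t. if t < d then i * d + t else j * d + (t - d)"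
  let ?R = "{x \<in> E (d + d). slice 0 d x \<in> sa_dom X \<and> slice d d x \<in> sa_dom X \<and>
          sa_par X (slice 0 d x) = sa_par X (slice d d x)}"
  have "semialgebraic (d + d) ?R" using wf by (simp add: wf_sa_space_def)
  moreover have "?c t < N * d" if "t < d + d" for t
    using block_bound[OF assms(1), of t] block_bound[OF assms(2), of "t - d"] that by auto
  ultimately have "semialgebraic (N * d) {x \<in> E (N * d). select ?c (d + d) x \<in> ?R}"
    by (rule semialgebraic_select)
  moreover have "slice 0 d (select ?c (d + d) x) = block i x" "slice d d (select ?c (d + d) x) = block j x" for x
    by (auto simp: slice_def select_def block_def fun_eq_iff)
  moreover have "select ?c (d + d) x \<in> E (d + d)" for x
    by (simp add: select_def topspace_Euclidean_space)
  ultimately show ?thesis by simp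
qed

text \<open>
  The preimage of the graph, in a vector of \<open>2n\<close> blocks. The \<open>n\<close> blocks from \<open>b\<close> onwards describe a triple
  of multisets and the \<open>n\<close> blocks from \<open>a\<close> onwards its sum. The offsets are variable because the graphs of the two
  mutually inverse maps list these halves in opposite orders.
\<close>

definition sum_relation :: "nat \<Rightarrow> nat \<Rightarrow> (nat \<Rightarrow> real) set" where
  "sum_relation a b = {x \<in> E ((n + n) * d). (\<forall>i<n. block (a + i) x \<in> sa_dom X) \<and>
      (\<forall>i<n. block (b + i) x \<in> sa_dom X \<and> point x (b + i) \<in> part i) \<and>
      mset_of_fun n (\<lambda>i. point x (a + i)) = mset_of_fun n (\<lambda>i. point x (b + i))}"

text \<open>
  Two tuples have the same orbit if and only if one of the finitely many permutations takes one to the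
  other, so the relation is built from equality of single points.
\<close>

lemma semialgebraic_sum_relation:
  assumes "a \<le> n" "b \<le> n"
  shows "semialgebraic ((n + n) * d) (sum_relation a b)"
proof -
  let ?N = "(n + n) * d"
  let ?B = "{x \<in> E ?N. \<forall>i\<in>{..<n}. block (b + i) x \<in> sa_dom X \<and> point x (b + i) \<in> part i}"
  let ?P = "\<lambda>i j x. block (a + i) x \<in> sa_dom X \<and> block (b + j) x \<in> sa_dom X \<and> point x (a + i) = point x (b + j)"
  let ?S = "{x \<in> E ?N. \<exists>\<pi>\<in>{\<pi>. \<pi> permutes {..<n}}. \<forall>i\<in>{..<n}. ?P i (\<pi> i) x}"
  have "sum_relation a b = ?B \<inter> ?S"
  proof (intro equalityI subsetI)
    fix x assume x: "x \<in> sum_relation a b"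
    then obtain \<pi> where \<pi>: "\<pi> permutes {..<n}" "\<forall>i\<in>{..<n}. point x (a + i) = point x (b + \<pi> i)"
      unfolding sum_relation_def mset_of_fun_eq_iff by blast
    have "?P i (\<pi> i) x" if "i \<in> {..<n}" for i
      using x \<pi> that permutes_in_image[OF \<pi>(1), of i] unfolding sum_relation_def by simp
    then show "x \<in> ?B \<inter> ?S" using x \<pi>(1) unfolding sum_relation_def by auto
  next
    fix x assume "x \<in> ?B \<inter> ?S"
    then show "x \<in> sum_relation a b" unfolding sum_relation_def mset_of_fun_eq_iff by auto
  qed
  moreover have "semialgebraic ?N ?B"
  proof (rule semialgebraic_Ball)
    fix i assume "i \<in> {..<n}"
    then show "semialgebraic ?N {x \<in> E ?N. block (b + i) x \<in> sa_dom X \<and> point x (b + i) \<in> part i}"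
      using assms sa by (intro semialgebraic_point_in) (auto simp: part_def)
  qed simp
  moreover have "semialgebraic ?N ?S"
  proof (intro semialgebraic_Bex semialgebraic_Ball)
    fix \<pi> i assume "\<pi> \<in> {\<pi>. \<pi> permutes {..<n}}" "i \<in> {..<n}"
    then have "i < n" "\<pi> i < n" using permutes_in_image[of \<pi> "{..<n}" i] by auto
    then show "semialgebraic ?N {x \<in> E ?N. ?P i (\<pi> i) x}"
      using assms by (intro semialgebraic_points_equal) auto
  qed (simp_all add: finite_permutations)
  ultimately show ?thesis by (simp only: semialgebraic_Int)
qed

lemma dims: "sa_dim Mspace = n * d" "sa_dim Nspace = n * d"
  by (simp_all add: sa_sub_def sa_prod_def sym_prod_def algebra_simps)

lemma par_M: "sa_par Mspace x = mset_of_fun n (\<lambda>i. point x i)"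
  by (simp add: sa_sub_def sym_prod_def block_def)

lemma dom_M: "x \<in> sa_dom Mspace \<longleftrightarrow> x \<in> E (n * d) \<and> (\<forall>i<n. block i x \<in> sa_dom X) \<and> sa_par Mspace x \<in> D"
  by (simp add: sa_sub_def sym_prod_def block_def)

lemma block_slices:
  "i < k \<Longrightarrow> block i (slice 0 (k * d) x) = block i x"
  "i < l \<Longrightarrow> block i (slice 0 (l * d) (slice (k * d) (l * d + m * d) x)) = block (k + i) x"
  "i < m \<Longrightarrow> block i (slice (l * d) (m * d) (slice (k * d) (l * d + m * d) x)) = block (k + l + i) x"
  using block_slice[of i k "k * d" 0 x] block_slice[of i l "l * d" 0 "slice (k * d) (l * d + m * d) x"]
    block_slice[of i m "m * d" l "slice (k * d) (l * d + m * d) x"]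
    block_slice[of i "l + m" "l * d + m * d" k x] block_slice[of "l + i" "l + m" "l * d + m * d" k x]
  by (simp_all add: distrib_right add.assoc)

lemma par_N: "sa_par Nspace x =
   (mset_of_fun k (\<lambda>i. point x i), mset_of_fun l (\<lambda>i. point x (k + i)), mset_of_fun m (\<lambda>i. point x (k + l + i)))"
proof -
  have "sa_par Nspace x = (mset_of_fun k (\<lambda>i. sa_par X (block i (slice 0 (k * d) x))),
    mset_of_fun l (\<lambda>i. sa_par X (block i (slice 0 (l * d) (slice (k * d) (l * d + m * d) x)))),
    mset_of_fun m (\<lambda>i. sa_par X (block i (slice (l * d) (m * d) (slice (k * d) (l * d + m * d) x)))))"
    by (simp add: sa_sub_def sa_prod_def sym_prod_def block_def)
  also have "\<dots> = (mset_of_fun k (\<lambda>i. point x i), mset_of_fun l (\<lambda>i. point x (k + i)), mset_of_fun m (\<lambda>i. point x (k + l + i)))"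
    by (intro arg_cong2[where f=Pair] mset_of_fun_cong) (simp_all add: block_slices)
  finally show ?thesis .
qed

lemma all_less_parts:
  "(\<forall>i<n. Q i) \<longleftrightarrow> (\<forall>i<k. Q i) \<and> (\<forall>i<l. Q (k + i)) \<and> (\<forall>i<m. Q (k + l + i))"
proof (intro iffI conjI allI impI)
  fix i assume "(\<forall>i<k. Q i) \<and> (\<forall>i<l. Q (k + i)) \<and> (\<forall>i<m. Q (k + l + i))" "i < n"
  moreover have "i < k \<or> (\<exists>j<l. i = k + j) \<or> (\<exists>j<m. i = k + l + j)" using \<open>i < n\<close> by presburger
  ultimately show "Q i" by auto
qed auto

lemma dom_N: "x \<in> sa_dom Nspace \<longleftrightarrow>
   x \<in> E (n * d) \<and> (\<forall>i<n. block i x \<in> sa_dom X \<and> point x i \<in> part i)"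
proof -
  have "x \<in> sa_dom Nspace \<longleftrightarrow> x \<in> E (n * d) \<and>
     (\<forall>i<k. block i (slice 0 (k * d) x) \<in> sa_dom X \<and> sa_par X (block i (slice 0 (k * d) x)) \<in> A) \<and>
     (\<forall>i<l. block i (slice 0 (l * d) (slice (k * d) (l * d + m * d) x)) \<in> sa_dom X \<and>
        sa_par X (block i (slice 0 (l * d) (slice (k * d) (l * d + m * d) x))) \<in> B) \<and>
     (\<forall>i<m. block i (slice (l * d) (m * d) (slice (k * d) (l * d + m * d) x)) \<in> sa_dom X \<and>
        sa_par X (block i (slice (l * d) (m * d) (slice (k * d) (l * d + m * d) x))) \<in> C)"
    by (simp add: sa_sub_def sa_prod_def sym_prod_def block_def distrib_right add.assoc)
  then show ?thesis unfolding all_less_parts by (simp add: block_slices parts)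
qed

lemma join_par_N: "mset_join (sa_par Nspace x) = mset_of_fun n (\<lambda>i. point x i)"
  by (simp add: par_N mset_join_def mset_of_fun_add)

lemma par_N_in: "x \<in> sa_dom Nspace \<Longrightarrow> sa_par Nspace x \<in> topspace (sa_top Nspace)"
  unfolding dom_N par_N topspace_N all_less_parts by (auto simp: parts)

lemma block_half_slices:
  assumes "i < n"
  shows "block i (slice 0 (n * d) x) = block i x" "block i (slice (n * d) (n * d) x) = block (n + i) x"
  using block_slice[OF assms, of "n * d" 0 x] block_slice[OF assms, of "n * d" n x] by simp_all

lemma dims_sum: "(n + n) * d = n * d + n * d"
  by (rule distrib_right)

lemma in_graph_iff_same_points:
  assumes "u \<in> sa_dom Nspace" "v \<in> E (n * d)" "\<forall>i<n. block i v \<in> sa_dom X"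
  shows "v \<in> sa_dom Mspace \<and> sa_par Mspace v = mset_join (sa_par Nspace u) \<longleftrightarrow>
    mset_of_fun n (\<lambda>i. point v i) = mset_of_fun n (\<lambda>i. point u i)"
  using assms join_in_D[OF par_N_in[OF assms(1)]] by (auto simp: dom_M par_M join_par_N)

lemma sa_map_join: "sa_map Nspace Mspace mset_join"
proof -
  let ?G = "(\<lambda>p. (p, mset_join p)) ` topspace (sa_top Nspace)"
  have "{x \<in> sa_dom (sa_prod Nspace Mspace). sa_par (sa_prod Nspace Mspace) x \<in> ?G} = sum_relation n 0"
  proof (rule set_eqI)
    fix x
    let ?u = "slice 0 (n * d) x" and ?v = "slice (n * d) (n * d) x"
    have u: "?u \<in> sa_dom Nspace \<longleftrightarrow> (\<forall>i<n. block (0 + i) x \<in> sa_dom X \<and> point x (0 + i) \<in> part i)"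
      unfolding dom_N by (simp add: block_half_slices)
    have v: "(\<forall>i<n. block i ?v \<in> sa_dom X) \<longleftrightarrow> (\<forall>i<n. block (n + i) x \<in> sa_dom X)"
      by (simp add: block_half_slices)
    have "x \<in> {x \<in> sa_dom (sa_prod Nspace Mspace). sa_par (sa_prod Nspace Mspace) x \<in> ?G} \<longleftrightarrow>
      x \<in> E (n * d + n * d) \<and> ?u \<in> sa_dom Nspace \<and> ?v \<in> sa_dom Mspace \<and> sa_par Mspace ?v = mset_join (sa_par Nspace ?u)"
      using par_N_in[of ?u] unfolding sa_prod_def[of Nspace Mspace] by (auto simp: dims)
    also have "\<dots> \<longleftrightarrow> x \<in> E (n * d + n * d) \<and> ?u \<in> sa_dom Nspace \<and> (\<forall>i<n. block i ?v \<in> sa_dom X) \<and>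
        mset_of_fun n (\<lambda>i. point ?v i) = mset_of_fun n (\<lambda>i. point ?u i)"
      using in_graph_iff_same_points[of ?u ?v] dom_M[of ?v] by auto
    also have "mset_of_fun n (\<lambda>i. point ?v i) = mset_of_fun n (\<lambda>i. point x (n + i))"
      by (rule mset_of_fun_cong) (simp add: block_half_slices)
    also have "mset_of_fun n (\<lambda>i. point ?u i) = mset_of_fun n (\<lambda>i. point x (0 + i))"
      by (rule mset_of_fun_cong) (simp add: block_half_slices)
    finally show "x \<in> {x \<in> sa_dom (sa_prod Nspace Mspace). sa_par (sa_prod Nspace Mspace) x \<in> ?G} \<longleftrightarrow>
        x \<in> sum_relation n 0"
      unfolding sum_relation_def dims_sum u v mem_Collect_eq by blast
  qed
  moreover have "?G \<subseteq> topspace (sa_top (sa_prod Nspace Mspace))"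
    using join_in_D topspace_M by (auto simp: sa_prod_def[of Nspace Mspace])
  moreover have "sa_dim (sa_prod Nspace Mspace) = (n + n) * d"
    by (simp only: sa_prod_def[of Nspace Mspace] sa_space.select_convs dims dims_sum)
  ultimately show ?thesis
    unfolding sa_map_def sa_subset_def using semialgebraic_sum_relation[of n 0] join_continuous by simp
qed

lemma sa_map_split: "sa_map Mspace Nspace (mset_split A B C)"
proof -
  let ?G = "(\<lambda>p. (p, mset_split A B C p)) ` topspace (sa_top Mspace)"
  have inverse: "M \<in> D \<and> q = mset_split A B C M \<longleftrightarrow> M = mset_join q" if "q \<in> topspace (sa_top Nspace)" for M q
    using that split_in_N[of M] join_in_D[of q] join_split by (auto simp: topspace_N)
  have "{x \<in> sa_dom (sa_prod Mspace Nspace). sa_par (sa_prod Mspace Nspace) x \<in> ?G} = sum_relation 0 n"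
  proof (rule set_eqI)
    fix x
    let ?v = "slice 0 (n * d) x" and ?u = "slice (n * d) (n * d) x"
    have u: "?u \<in> sa_dom Nspace \<longleftrightarrow> (\<forall>i<n. block (n + i) x \<in> sa_dom X \<and> point x (n + i) \<in> part i)"
      unfolding dom_N by (simp add: block_half_slices)
    have v: "(\<forall>i<n. block i ?v \<in> sa_dom X) \<longleftrightarrow> (\<forall>i<n. block (0 + i) x \<in> sa_dom X)"
      by (simp add: block_half_slices)
    have "x \<in> {x \<in> sa_dom (sa_prod Mspace Nspace). sa_par (sa_prod Mspace Nspace) x \<in> ?G} \<longleftrightarrow>
      x \<in> E (n * d + n * d) \<and> ?u \<in> sa_dom Nspace \<and> ?v \<in> sa_dom Mspace \<and>
        sa_par Mspace ?v \<in> D \<and> sa_par Nspace ?u = mset_split A B C (sa_par Mspace ?v)"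
      unfolding sa_prod_def[of Mspace Nspace] by (auto simp: dims topspace_M)
    also have "\<dots> \<longleftrightarrow> x \<in> E (n * d + n * d) \<and> ?u \<in> sa_dom Nspace \<and> ?v \<in> sa_dom Mspace \<and>
        sa_par Mspace ?v = mset_join (sa_par Nspace ?u)"
      using inverse[OF par_N_in[of ?u]] by blast
    also have "\<dots> \<longleftrightarrow> x \<in> E (n * d + n * d) \<and> ?u \<in> sa_dom Nspace \<and> (\<forall>i<n. block i ?v \<in> sa_dom X) \<and>
        mset_of_fun n (\<lambda>i. point ?v i) = mset_of_fun n (\<lambda>i. point ?u i)"
      using in_graph_iff_same_points[of ?u ?v] dom_M[of ?v] by auto
    also have "mset_of_fun n (\<lambda>i. point ?u i) = mset_of_fun n (\<lambda>i. point x (n + i))"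
      by (rule mset_of_fun_cong) (simp add: block_half_slices)
    also have "mset_of_fun n (\<lambda>i. point ?v i) = mset_of_fun n (\<lambda>i. point x (0 + i))"
      by (rule mset_of_fun_cong) (simp add: block_half_slices)
    finally show "x \<in> {x \<in> sa_dom (sa_prod Mspace Nspace). sa_par (sa_prod Mspace Nspace) x \<in> ?G} \<longleftrightarrow>
        x \<in> sum_relation 0 n"
      unfolding sum_relation_def dims_sum u v mem_Collect_eq by blast
  qed
  moreover have "?G \<subseteq> topspace (sa_top (sa_prod Mspace Nspace))"
    using split_in_N topspace_M by (auto simp: sa_prod_def[of Mspace Nspace])
  moreover have "sa_dim (sa_prod Mspace Nspace) = (n + n) * d"
    by (simp only: sa_prod_def[of Mspace Nspace] sa_space.select_convs dims dims_sum)
  ultimately show ?thesis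
    unfolding sa_map_def sa_subset_def using semialgebraic_sum_relation[of 0 n] split_continuous by simp
qed

theorem stratum_sa_homeomorphic: "sa_homeomorphic Mspace Nspace"
  unfolding sa_homeomorphic_def
  using homeomorphic_maps_split_join sa_map_split sa_map_join by blast

end

text \<open>
  That the stable set is open in its closure means that the points added by the closure form a closed set.
  So the three strata satisfy the separation conditions on which the splitting rests.
\<close>

lemma D_stratum_sa_homeomorphic:
  assumes wf: "wf_sa_space (ambient S)" and sa: "sa_subset (ambient S) (stable S)"
    and open_s: "open_in_closure (sa_top (ambient S)) (Omega_s S)"
  shows "sa_homeomorphic
     (sa_sub (sym_prod (k + l + m) (ambient S)) (D_stratum S k l m))
     (sa_prod (sym_prod k (sa_sub (ambient S) (Omega_s S)))
       (sa_prod (sym_prod l (sa_sub (ambient S) (Omega_ss S)))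
                (sym_prod m (sa_sub (ambient S) (Omega_un S)))))"
proof -
  let ?T = "sa_top (ambient S)"
  have sub: "stable S \<subseteq> ?T closure_of stable S"
    using sa closure_of_subset by (auto simp: sa_subset_def)
  note cl = sa_subset_closure[OF wf sa]
  have "closedin (subtopology ?T (?T closure_of stable S)) (?T closure_of stable S - stable S)"
    using open_s closure_of_subset_topspace[of ?T "stable S"]
    unfolding open_in_closure_def Omega_s_def
    by (metis closedin_diff closedin_topspace topspace_subtopology_subset)
  then have "closedin ?T (Omega_ss S)"
    unfolding Omega_ss_def using closedin_trans_full closedin_closure_of by blast
  then have "three_strata (ambient S) (Omega_s S) (Omega_ss S) (Omega_un S)"
    using wf sa sub sa_subset_Diff[OF cl sa] sa_subset_Diff[OF sa_subset_topspace[OF wf] cl]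
    by unfold_locales (auto simp: Omega_s_def Omega_ss_def Omega_un_def)
  moreover have "D_stratum S k l m = count_stratum (ambient S) (Omega_s S) (Omega_ss S) (Omega_un S) k l m"
    by (simp add: D_stratum_def count_stratum_def)
  ultimately show ?thesis using three_strata.stratum_sa_homeomorphic by simp
qed

theorem proposition7:
  shows "(\<forall>S. stability_theory S \<and> nontrivial S \<and>
              (\<forall>A\<in>Str S. open_in_closure (sa_top (ambient S)) A) \<longrightarrow>
            (\<forall>k l m. sa_homeomorphic
               (sa_sub (sym_prod (k + l + m) (ambient S)) (D_stratum S k l m))
               (sa_prod (sym_prod k (sa_sub (ambient S) (Omega_s S)))
                 (sa_prod (sym_prod l (sa_sub (ambient S) (Omega_ss S)))
                          (sym_prod m (sa_sub (ambient S) (Omega_un S))))))) \<and>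
         (\<forall>S. monic_stability_theory S \<and> nontrivial S \<and>
              (\<forall>A\<in>Str S. open_in_closure (sa_top (ambient S)) A) \<longrightarrow>
            (\<forall>k l m. sa_homeomorphic
               (sa_sub (sym_prod (k + l + m) (ambient S)) (D_stratum S k l m))
               (sa_prod (sym_prod k (sa_sub (ambient S) (Omega_s S)))
                 (sa_prod (sym_prod l (sa_sub (ambient S) (Omega_ss S)))
                          (sym_prod m (sa_sub (ambient S) (Omega_un S)))))))"
proof (intro conjI allI impI)
  fix S :: "cp1 stability_data" and k l m
  assume S: "stability_theory S \<and> nontrivial S \<and> (\<forall>A\<in>Str S. open_in_closure (sa_top (ambient S)) A)"
  show "sa_homeomorphic
     (sa_sub (sym_prod (k + l + m) (ambient S)) (D_stratum S k l m))
     (sa_prod (sym_prod k (sa_sub (ambient S) (Omega_s S)))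
       (sa_prod (sym_prod l (sa_sub (ambient S) (Omega_ss S)))
                (sym_prod m (sa_sub (ambient S) (Omega_un S)))))"
    by (rule D_stratum_sa_homeomorphic) (use S wf_CP1 in \<open>auto simp: stability_theory_def Str_def\<close>)
next
  fix S :: "complex stability_data" and k l m
  assume S: "monic_stability_theory S \<and> nontrivial S \<and>
     (\<forall>A\<in>Str S. open_in_closure (sa_top (ambient S)) A)"
  show "sa_homeomorphic
     (sa_sub (sym_prod (k + l + m) (ambient S)) (D_stratum S k l m))
     (sa_prod (sym_prod k (sa_sub (ambient S) (Omega_s S)))
       (sa_prod (sym_prod l (sa_sub (ambient S) (Omega_ss S)))
                (sym_prod m (sa_sub (ambient S) (Omega_un S)))))"
    by (rule D_stratum_sa_homeomorphic)
       (use S wf_complex_line in \<open>auto simp: monic_stability_theory_def Str_def\<close>)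
qed

end
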